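(* Let $0<\epsilon<1$. The $(1,\epsilon)$-case of restricted assignment makespan minimization admits a polynomial time $(2-\epsilon)$-approximation algorithm; that is, a polynomial time algorithm that on every instance of the $(1,\epsilon)$-case outputs a schedule of makespan at most $(2-\epsilon)\cdot\mathrm{OPT}$, where $\mathrm{OPT}$ is the optimal makespan.
   Context: Restricted assignment makespan minimization: an instance consists of a finite set of machines $M$, a finite set of jobs $J$, a processing time $p_j>0$ for each job $j\in J$, and for each job $j$ a set $\Gamma(j)\subseteq M$ of machines on which it may be scheduled. A schedule is a map $\sigma:J\to M$ with $\sigma(j)\in\Gamma(j)$ for all $j$; its makespan is $\max_{i\in M}\sum_{j\in\sigma^{-1}(i)}p_j$. $\mathrm{OPT}$ denotes the minimum makespan over all schedules. The $(1,\epsilon)$-case is the special case in which every job has processing time $p_j\in\{1,\epsilon\}$. *)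

theory Defs
  imports Complex_Main "HOL-Library.FuncSet" "HOL-Computational_Algebra.Polynomial"
begin

section \<open>Restricted assignment makespan minimization\<close>

record ('m, 'j) assignment_instance =
  machines :: "'m set"
  jobs :: "'j set"
  ptime :: "'j \<Rightarrow> real"
  allowed :: "'j \<Rightarrow> 'm set"

text \<open>There is at least one machine, so that the maximum in the makespan is meaningful. Instances
  without any schedule (some job has no allowed machine) are included.\<close>

definition restricted_assignment :: "('m, 'j) assignment_instance \<Rightarrow> bool" where
  "restricted_assignment I \<longleftrightarrow>
     finite (machines I) \<and> machines I \<noteq> {} \<and> finite (jobs I) \<and>
     (\<forall>j\<in>jobs I. ptime I j > 0 \<and> allowed I j \<subseteq> machines I)"

definition one_eps_case :: "real \<Rightarrow> ('m, 'j) assignment_instance \<Rightarrow> bool" where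
  "one_eps_case \<epsilon> I \<longleftrightarrow> restricted_assignment I \<and> (\<forall>j\<in>jobs I. ptime I j \<in> {1, \<epsilon>})"

text \<open>Schedules are extensional functions on the set of jobs, so there are finitely many of them
  and the minimum below is attained as soon as a schedule exists.\<close>

definition schedules :: "('m, 'j) assignment_instance \<Rightarrow> ('j \<Rightarrow> 'm) set" where
  "schedules I = (\<Pi>\<^sub>E j\<in>jobs I. allowed I j)"

definition makespan :: "('m, 'j) assignment_instance \<Rightarrow> ('j \<Rightarrow> 'm) \<Rightarrow> real" where
  "makespan I \<sigma> = (MAX i\<in>machines I. \<Sum>j\<in>{j \<in> jobs I. \<sigma> j = i}. ptime I j)"

definition OPT :: "('m, 'j) assignment_instance \<Rightarrow> real" where
  "OPT I = (MIN \<sigma>\<in>schedules I. makespan I \<sigma>)"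

section \<open>The machine model\<close>

text \<open>Structured programs for a random access machine over the natural numbers. The memory consists
  of finitely many (those named in the program) unbounded arrays; a scalar variable is an array used
  at one index only. Commands have unit cost. Since expressions are part of the fixed
  program, each command amounts to a bounded number of elementary machine operations. The only
  arithmetic is addition and truncated subtraction: as there is no multiplication, the numbers
  occurring within t steps have O(t) more bits than those in the input, and unit-cost
  polynomial time on these programs is polynomial time on Turing machines.\<close>

type_synonym store = "string \<Rightarrow> nat \<Rightarrow> nat"

datatype expr =
    Const nat
  | Elem string expr
  | Plus expr expr
  | Minus expr expr

primrec val :: "expr \<Rightarrow> store \<Rightarrow> nat" where
  "val (Const k) s = k"
| "val (Elem x e) s = s x (val e s)"
| "val (Plus d e) s = val d s + val e s"
| "val (Minus d e) s = val d s - val e s"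

text \<open>\<open>Assign x d e\<close> stores the value of \<open>e\<close> in array \<open>x\<close> at the index given by \<open>d\<close>; conditions
  are expressions, regarded as true when nonzero.\<close>

datatype prog =
    Skip
  | Assign string expr expr
  | Seq prog prog
  | Cond expr prog prog
  | While expr prog

text \<open>\<open>exec c s t s'\<close>: started in store \<open>s\<close>, program \<open>c\<close> halts after exactly \<open>t\<close> steps in store
  \<open>s'\<close>.\<close>

inductive exec :: "prog \<Rightarrow> store \<Rightarrow> nat \<Rightarrow> store \<Rightarrow> bool" where
  Skip: "exec Skip s 1 s"
| Assign: "exec (Assign x d e) s 1 (s(x := (s x)(val d s := val e s)))"
| Seq: "exec c s t s' \<Longrightarrow> exec c' s' t' s'' \<Longrightarrow> exec (Seq c c') s (t + t') s''"
| CondTrue: "val e s \<noteq> 0 \<Longrightarrow> exec c s t s' \<Longrightarrow> exec (Cond e c c') s (t + 1) s'"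
| CondFalse: "val e s = 0 \<Longrightarrow> exec c' s t s' \<Longrightarrow> exec (Cond e c c') s (t + 1) s'"
| WhileFalse: "val e s = 0 \<Longrightarrow> exec (While e c) s 1 s"
| WhileTrue: "val e s \<noteq> 0 \<Longrightarrow> exec c s t s' \<Longrightarrow> exec (While e c) s' t' s'' \<Longrightarrow>
    exec (While e c) s (t + t' + 1) s''"

inductive_cases exec_SkipE: "exec Skip s t s'"
inductive_cases exec_AssignE: "exec (Assign x d e) s t s'"
inductive_cases exec_SeqE: "exec (Seq c c') s t s'"
inductive_cases exec_CondE: "exec (Cond e c c') s t s'"
inductive_cases exec_WhileE: "exec (While e c) s t s'"

lemma exec_deterministic:
  "exec c s t s' \<Longrightarrow> exec c s u s'' \<Longrightarrow> u = t \<and> s'' = s'"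
proof (induction arbitrary: u s'' rule: exec.induct)
  case (Skip s)
  then show ?case by (rule exec_SkipE) simp
next
  case (Assign x d e s)
  then show ?case by (rule exec_AssignE) simp
next
  case (Seq c s t s' c' t' s2)
  from Seq.prems obtain a r b where *: "exec c s a r" "exec c' r b s''" and u: "u = a + b"
    by (rule exec_SeqE)
  from Seq.IH(1)[OF *(1)] have "a = t" "r = s'" by simp_all
  with Seq.IH(2)[of b s''] * u show ?case by simp
next
  case (CondTrue e s c t s' c')
  from CondTrue.prems obtain a where "exec c s a s''" and u: "u = a + 1"
    by (rule exec_CondE) (use CondTrue.hyps(1) in simp_all)
  with CondTrue.IH[of a s''] show ?case by simp
next
  case (CondFalse e s c' t s' c)
  from CondFalse.prems obtain a where "exec c' s a s''" and u: "u = a + 1"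
    by (rule exec_CondE) (use CondFalse.hyps(1) in simp_all)
  with CondFalse.IH[of a s''] show ?case by simp
next
  case (WhileFalse e s c)
  from WhileFalse.prems show ?case by (rule exec_WhileE) (use WhileFalse.hyps in simp_all)
next
  case (WhileTrue e s c t s' t' s2)
  from WhileTrue.prems obtain a r b
    where *: "exec c s a r" "exec (While e c) r b s''" and u: "u = a + b + 1"
    by (rule exec_WhileE) (use WhileTrue.hyps(1) in simp_all)
  from WhileTrue.IH(1)[OF *(1)] have "a = t" "r = s'" by simp_all
  with WhileTrue.IH(2)[of b s''] * u show ?case by simp
qed

definition input_store :: "nat list \<Rightarrow> store" where
  "input_store xs x i = (if x = ''in'' \<and> i < length xs then xs ! i else 0)"

section \<open>Approximation algorithms for the two-valued case\<close>

text \<open>To be given to an algorithm, machines and jobs are numbered consecutively from 0.\<close>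

definition numbered :: "(nat, nat) assignment_instance \<Rightarrow> bool" where
  "numbered I \<longleftrightarrow> machines I = {..<card (machines I)} \<and> jobs I = {..<card (jobs I)}"

text \<open>The input consists of the number of machines, the number of jobs, for every job a flag telling
  whether its processing time is 1 (rather than \<open>\<epsilon>\<close>), and for every job a row with
  the characteristic vector of its set of allowed machines.\<close>

definition encode :: "(nat, nat) assignment_instance \<Rightarrow> nat list" where
  "encode I = (let m = card (machines I); n = card (jobs I) in
     [m, n] @ map (\<lambda>j. of_bool (ptime I j = 1)) [0..<n] @
     concat (map (\<lambda>j. map (\<lambda>i. of_bool (i \<in> allowed I j)) [0..<m]) [0..<n]))"

text \<open>The size does not exceed the length of any explicit listing of the machines, the jobs and the
  sets of allowed machines; the length of the list above is polynomial in it.\<close>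

definition instance_size :: "('m, 'j) assignment_instance \<Rightarrow> nat" where
  "instance_size I = card (machines I) + card (jobs I) + (\<Sum>j\<in>jobs I. card (allowed I j))"

definition output_schedule :: "(nat, nat) assignment_instance \<Rightarrow> store \<Rightarrow> nat \<Rightarrow> nat" where
  "output_schedule I s = restrict (s ''out'') (jobs I)"

text \<open>The program has to halt in polynomial time on every instance; it has to output a schedule
  within factor \<open>\<alpha>\<close> of the optimum whenever a schedule exists.\<close>

definition poly_time_approximation :: "real \<Rightarrow> real \<Rightarrow> prog \<Rightarrow> bool" where
  "poly_time_approximation \<epsilon> \<alpha> A \<longleftrightarrow>
     (\<exists>q :: nat poly. \<forall>I. one_eps_case \<epsilon> I \<and> numbered I \<longrightarrow>
        (\<exists>t s. exec A (input_store (encode I)) t s \<and>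
               t \<le> poly q (instance_size I) \<and>
               (schedules I \<noteq> {} \<longrightarrow>
                  output_schedule I s \<in> schedules I \<and>
                  makespan I (output_schedule I s) \<le> \<alpha> * OPT I)))"

end

theory Submission
  imports Defs
begin

text \<open>
  Let machine \<open>i\<close> get \<open>N\<close> jobs, \<open>B\<close> of them big, in a schedule of makespan \<open>T\<close>. Then \<open>B \<le> T\<close> and
  \<open>\<epsilon> N \<le> T\<close>. Conversely, if just these two bounds hold, the load is
  \<open>(1 - \<epsilon>) B + \<epsilon> N \<le> (2 - \<epsilon>) T\<close>; and assignments subject to these bounds are bipartite matchings of
  jobs to slots, \<open>\<lfloor>T / \<epsilon>\<rfloor>\<close> per machine, \<open>\<lfloor>T\<rfloor>\<close> of which take big jobs. So it suffices to find the
  least \<open>T\<close> for which there is a matching.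

  As \<open>\<epsilon>\<close> may be uncomputable, the program compares numbers of big and small jobs by means of a
  rational \<open>p / q\<close> slightly above \<open>\<epsilon>\<close>. This is exact for \<open>T \<le> K\<close>, with \<open>K\<close> a constant. For larger
  \<open>T\<close> a makespan of \<open>T + 1\<close> for processing times \<open>1\<close> and \<open>p / q\<close> is good enough: cut big jobs into \<open>q\<close>
  and small ones into \<open>p\<close> units and match the units to \<open>T q\<close> slots per machine. If machine \<open>i\<close> gets \<open>U\<close>
  units of big and \<open>W\<close> units of small jobs, there is a fractional and hence an integral assignment
  with at most \<open>\<lceil>U / q\<rceil>\<close> big jobs and at most \<open>\<lceil>U / q + W / p\<rceil>\<close> jobs on machine \<open>i\<close>.

  Matchings are computed by an auction. If it gets stuck it yields a violation of Hall's condition,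
  which excludes fractional assignments as well.
\<close>

section \<open>Reasoning about programs\<close>

text \<open>The counting argument already spends the whole factor \<open>2 - \<epsilon>\<close>, so
  it leaves no room for replacing \<open>\<epsilon>\<close> by another number. It uses
  \<open>\<epsilon>\<close> only to compare \<open>b\<close> big with \<open>t\<close> small jobs,
  however, and while \<open>b \<le> K\<close> a rational slightly above \<open>\<epsilon>\<close>
  decides all these comparisons correctly. For irrational \<open>\<epsilon>\<close> no rational does
  so for all \<open>b\<close>. For a large optimum the factor is merely \<open>1 + 1 / K\<close> for
  the rounding times at most \<open>p / (q * \<epsilon>)\<close> for the inexact processing time,
  and the gap up to \<open>2 - \<epsilon>\<close> pays for both. Thus \<open>K\<close> is chosen
  first, to fit this gap, and \<open>p / q\<close> next, to fit \<open>K\<close>; all three depend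
  on \<open>\<epsilon>\<close> alone and are constants of the program.

  In the program makespans are measured in units of \<open>1 / q\<close>, so that only the natural
  numbers up to \<open>n * q\<close> have to be tried. Success at some \<open>T\<close> need not
  persist when \<open>T\<close> crosses the threshold \<open>K * q\<close> between the two
  relaxations; the analysis therefore uses only that all smaller values have failed.\<close>

primrec assigned :: "prog \<Rightarrow> string set" where
  "assigned Skip = {}"
| "assigned (Assign x d e) = {x}"
| "assigned (Seq c c') = assigned c \<union> assigned c'"
| "assigned (Cond e c c') = assigned c \<union> assigned c'"
| "assigned (While e c) = assigned c"

lemma exec_frame: "exec c s t s' \<Longrightarrow> x \<notin> assigned c \<Longrightarrow> s' x = s x"
  by (induction rule: exec.induct) auto

text \<open>Execution is deterministic, so this existential is the weakest precondition of total
  correctness, and the rules below can be equivalences. The postcondition also sees the number of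
  steps.\<close>

definition wp :: "prog \<Rightarrow> (nat \<Rightarrow> store \<Rightarrow> bool) \<Rightarrow> store \<Rightarrow> bool" where
  "wp c Q s \<longleftrightarrow> (\<exists>t s'. exec c s t s' \<and> Q t s')"

lemma wp_mono: "wp c Q s \<Longrightarrow> (\<And>t s'. Q t s' \<Longrightarrow> Q' t s') \<Longrightarrow> wp c Q' s"
  unfolding wp_def by blast

lemma wp_frame:
  "wp c Q s \<Longrightarrow> wp c (\<lambda>t s'. Q t s' \<and> (\<forall>x. x \<notin> assigned c \<longrightarrow> s' x = s x)) s"
  unfolding wp_def using exec_frame by blast

lemma wp_Skip [simp]: "wp Skip Q s \<longleftrightarrow> Q 1 s"
  unfolding wp_def by (metis exec.Skip exec_deterministic)

lemma wp_Assign [simp]: "wp (Assign x d e) Q s \<longleftrightarrow> Q 1 (s(x := (s x)(val d s := val e s)))"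
  unfolding wp_def by (metis exec.Assign exec_deterministic)

lemma wp_Seq [simp]: "wp (Seq c c') Q s \<longleftrightarrow> wp c (\<lambda>t. wp c' (\<lambda>t'. Q (t + t'))) s"
proof
  assume "wp (Seq c c') Q s"
  then show "wp c (\<lambda>t. wp c' (\<lambda>t'. Q (t + t'))) s"
    unfolding wp_def by (blast elim: exec_SeqE)
next
  assume "wp c (\<lambda>t. wp c' (\<lambda>t'. Q (t + t'))) s"
  then show "wp (Seq c c') Q s"
    unfolding wp_def by (blast intro: exec.Seq)
qed

lemma wp_Cond [simp]:
  "wp (Cond e c c') Q s \<longleftrightarrow>
     (if val e s \<noteq> 0 then wp c (\<lambda>t. Q (t + 1)) s else wp c' (\<lambda>t. Q (t + 1)) s)"
proof
  assume "wp (Cond e c c') Q s"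
  then obtain t s' where "exec (Cond e c c') s t s'" "Q t s'" unfolding wp_def by blast
  then show "if val e s \<noteq> 0 then wp c (\<lambda>t. Q (t + 1)) s else wp c' (\<lambda>t. Q (t + 1)) s"
    unfolding wp_def by (cases rule: exec_CondE[of e c c' s t s']) auto
next
  assume *: "if val e s \<noteq> 0 then wp c (\<lambda>t. Q (t + 1)) s else wp c' (\<lambda>t. Q (t + 1)) s"
  show "wp (Cond e c c') Q s"
  proof (cases "val e s = 0")
    case True
    with * obtain t s' where "exec c' s t s'" "Q (t + 1) s'" unfolding wp_def by auto
    with exec.CondFalse[OF True this(1)] show ?thesis unfolding wp_def by blast
  next
    case False
    with * obtain t s' where "exec c s t s'" "Q (t + 1) s'" unfolding wp_def by auto
    with exec.CondTrue[OF False this(1)] show ?thesis unfolding wp_def by blast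
  qed
qed

lemma wp_While_unfold:
  "wp (While e c) Q s \<longleftrightarrow>
     (if val e s \<noteq> 0 then wp c (\<lambda>t. wp (While e c) (\<lambda>t'. Q (t + t' + 1))) s else Q 1 s)"
proof
  assume "wp (While e c) Q s"
  then obtain t s' where "exec (While e c) s t s'" "Q t s'" unfolding wp_def by blast
  then show "if val e s \<noteq> 0 then wp c (\<lambda>t. wp (While e c) (\<lambda>t'. Q (t + t' + 1))) s else Q 1 s"
    unfolding wp_def by (cases rule: exec_WhileE[of e c s t s']) (simp_all, blast)
next
  assume *: "if val e s \<noteq> 0 then wp c (\<lambda>t. wp (While e c) (\<lambda>t'. Q (t + t' + 1))) s else Q 1 s"
  show "wp (While e c) Q s"
  proof (cases "val e s = 0")
    case True
    with * exec.WhileFalse[OF True] show ?thesis unfolding wp_def by auto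
  next
    case False
    with * obtain t r t' s' where "exec c s t r" "exec (While e c) r t' s'" "Q (t + t' + 1) s'"
      unfolding wp_def by auto
    with exec.WhileTrue[OF False this(1,2)] show ?thesis unfolding wp_def by blast
  qed
qed

text \<open>The variant \<open>f\<close> bounds the number of rounds by \<open>N\<close>; a round
  costs at most \<open>B\<close> steps and one for the test, and the failing test adds the last one.
  In \<open>step\<close> the arrays not assigned by the body still have their initial contents,
  which spares invariants from saying so.\<close>

lemma wp_While:
  fixes f :: "store \<Rightarrow> nat"
  assumes "I s" and "f s \<le> N"
    and step: "\<And>s'. I s' \<Longrightarrow> (\<forall>x. x \<notin> assigned c \<longrightarrow> s' x = s x) \<Longrightarrow> val e s' \<noteq> 0 \<Longrightarrow>
      wp c (\<lambda>t s''. t \<le> B \<and> I s'' \<and> f s'' < f s') s'"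
  shows "wp (While e c) (\<lambda>t s'. t \<le> N * (B + 1) + 1 \<and> I s' \<and> val e s' = 0 \<and>
    (\<forall>x. x \<notin> assigned c \<longrightarrow> s' x = s x)) s"
proof -
  have "wp (While e c) (\<lambda>t s'. t \<le> f r * (B + 1) + 1 \<and> I s' \<and> val e s' = 0) r"
    if "I r" "\<forall>x. x \<notin> assigned c \<longrightarrow> r x = s x" for r
    using that
  proof (induction "f r" arbitrary: r rule: less_induct)
    case less
    show ?case
    proof (cases "val e r = 0")
      case True
      then show ?thesis using less.prems by (subst wp_While_unfold) simp
    next
      case False
      have "wp c (\<lambda>t r'. wp (While e c) (\<lambda>t' s'. t + t' + 1 \<le> f r * (B + 1) + 1 \<and> I s' \<and>
          val e s' = 0) r') r"
      proof (rule wp_mono[OF wp_frame[OF step[OF less.prems False]]])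
        fix t r'
        assume r': "(t \<le> B \<and> I r' \<and> f r' < f r) \<and> (\<forall>x. x \<notin> assigned c \<longrightarrow> r' x = r x)"
        have "Suc (f r') * (B + 1) \<le> f r * (B + 1)"
          using r' by (intro mult_le_mono1) simp
        then have "t + t' + 1 \<le> f r * (B + 1) + 1" if "t' \<le> f r' * (B + 1) + 1" for t'
          using that r' by simp
        then show "wp (While e c) (\<lambda>t' s'. t + t' + 1 \<le> f r * (B + 1) + 1 \<and> I s' \<and> val e s' = 0) r'"
          using less.hyps[of r'] less.prems(2) r' by (auto elim!: wp_mono)
      qed
      with False show ?thesis by (subst wp_While_unfold) simp
    qed
  qed
  then have "wp (While e c) (\<lambda>t s'. (t \<le> f s * (B + 1) + 1 \<and> I s' \<and> val e s' = 0) \<and>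
      (\<forall>x. x \<notin> assigned (While e c) \<longrightarrow> s' x = s x)) s"
    using assms(1) by (intro wp_frame) simp
  moreover have "f s * (B + 1) \<le> N * (B + 1)" using assms(2) by (rule mult_le_mono1)
  ultimately show ?thesis by (elim wp_mono) auto
qed

notation Seq (infixr ";;" 60)

abbreviation V :: "string \<Rightarrow> expr" where "V x \<equiv> Elem x (Const 0)"

abbreviation Put :: "string \<Rightarrow> expr \<Rightarrow> prog" where "Put x e \<equiv> Assign x (Const 0) e"

definition For :: "string \<Rightarrow> expr \<Rightarrow> prog \<Rightarrow> prog" where
  "For x e c = Put x (Const 0) ;;
     While (Minus e (V x)) (c ;; Put x (Plus (V x) (Const 1)))"

lemma assigned_For [simp]: "assigned (For x e c) = insert x (assigned c)"
  by (auto simp: For_def)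

text \<open>Per round, 2 is added for the test and for the increment of the counter; the other 2
  steps are the initialization and the failing test. As \<open>e\<close> is evaluated anew in each
  round, \<open>bound\<close> asks for its value in every store the loop can reach.\<close>

lemma wp_For:
  assumes init: "I 0 (s(x := (s x)(0 := 0)))"
    and fresh: "x \<notin> assigned c"
    and bound: "\<And>s'. (\<forall>y. y \<noteq> x \<and> y \<notin> assigned c \<longrightarrow> s' y = s y) \<Longrightarrow> val e s' = N"
    and step: "\<And>k s'. k < N \<Longrightarrow> I k s' \<Longrightarrow> s' x 0 = k \<Longrightarrow>
      (\<forall>y. y \<noteq> x \<and> y \<notin> assigned c \<longrightarrow> s' y = s y) \<Longrightarrow>
      wp c (\<lambda>t s''. t \<le> B \<and> I (Suc k) (s''(x := (s'' x)(0 := Suc k)))) s'"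
  shows "wp (For x e c) (\<lambda>t s'. t \<le> N * (B + 2) + 2 \<and> I N s' \<and>
    (\<forall>y. y \<noteq> x \<and> y \<notin> assigned c \<longrightarrow> s' y = s y)) s"
proof -
  let ?c = "c ;; Put x (Plus (V x) (Const 1))"
  let ?s = "s(x := (s x)(0 := 0))"
  have "wp (While (Minus e (V x)) ?c)
      (\<lambda>t s'. t \<le> N * ((B + 1) + 1) + 1 \<and> (I (s' x 0) s' \<and> s' x 0 \<le> N) \<and>
        val (Minus e (V x)) s' = 0 \<and> (\<forall>y. y \<notin> assigned ?c \<longrightarrow> s' y = ?s y)) ?s"
  proof (rule wp_While[where f = "\<lambda>s'. N - s' x 0"])
    fix r
    assume I: "I (r x 0) r \<and> r x 0 \<le> N"
      and fr: "\<forall>y. y \<notin> assigned ?c \<longrightarrow> r y = ?s y"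
      and cond: "val (Minus e (V x)) r \<noteq> 0"
    have fr': "\<forall>y. y \<noteq> x \<and> y \<notin> assigned c \<longrightarrow> r y = s y" using fr by auto
    from bound[OF fr'] cond have lt: "r x 0 < N" by simp
    have "wp c (\<lambda>t s''. (t \<le> B \<and> I (Suc (r x 0)) (s''(x := (s'' x)(0 := Suc (r x 0))))) \<and>
        (\<forall>y. y \<notin> assigned c \<longrightarrow> s'' y = r y)) r"
      using lt I fr' by (intro wp_frame step) auto
    then show "wp ?c (\<lambda>t s''. t \<le> B + 1 \<and> (I (s'' x 0) s'' \<and> s'' x 0 \<le> N) \<and>
        N - s'' x 0 < N - r x 0) r"
      using lt fresh unfolding wp_Seq wp_Assign by (auto elim!: wp_mono)
  next
    show "I (?s x 0) ?s \<and> ?s x 0 \<le> N" using init by simp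
  qed auto
  then show ?thesis
    unfolding For_def wp_Seq wp_Assign val.simps(1)
  proof (elim wp_mono)
    fix t s'
    assume *: "t \<le> N * ((B + 1) + 1) + 1 \<and> (I (s' x 0) s' \<and> s' x 0 \<le> N) \<and>
        val (Minus e (V x)) s' = 0 \<and> (\<forall>y. y \<notin> assigned ?c \<longrightarrow> s' y = ?s y)"
    then have fr: "\<forall>y. y \<noteq> x \<and> y \<notin> assigned c \<longrightarrow> s' y = s y" by simp
    from bound[OF fr] * have "s' x 0 = N" by simp
    with * fr show "1 + t \<le> N * (B + 2) + 2 \<and> I N s' \<and>
        (\<forall>y. y \<noteq> x \<and> y \<notin> assigned c \<longrightarrow> s' y = s y)" by simp
  qed
qed

section \<open>Bipartite matching\<close>

text \<open>Left vertices are copies of jobs; right vertices are slots of machines, and the slots \<open>r\<close> with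
  \<open>any r = 0\<close> are reserved for small jobs.\<close>

definition edge :: "store \<Rightarrow> nat \<Rightarrow> nat \<Rightarrow> bool" where
  "edge s l r \<longleftrightarrow> s ''in'' (2 + s ''job'' l) - s ''any'' r < s ''in'' (s ''row'' (s ''job'' l) + s ''mach'' r)"

text \<open>Truncated subtraction serves as conjunction with a negation: the inner difference is
  nonzero iff the job is big and the slot is reserved, the outer one iff the machine is allowed and
  the inner one vanishes. The array \<open>c\<close> holds the left vertex plus one.\<close>

definition edge_expr :: expr where
  "edge_expr = (let j = Elem ''job'' (Minus (V ''c'') (Const 1)) in
     Minus (Elem ''in'' (Plus (Elem ''row'' j) (Elem ''mach'' (V ''r''))))
       (Minus (Elem ''in'' (Plus (Const 2) j)) (Elem ''any'' (V ''r''))))"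

text \<open>The value \<open>R\<close> of \<open>low\<close> stands for "nothing found": only
  neighbours with labels below \<open>R\<close> are recorded, so a vertex whose label has reached
  \<open>R\<close> is never taken again.\<close>

definition scan :: prog where
  "scan = Put ''best'' (V ''R'') ;; Put ''low'' (V ''R'') ;;
     For ''r'' (V ''R'') (Cond edge_expr
       (Cond (Minus (V ''low'') (Elem ''d'' (V ''r'')))
         (Put ''best'' (V ''r'') ;; Put ''low'' (Elem ''d'' (V ''r''))) Skip) Skip)"

lemma val_edge_expr: "s ''c'' 0 = Suc l \<Longrightarrow> val edge_expr s > 0 \<longleftrightarrow> edge s l (s ''r'' 0)"
  by (simp add: edge_expr_def edge_def Let_def)

lemma edge_cong:
  "(\<And>x. x \<in> {''in'', ''job'', ''any'', ''row'', ''mach''} \<Longrightarrow> s' x = s x) \<Longrightarrow> edge s' = edge s"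
  by (simp add: edge_def fun_eq_iff)

lemma wp_scan:
  assumes c: "s ''c'' 0 = Suc l" and R: "s ''R'' 0 = R"
  shows "wp scan (\<lambda>t s'. t \<le> R * 6 + 4 \<and>
    s' ''low'' 0 \<le> R \<and> (\<forall>r<R. edge s l r \<longrightarrow> s' ''low'' 0 \<le> s ''d'' r) \<and>
    (s' ''low'' 0 < R \<longrightarrow> s' ''best'' 0 < R \<and> edge s l (s' ''best'' 0) \<and> s ''d'' (s' ''best'' 0) = s' ''low'' 0) \<and>
    (\<forall>x. x \<notin> {''best'', ''low'', ''r''} \<longrightarrow> s' x = s x)) s"
proof -
  let ?I = "\<lambda>k s'. s' ''low'' 0 \<le> R \<and>
    (\<forall>r<k. edge s l r \<longrightarrow> s' ''low'' 0 \<le> s ''d'' r) \<and>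
    (s' ''low'' 0 < R \<longrightarrow> s' ''best'' 0 < k \<and> edge s l (s' ''best'' 0) \<and> s ''d'' (s' ''best'' 0) = s' ''low'' 0)"
  let ?c = "Cond edge_expr
       (Cond (Minus (V ''low'') (Elem ''d'' (V ''r'')))
         (Put ''best'' (V ''r'') ;; Put ''low'' (Elem ''d'' (V ''r''))) Skip) Skip"
  define s1 where "s1 = s(''best'' := (s ''best'')(0 := R), ''low'' := (s ''low'')(0 := R))"
  have "wp (For ''r'' (V ''R'') ?c) (\<lambda>t s'. t \<le> R * (4 + 2) + 2 \<and> ?I R s' \<and>
      (\<forall>y. y \<noteq> ''r'' \<and> y \<notin> assigned ?c \<longrightarrow> s' y = s1 y)) s1"
  proof (rule wp_For[where I = ?I])
    fix k s'
    assume I: "?I k s'" and k: "s' ''r'' 0 = k"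
      and fr: "\<forall>y. y \<noteq> ''r'' \<and> y \<notin> assigned ?c \<longrightarrow> s' y = s1 y"
    have "edge s' = edge s" by (rule edge_cong) (use fr in \<open>auto simp: s1_def\<close>)
    moreover have "s' ''c'' 0 = Suc l" "s' ''d'' = s ''d''" using fr c by (auto simp: s1_def)
    ultimately show "wp ?c (\<lambda>t s''. t \<le> 4 \<and> ?I (Suc k) (s''(''r'' := (s'' ''r'')(0 := Suc k)))) s'"
      using I k by (auto simp: val_edge_expr less_Suc_eq)
  qed (simp_all add: s1_def R)
  then show ?thesis
    unfolding scan_def wp_Seq wp_Assign val.simps R s1_def[symmetric]
    by (simp add: s1_def R) (elim wp_mono, auto simp: s1_def)
qed

section \<open>The auction: invariant, progress and violations of Hall's condition\<close>

definition hall_violation :: "(nat \<Rightarrow> nat \<Rightarrow> bool) \<Rightarrow> nat \<Rightarrow> nat \<Rightarrow> bool" where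
  "hall_violation E L R \<longleftrightarrow> (\<exists>X\<subseteq>{..<L}. card {r. r < R \<and> (\<exists>l\<in>X. E l r)} < card X)"

text \<open>A right vertex \<open>r\<close> matched to \<open>l\<close> has \<open>a r = l + 1\<close>, and \<open>a r = 0\<close> if it is unmatched.\<close>

definition matching :: "(nat \<Rightarrow> nat \<Rightarrow> bool) \<Rightarrow> nat \<Rightarrow> nat \<Rightarrow> (nat \<Rightarrow> nat) \<Rightarrow> bool" where
  "matching E L R a \<longleftrightarrow>
     (\<forall>r<R. a r \<le> L \<and> (a r \<noteq> 0 \<longrightarrow> E (a r - 1) r \<and> (\<forall>r'<R. a r' = a r \<longrightarrow> r' = r))) \<and>
     (\<forall>l<L. \<exists>r<R. a r = Suc l)"

text \<open>The left vertices below \<open>nxt\<close> are matched, with the exception of \<open>c - 1\<close> if \<open>c \<noteq> 0\<close>. A vertex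
  takes a neighbour of minimal label \<open>d\<close>, which is then raised by one; so labels of other neighbours
  of a matched vertex are at most one below that of its partner.\<close>

definition auction_inv ::
  "(nat \<Rightarrow> nat \<Rightarrow> bool) \<Rightarrow> nat \<Rightarrow> nat \<Rightarrow> nat \<Rightarrow> nat \<Rightarrow> (nat \<Rightarrow> nat) \<Rightarrow> (nat \<Rightarrow> nat) \<Rightarrow> bool" where
  "auction_inv E L R nxt c a d \<longleftrightarrow>
     nxt \<le> L \<and> c \<le> nxt \<and>
     (\<forall>l<nxt. Suc l = c \<or> (\<exists>r<R. a r = Suc l)) \<and>
     (\<forall>r<R. a r \<le> nxt \<and> d r \<le> R \<and> (a r = 0 \<longrightarrow> d r = 0) \<and>
       (a r \<noteq> 0 \<longrightarrow> a r \<noteq> c \<and> E (a r - 1) r \<and>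
         (\<forall>r'<R. E (a r - 1) r' \<longrightarrow> d r \<le> d r' + 1) \<and> (\<forall>r'<R. a r' = a r \<longrightarrow> r' = r)))"

lemma auction_inv_init:
  "(\<And>r. r < R \<Longrightarrow> a r = 0 \<and> d r = 0) \<Longrightarrow> auction_inv E L R 0 0 a d"
  by (simp add: auction_inv_def)

lemma auction_inv_next:
  "auction_inv E L R nxt 0 a d \<Longrightarrow> nxt < L \<Longrightarrow> auction_inv E L R (Suc nxt) (Suc nxt) a d"
  unfolding auction_inv_def by (auto simp: less_Suc_eq le_Suc_eq)

lemma auction_inv_final: "auction_inv E L R L 0 a d \<Longrightarrow> matching E L R a"
  by (simp add: auction_inv_def matching_def)

text \<open>By minimality of \<open>d b\<close>, the raised label is at most one above the labels of
  all neighbours of \<open>l\<close>. For the other matched vertices raising a label only weakens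
  the requirement, and the former partner of \<open>b\<close>, now the pending vertex
  \<open>a b\<close>, is no longer subject to it. If \<open>b\<close> was free,
  \<open>a b = 0\<close> says that nothing is pending.\<close>

lemma auction_inv_take:
  assumes inv: "auction_inv E L R nxt (Suc l) a d" and b: "b < R" "E l b" "d b < R"
    and min: "\<And>r. r < R \<Longrightarrow> E l r \<Longrightarrow> d b \<le> d r"
  shows "auction_inv E L R nxt (a b) (a(b := Suc l)) (d(b := Suc (d b)))"
proof -
  have 1: "Suc l \<le> nxt" "nxt \<le> L" and 2: "\<And>k. k < nxt \<Longrightarrow> k = l \<or> (\<exists>r<R. a r = Suc k)"
    and 3: "\<And>r. r < R \<Longrightarrow> a r \<le> nxt" "\<And>r. r < R \<Longrightarrow> d r \<le> R" "\<And>r. r < R \<Longrightarrow> a r = 0 \<Longrightarrow> d r = 0"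
    and 4: "\<And>r. r < R \<Longrightarrow> a r \<noteq> Suc l" "\<And>r. r < R \<Longrightarrow> a r \<noteq> 0 \<Longrightarrow> E (a r - 1) r"
    and 5: "\<And>r r'. r < R \<Longrightarrow> a r \<noteq> 0 \<Longrightarrow> r' < R \<Longrightarrow> E (a r - 1) r' \<Longrightarrow> d r \<le> d r' + 1"
    and 6: "\<And>r r'. r < R \<Longrightarrow> a r \<noteq> 0 \<Longrightarrow> r' < R \<Longrightarrow> a r' = a r \<Longrightarrow> r' = r"
    using inv unfolding auction_inv_def by auto
  show ?thesis
    unfolding auction_inv_def
  proof (intro conjI allI impI)
    fix k assume "k < nxt"
    with 2[of k] show "Suc k = a b \<or> (\<exists>r<R. (a(b := Suc l)) r = Suc k)"
    proof (cases "k = l")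
      case True
      then show ?thesis using b(1) by (intro disjI2 exI[of _ b]) simp
    next
      case False
      with 2[OF \<open>k < nxt\<close>] obtain r where "r < R" "a r = Suc k" by blast
      then show ?thesis by (cases "r = b") auto
    qed
  next
    fix r r' assume "r < R" "(a(b := Suc l)) r \<noteq> 0" "r' < R" "E ((a(b := Suc l)) r - 1) r'"
    then show "(d(b := Suc (d b))) r \<le> (d(b := Suc (d b))) r' + 1"
      using 5[of r r'] min[of r'] by (auto split: if_splits)
  next
    fix r r' assume "r < R" "(a(b := Suc l)) r \<noteq> 0" "r' < R" "(a(b := Suc l)) r' = (a(b := Suc l)) r"
    then show "r' = r" using 6[of r r'] 4(1) by (metis fun_upd_apply)
  next
    fix r assume "r < R" "(a(b := Suc l)) r \<noteq> 0"
    then show "(a(b := Suc l)) r \<noteq> a b"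
      using 4(1)[OF b(1)] 6[OF _ _ b(1), of r] by (metis fun_upd_apply)
  next
    show "a b \<le> nxt" using 3(1) b(1) .
  next
    fix r assume "r < R"
    then show "(a(b := Suc l)) r \<le> nxt" "(d(b := Suc (d b))) r \<le> R"
      "(a(b := Suc l)) r = 0 \<Longrightarrow> (d(b := Suc (d b))) r = 0"
      "(a(b := Suc l)) r \<noteq> 0 \<Longrightarrow> E ((a(b := Suc l)) r - 1) r"
      using 1(1) 3 4(2) b by (auto split: if_splits)
  qed (rule 1(2))
qed

text \<open>Some label below \<open>R\<close> is not attained; the vertices whose partners have larger labels, along with
  \<open>l\<close>, have no neighbours other than these partners.\<close>

lemma auction_inv_fail:
  assumes inv: "auction_inv E L R nxt (Suc l) a d" and "\<And>r. r < R \<Longrightarrow> E l r \<Longrightarrow> R \<le> d r"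
  shows "hall_violation E L R"
proof (cases "\<exists>r<R. E l r")
  case False
  then have "{r. r < R \<and> (\<exists>k\<in>{l}. E k r)} = {}" by auto
  moreover have "l < L" using inv by (simp add: auction_inv_def)
  ultimately show ?thesis
    unfolding hall_violation_def by (intro exI[of _ "{l}"]) simp
next
  case True
  then obtain r0 where "r0 < R" "E l r0" by blast
  with assms have r0: "d r0 = R" by (fastforce simp: auction_inv_def)
  \<comment> \<open>Pigeonhole: \<open>R\<close> vertices cannot carry all of the
    \<open>R + 1\<close> labels from 0 to \<open>R\<close>, and \<open>R\<close> itself is carried
    by \<open>r0\<close>.\<close>
  have "\<exists>k<R. k \<notin> d ` {..<R}"
  proof (rule ccontr)
    assume "\<not> (\<exists>k<R. k \<notin> d ` {..<R})"
    then have "{..R} \<subseteq> d ` {..<R}"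
      using r0 \<open>r0 < R\<close> by (auto simp: le_less image_iff)
    then have "card {..R} \<le> card (d ` {..<R})" by (intro card_mono) auto
    also have "\<dots> \<le> R" using card_image_le[of "{..<R}" d] by simp
    finally show False by simp
  qed
  then obtain k where k: "k < R" "\<And>r. r < R \<Longrightarrow> d r \<noteq> k" by blast
  define Y where "Y = {r. r < R \<and> k < d r}"
  \<comment> \<open>A label above \<open>k\<close> is positive, and unmatched vertices have label
    0.\<close>
  have Y: "r < R" "a r \<noteq> 0" "a r \<noteq> Suc l" "a r \<le> L" if "r \<in> Y" for r
    using that inv by (auto simp: Y_def auction_inv_def)
  define X where "X = insert l ((\<lambda>r. a r - 1) ` Y)"
  have "inj_on (\<lambda>r. a r - 1) Y"
  proof (rule inj_onI)
    fix r r' assume r: "r \<in> Y" "r' \<in> Y" and "a r - 1 = a r' - 1"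
    then have "a r = a r'" using Y(2)[OF r(1)] Y(2)[OF r(2)] by simp
    then show "r = r'" using inv Y(1,2) r unfolding auction_inv_def by metis
  qed
  moreover have "l \<notin> (\<lambda>r. a r - 1) ` Y" using Y(2,3) by force
  moreover have fin: "finite Y" by (simp add: Y_def)
  ultimately have "card X = Suc (card Y)" by (simp add: X_def card_image)
  moreover have "{r. r < R \<and> (\<exists>l\<in>X. E l r)} \<subseteq> Y"
  proof
    fix r assume "r \<in> {r. r < R \<and> (\<exists>l\<in>X. E l r)}"
    then obtain l' where r: "r < R" "l' \<in> X" "E l' r" by blast
    show "r \<in> Y"
    proof (cases "l' = l")
      case True
      with assms(2) r k(1) show ?thesis by (fastforce simp: Y_def)
    next
      case False
      then obtain r' where r': "r' \<in> Y" "l' = a r' - 1" using r(2) by (auto simp: X_def)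
      then have "d r' \<le> d r + 1"
        using inv Y[OF r'(1)] r unfolding auction_inv_def by blast
      \<comment> \<open>From \<open>k < d r'\<close> only \<open>k \<le> d r\<close> follows;
        equality is excluded because \<open>k\<close> is not attained.\<close>
      then show ?thesis using r' k(2)[OF r(1)] r(1) by (simp add: Y_def)
    qed
  qed
  then have "card {r. r < R \<and> (\<exists>l\<in>X. E l r)} \<le> card Y" using fin by (rule card_mono[rotated])
  moreover have "X \<subseteq> {..<L}"
  proof -
    have "a r - 1 < L" if "r \<in> Y" for r using Y(2,4)[OF that] by simp
    moreover have "l < L" using inv by (simp add: auction_inv_def)
    ultimately show ?thesis by (auto simp: X_def)
  qed
  ultimately show ?thesis
    unfolding hall_violation_def by (intro exI[of _ X]) simp
qed

text \<open>On failure \<open>nxt\<close> and \<open>c\<close> are set to \<open>L\<close> and 0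
  just to falsify the condition of the loop in \<open>auction\<close>.\<close>

definition auction_step :: prog where
  "auction_step = Cond (V ''c'') Skip (Put ''nxt'' (Plus (V ''nxt'') (Const 1)) ;; Put ''c'' (V ''nxt'')) ;;
     scan ;;
     Cond (Minus (V ''R'') (V ''low''))
       (Put ''old'' (Elem ''a'' (V ''best'')) ;;
        Assign ''a'' (V ''best'') (V ''c'') ;;
        Assign ''d'' (V ''best'') (Plus (V ''low'') (Const 1)) ;;
        Put ''c'' (V ''old''))
       (Put ''fail'' (Const 1) ;; Put ''nxt'' (V ''L'') ;; Put ''c'' (Const 0))"

definition auction :: prog where
  "auction = For ''r'' (V ''R'') (Assign ''a'' (V ''r'') (Const 0) ;; Assign ''d'' (V ''r'') (Const 0)) ;;
     Put ''fail'' (Const 0) ;; Put ''nxt'' (Const 0) ;; Put ''c'' (Const 0) ;;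
     While (Plus (V ''c'') (Minus (V ''L'') (V ''nxt''))) auction_step"

lemma assigned_auction_step [simp]: "assigned auction_step =
    {''nxt'', ''c'', ''best'', ''low'', ''r'', ''old'', ''a'', ''d'', ''fail''}"
  by (auto simp: auction_step_def scan_def)

lemma assigned_auction [simp]: "assigned auction =
    {''nxt'', ''c'', ''best'', ''low'', ''r'', ''old'', ''a'', ''d'', ''fail''}"
  by (auto simp: auction_def)

text \<open>A step either raises one label by one, while the labels sum up to at most
  \<open>R * R\<close>, or it sets \<open>fail\<close>. The second summand of \<open>f\<close> pays
  for the latter.\<close>

lemma wp_auction_step:
  fixes R L :: nat and s0 :: store
  defines "f \<equiv> \<lambda>s. (R * R - (\<Sum>r<R. s ''d'' r)) + (if s ''fail'' 0 = 0 then 1 else 0)"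
  assumes RL: "s ''R'' 0 = R" "s ''L'' 0 = L" and "edge s = E"
    and fail: "s ''fail'' 0 = 0"
    and inv: "auction_inv E L R (s ''nxt'' 0) (s ''c'' 0) (s ''a'') (s ''d'')"
    and cond: "0 < s ''c'' 0 \<or> s ''nxt'' 0 < L"
  shows "wp auction_step (\<lambda>t s'. t \<le> R * 6 + 12 \<and> f s' < f s \<and>
    (if s' ''fail'' 0 = 0 then auction_inv E L R (s' ''nxt'' 0) (s' ''c'' 0) (s' ''a'') (s' ''d'')
     else hall_violation E L R \<and> s' ''nxt'' 0 = L \<and> s' ''c'' 0 = 0)) s"
proof -
  let ?scan = "scan ;;
     Cond (Minus (V ''R'') (V ''low''))
       (Put ''old'' (Elem ''a'' (V ''best'')) ;;
        Assign ''a'' (V ''best'') (V ''c'') ;;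
        Assign ''d'' (V ''best'') (Plus (V ''low'') (Const 1)) ;;
        Put ''c'' (V ''old''))
       (Put ''fail'' (Const 1) ;; Put ''nxt'' (V ''L'') ;; Put ''c'' (Const 0))"
  let ?Q = "\<lambda>t s'. t \<le> R * 6 + 12 \<and> f s' < f s \<and>
    (if s' ''fail'' 0 = 0 then auction_inv E L R (s' ''nxt'' 0) (s' ''c'' 0) (s' ''a'') (s' ''d'')
     else hall_violation E L R \<and> s' ''nxt'' 0 = L \<and> s' ''c'' 0 = 0)"
  have main: "wp ?scan (\<lambda>t. ?Q (t0 + t)) s1"
    if "t0 \<le> 3" and inv1: "auction_inv E L R (s1 ''nxt'' 0) (s1 ''c'' 0) (s ''a'') (s ''d'')"
      and "s1 ''c'' 0 \<noteq> 0" and fr: "\<And>x. x \<noteq> ''c'' \<Longrightarrow> x \<noteq> ''nxt'' \<Longrightarrow> s1 x = s x" for s1 t0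
  proof -
    obtain l where l: "s1 ''c'' 0 = Suc l" using \<open>s1 ''c'' 0 \<noteq> 0\<close> by (cases "s1 ''c'' 0") auto
    have E: "edge s1 = E" unfolding \<open>edge s = E\<close>[symmetric] by (rule edge_cong) (auto simp: fr)
    have R: "s1 ''R'' 0 = R" by (simp add: fr RL)
    show ?thesis
      unfolding wp_Seq
    proof (rule wp_mono[OF wp_scan[of s1 l R, OF l R]], unfold E, elim conjE)
      fix t s'
      assume t: "t \<le> R * 6 + 4" and low: "s' ''low'' 0 \<le> R" "\<forall>r<R. E l r \<longrightarrow> s' ''low'' 0 \<le> s1 ''d'' r"
        "s' ''low'' 0 < R \<longrightarrow> s' ''best'' 0 < R \<and> E l (s' ''best'' 0) \<and> s1 ''d'' (s' ''best'' 0) = s' ''low'' 0"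
        and "\<forall>x. x \<notin> {''best'', ''low'', ''r''} \<longrightarrow> s' x = s1 x"
      then have fr': "s' x = s1 x" if "x \<notin> {''best'', ''low'', ''r''}" for x using that by blast
      have d: "s1 ''d'' = s ''d''" by (simp add: fr)
      show "wp (Cond (Minus (V ''R'') (V ''low''))
       (Put ''old'' (Elem ''a'' (V ''best'')) ;;
        Assign ''a'' (V ''best'') (V ''c'') ;;
        Assign ''d'' (V ''best'') (Plus (V ''low'') (Const 1)) ;;
        Put ''c'' (V ''old''))
       (Put ''fail'' (Const 1) ;; Put ''nxt'' (V ''L'') ;; Put ''c'' (Const 0))) (\<lambda>t'. ?Q (t0 + (t + t'))) s'"
      proof (cases "s' ''low'' 0 < R")
        case True
        define b where "b = s' ''best'' 0"
        have b: "b < R" "E l b" "s ''d'' b = s' ''low'' 0" using low(3) True by (auto simp: b_def d)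
        have inv2: "auction_inv E L R (s1 ''nxt'' 0) (s ''a'' b) ((s ''a'')(b := Suc l)) ((s ''d'')(b := Suc (s ''d'' b)))"
          using inv1 b low(2) True by (intro auction_inv_take) (auto simp: l d)
        have "(\<Sum>r<R. ((s ''d'')(b := Suc (s ''d'' b))) r) = Suc (\<Sum>r<R. s ''d'' r)"
          using b(1) by (simp add: sum.remove[of "{..<R}" b])
        moreover have "(\<Sum>r<R. ((s ''d'')(b := Suc (s ''d'' b))) r) \<le> R * R"
        proof -
          have "((s ''d'')(b := Suc (s ''d'' b))) r \<le> R" if "r < R" for r
            using inv2 that unfolding auction_inv_def by blast
          then show ?thesis
            using sum_bounded_above[of "{..<R}" "(s ''d'')(b := Suc (s ''d'' b))" R] by simp
        qed
        ultimately show ?thesis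
          using True t \<open>t0 \<le> 3\<close> inv2 b(3)
          by (simp add: fr fr' RL l f_def fail b_def[symmetric])
      next
        case False
        then have "hall_violation E L R" using low(1,2) inv1 by (intro auction_inv_fail) (auto simp: l d)
        with False t \<open>t0 \<le> 3\<close> show ?thesis by (simp add: fr fr' RL f_def fail)
      qed
    qed
  qed
  let ?pick = "Cond (V ''c'') Skip (Put ''nxt'' (Plus (V ''nxt'') (Const 1)) ;; Put ''c'' (V ''nxt''))"
  have pick: "wp ?pick (\<lambda>t s1. t \<le> 3 \<and> auction_inv E L R (s1 ''nxt'' 0) (s1 ''c'' 0) (s ''a'') (s ''d'') \<and>
    s1 ''c'' 0 \<noteq> 0 \<and> (\<forall>x. x \<noteq> ''c'' \<longrightarrow> x \<noteq> ''nxt'' \<longrightarrow> s1 x = s x)) s"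
  proof (cases "s ''c'' 0 = 0")
    case True
    with cond inv have "auction_inv E L R (Suc (s ''nxt'' 0)) (Suc (s ''nxt'' 0)) (s ''a'') (s ''d'')"
      by (intro auction_inv_next) auto
    then show ?thesis using True by simp
  next
    case False
    then show ?thesis using inv by simp
  qed
  show ?thesis
    unfolding auction_step_def
    by (subst wp_Seq, rule wp_mono[OF pick], rule main) auto
qed

text \<open>The time does not depend on \<open>L\<close>: each of the at most
  \<open>R * R + 1\<close> rounds raises a label or ends the auction.\<close>

lemma wp_auction:
  assumes R: "s ''R'' 0 = R" and L: "s ''L'' 0 = L"
  shows "wp auction (\<lambda>t s'. t \<le> (R * R + 1) * (R * 6 + 13) + R * 4 + 6 \<and>
    (if s' ''fail'' 0 = 0 then matching (edge s) L R (s' ''a'') else hall_violation (edge s) L R)) s"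
proof -
  let ?c = "Assign ''a'' (V ''r'') (Const 0) ;; Assign ''d'' (V ''r'') (Const 0)"
  let ?J = "\<lambda>k s. \<forall>r<k. s ''a'' r = 0 \<and> s ''d'' r = 0"
  let ?f = "\<lambda>s. (R * R - (\<Sum>r<R. s ''d'' r)) + (if s ''fail'' 0 = 0 then 1 else 0)"
  let ?I = "\<lambda>s'. if s' ''fail'' 0 = 0
     then auction_inv (edge s) L R (s' ''nxt'' 0) (s' ''c'' 0) (s' ''a'') (s' ''d'')
     else hall_violation (edge s) L R \<and> s' ''nxt'' 0 = L \<and> s' ''c'' 0 = 0"
  have 1: "wp (For ''r'' (V ''R'') ?c) (\<lambda>t s'. t \<le> R * (2 + 2) + 2 \<and> ?J R s' \<and>
      (\<forall>y. y \<noteq> ''r'' \<and> y \<notin> assigned ?c \<longrightarrow> s' y = s y)) s"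
  proof (rule wp_For[where I = ?J])
    fix k :: nat and s' assume "?J k s'" "s' ''r'' 0 = k"
    then show "wp ?c (\<lambda>t s''. t \<le> 2 \<and> ?J (Suc k) (s''(''r'' := (s'' ''r'')(0 := Suc k)))) s'"
      by (auto simp: less_Suc_eq)
  qed (simp_all add: R)
  have 2: "wp (While (Plus (V ''c'') (Minus (V ''L'') (V ''nxt''))) auction_step)
      (\<lambda>t s'. t \<le> (R * R + 1) * ((R * 6 + 12) + 1) + 1 \<and> ?I s' \<and>
        val (Plus (V ''c'') (Minus (V ''L'') (V ''nxt''))) s' = 0 \<and>
        (\<forall>x. x \<notin> assigned auction_step \<longrightarrow> s' x = s1 x)) s1"
    if "?I s1" and fr: "\<forall>x. x \<notin> assigned auction_step \<longrightarrow> s1 x = s x" for s1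
  proof (rule wp_While[where f = ?f and I = ?I])
    fix s'
    assume I: "?I s'" and fr': "\<forall>x. x \<notin> assigned auction_step \<longrightarrow> s' x = s1 x"
      and cond: "val (Plus (V ''c'') (Minus (V ''L'') (V ''nxt''))) s' \<noteq> 0"
    have RL: "s' ''R'' 0 = R" "s' ''L'' 0 = L" using fr fr' R L by simp_all
    have "s' x = s x" if "x \<notin> assigned auction_step" for x using fr fr' that by metis
    then have E: "edge s' = edge s"
      by (intro edge_cong) (elim insertE emptyE; simp)
    have fail: "s' ''fail'' 0 = 0"
    proof (rule ccontr)
      assume "s' ''fail'' 0 \<noteq> 0"
      with I have "s' ''nxt'' 0 = L" "s' ''c'' 0 = 0" by simp_all
      with cond RL show False by simp
    qed
    have inv: "auction_inv (edge s) L R (s' ''nxt'' 0) (s' ''c'' 0) (s' ''a'') (s' ''d'')"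
      using I fail by simp
    have cond': "0 < s' ''c'' 0 \<or> s' ''nxt'' 0 < L" using cond RL by auto
    show "wp auction_step (\<lambda>t s''. t \<le> R * 6 + 12 \<and> ?I s'' \<and> ?f s'' < ?f s') s'"
      by (rule wp_mono[OF wp_auction_step[of s' R L "edge s", OF RL E fail inv cond']]) blast
  next
    show "?I s1" by (rule that(1))
    show "?f s1 \<le> R * R + 1" by (intro add_mono diff_le_self) simp
  qed
  show ?thesis
    unfolding auction_def wp_Seq
  proof (rule wp_mono[OF 1], elim conjE)
    fix t s'
    assume t: "t \<le> R * (2 + 2) + 2" and J: "?J R s'"
      and fr: "\<forall>y. y \<noteq> ''r'' \<and> y \<notin> assigned ?c \<longrightarrow> s' y = s y"
    define s1 where "s1 = s'(''fail'' := (s' ''fail'')(0 := 0), ''nxt'' := (s' ''nxt'')(0 := 0), ''c'' := (s' ''c'')(0 := 0))"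
    have I1: "?I s1" using J by (auto simp: s1_def intro: auction_inv_init)
    have fr1: "\<forall>x. x \<notin> assigned auction_step \<longrightarrow> s1 x = s x" using fr by (auto simp: s1_def)
    have "wp (While (Plus (V ''c'') (Minus (V ''L'') (V ''nxt''))) auction_step)
      (\<lambda>t' s''. t + (1 + (1 + (1 + t'))) \<le> (R * R + 1) * (R * 6 + 13) + R * 4 + 6 \<and>
       (if s'' ''fail'' 0 = 0 then matching (edge s) L R (s'' ''a'') else hall_violation (edge s) L R)) s1"
    proof (rule wp_mono[OF 2[OF I1 fr1]], elim conjE)
      fix t' s''
      assume t': "t' \<le> (R * R + 1) * (R * 6 + 12 + 1) + 1" and I: "?I s''"
        and "val (Plus (V ''c'') (Minus (V ''L'') (V ''nxt''))) s'' = 0"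
        and fr2: "\<forall>x. x \<notin> assigned auction_step \<longrightarrow> s'' x = s1 x"
      then have "s'' ''c'' 0 = 0" "L \<le> s'' ''nxt'' 0" using L fr1 by auto
      moreover from this I have "s'' ''nxt'' 0 = L" by (auto simp: auction_inv_def split: if_splits)
      ultimately show "t + (1 + (1 + (1 + t'))) \<le> (R * R + 1) * (R * 6 + 13) + R * 4 + 6 \<and>
       (if s'' ''fail'' 0 = 0 then matching (edge s) L R (s'' ''a'') else hall_violation (edge s) L R)"
        using t t' I auction_inv_final by (auto simp: algebra_simps)
    qed
    then show "wp (Put ''fail'' (Const 0)) (\<lambda>t1. wp (Put ''nxt'' (Const 0)) (\<lambda>t2. wp (Put ''c'' (Const 0))
       (\<lambda>t3. wp (While (Plus (V ''c'') (Minus (V ''L'') (V ''nxt''))) auction_step)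
        (\<lambda>t4 s''. t + (t1 + (t2 + (t3 + t4))) \<le> (R * R + 1) * (R * 6 + 13) + R * 4 + 6 \<and>
       (if s'' ''fail'' 0 = 0 then matching (edge s) L R (s'' ''a'') else hall_violation (edge s) L R))))) s'"
      by (simp add: s1_def del: wp_Seq)
  qed
qed

section \<open>Assigning jobs within capacities\<close>

definition cnt :: "nat \<Rightarrow> (nat \<Rightarrow> bool) \<Rightarrow> nat" where
  "cnt N P = card {r. r < N \<and> P r}"

lemma cnt_0 [simp]: "cnt 0 P = 0"
  by (simp add: cnt_def)

lemma cnt_Suc: "cnt (Suc N) P = cnt N P + of_bool (P N)"
proof -
  have "{r. r < Suc N \<and> P r} = (if P N then insert N {r. r < N \<and> P r} else {r. r < N \<and> P r})"
    by (auto simp: less_Suc_eq)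
  then show ?thesis by (simp add: cnt_def)
qed

lemma cnt_cong: "(\<And>r. r < N \<Longrightarrow> P r = P' r) \<Longrightarrow> cnt N P = cnt N P'"
  unfolding cnt_def by (intro arg_cong[where f = card]) auto

lemma cnt_mono: "(\<And>r. r < N \<Longrightarrow> P r \<Longrightarrow> P' r) \<Longrightarrow> cnt N P \<le> cnt N P'"
  unfolding cnt_def by (intro card_mono) auto

lemma cnt_eq_0: "cnt N P = 0 \<longleftrightarrow> (\<forall>r<N. \<not> P r)"
  by (auto simp: cnt_def)

lemma cnt_sum:
  assumes "finite J"
  shows "(\<Sum>j\<in>J. cnt N (\<lambda>r. P r \<and> f r = j)) = cnt N (\<lambda>r. P r \<and> f r \<in> J)"
proof -
  have "{r. r < N \<and> P r \<and> f r \<in> J} = (\<Union>j\<in>J. {r. r < N \<and> P r \<and> f r = j})" by auto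
  also have "card \<dots> = (\<Sum>j\<in>J. card {r. r < N \<and> P r \<and> f r = j})"
    using assms by (intro card_UN_disjoint) auto
  finally show ?thesis by (simp add: cnt_def)
qed

text \<open>\<open>steps\<close> is \<open>x / a\<close> rounded up.\<close>

definition steps :: "nat \<Rightarrow> nat \<Rightarrow> nat" where
  "steps a x = card {k. a * k < x}"

text \<open>If \<open>x\<close> and \<open>y\<close> are lowered by \<open>a\<close> and
  \<open>b\<close> in every round, this is the number of rounds begun with both of them
  positive.\<close>

definition steps2 :: "nat \<Rightarrow> nat \<Rightarrow> nat \<Rightarrow> nat \<Rightarrow> nat" where
  "steps2 a b x y = card {k. a * k < x \<and> b * k < y}"

lemma finite_steps: "0 < a \<Longrightarrow> finite {k::nat. a * k < x \<and> P k}"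
proof (rule finite_subset)
  assume "0 < a"
  show "{k. a * k < x \<and> P k} \<subseteq> {..x}"
  proof
    fix k assume "k \<in> {k. a * k < x \<and> P k}"
    moreover have "k \<le> a * k" using \<open>0 < a\<close> by (cases a) auto
    ultimately show "k \<in> {..x}" unfolding mem_Collect_eq atMost_iff by linarith
  qed
qed simp

lemma steps2_0 [simp]: "steps2 a b 0 y = 0"
  by (simp add: steps2_def)

text \<open>Splits off \<open>k = 0\<close>, which is one round of the subtraction loop; truncation
  at 0 makes this correct for \<open>x < a\<close> and \<open>y < b\<close>, too.\<close>

lemma steps2_step:
  assumes "0 < a" "0 < x"
  shows "steps2 a b x y = of_bool (y \<noteq> 0) + steps2 a b (x - a) (y - b)"
proof (cases "y = 0")
  case True
  then show ?thesis by (simp add: steps2_def)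
next
  case False
  let ?S = "{k. a * k < x - a \<and> b * k < y - b}"
  have "{k. a * k < x \<and> b * k < y} = insert 0 (Suc ` ?S)"
  proof (intro set_eqI)
    fix k
    show "k \<in> {k. a * k < x \<and> b * k < y} \<longleftrightarrow> k \<in> insert 0 (Suc ` ?S)"
      using False assms by (cases k) auto
  qed
  moreover have "card (insert 0 (Suc ` ?S)) = Suc (card ?S)"
    using finite_steps[OF assms(1)] by (subst card_insert_disjoint) (auto simp: card_image)
  ultimately show ?thesis using False by (simp add: steps2_def)
qed

lemma steps_eq_steps2: "steps a x = steps2 a 0 x 1"
  by (simp add: steps_def steps2_def)

lemma steps_0 [simp]: "steps a 0 = 0"
  by (simp add: steps_def)

lemma steps_step: "0 < a \<Longrightarrow> 0 < x \<Longrightarrow> steps a x = Suc (steps a (x - a))"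
  using steps2_step[of a x 0 1] by (simp add: steps_eq_steps2)

text \<open>With \<open>u = v = 1\<close> jobs stay whole; with \<open>u = q\<close> and
  \<open>v = p\<close> they are cut into units of length \<open>1 / q\<close>, a small job being
  regarded as having length \<open>p / q\<close>.\<close>

definition copies :: "nat \<Rightarrow> nat \<Rightarrow> prog" where
  "copies u v = Put ''L'' (Const 0) ;;
     For ''j'' (Elem ''in'' (Const 1))
       (Cond (Elem ''in'' (Plus (Const 2) (V ''j''))) (Put ''x'' (Const u)) (Put ''x'' (Const v)) ;;
        For ''k'' (V ''x'') (Assign ''job'' (V ''L'') (V ''j'') ;; Put ''L'' (Plus (V ''L'') (Const 1))))"

lemma assigned_copies [simp]: "assigned (copies u v) = {''L'', ''j'', ''x'', ''k'', ''job''}"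
  by (auto simp: copies_def)

lemma wp_copies:
  assumes n: "s ''in'' 1 = n"
    and mu: "\<And>j. \<mu> j = (if s ''in'' (2 + j) \<noteq> 0 then u else v)"
  shows "wp (copies u v) (\<lambda>t s'. t \<le> n * ((u + v) * 4 + 6) + 3 \<and>
    s' ''L'' 0 \<le> n * (u + v) \<and> (\<forall>l<s' ''L'' 0. s' ''job'' l < n) \<and>
    (\<forall>j<n. cnt (s' ''L'' 0) (\<lambda>l. s' ''job'' l = j) = \<mu> j)) s"
proof -
  let ?inner = "Assign ''job'' (V ''L'') (V ''j'') ;; Put ''L'' (Plus (V ''L'') (Const 1))"
  let ?c = "Cond (Elem ''in'' (Plus (Const 2) (V ''j''))) (Put ''x'' (Const u)) (Put ''x'' (Const v)) ;;
        For ''k'' (V ''x'') ?inner"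
  let ?I = "\<lambda>j s'. s' ''L'' 0 \<le> j * (u + v) \<and> (\<forall>l<s' ''L'' 0. s' ''job'' l < n) \<and>
    (\<forall>j'. cnt (s' ''L'' 0) (\<lambda>l. s' ''job'' l = j') = (if j' < j then \<mu> j' else 0))"
  define s1 where "s1 = s(''L'' := (s ''L'')(0 := 0))"
  have "wp (For ''j'' (Elem ''in'' (Const 1)) ?c)
    (\<lambda>t s'. t \<le> n * (((u + v) * 4 + 4) + 2) + 2 \<and> ?I n s' \<and>
      (\<forall>y. y \<noteq> ''j'' \<and> y \<notin> assigned ?c \<longrightarrow> s' y = s1 y)) s1"
  proof (rule wp_For[where I = ?I])
    show "?I 0 (s1(''j'' := (s1 ''j'')(0 := 0)))" by (simp add: s1_def)
    show "val (Elem ''in'' (Const 1)) s' = n" if "\<forall>y. y \<noteq> ''j'' \<and> y \<notin> assigned ?c \<longrightarrow> s' y = s1 y" for s'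
      using that n by (simp add: s1_def)
  next
    fix j s'
    assume j: "j < n" "s' ''j'' 0 = j" and I: "?I j s'"
      and fr: "\<forall>y. y \<noteq> ''j'' \<and> y \<notin> assigned ?c \<longrightarrow> s' y = s1 y"
    let ?J = "\<lambda>k s'. s' ''L'' 0 \<le> j * (u + v) + k \<and> (\<forall>l<s' ''L'' 0. s' ''job'' l < n) \<and>
      (\<forall>j'. cnt (s' ''L'' 0) (\<lambda>l. s' ''job'' l = j') = (if j' < j then \<mu> j' else if j' = j then k else 0))"
    have inn: "s' ''in'' = s ''in''" using fr by (simp add: s1_def)
    define s2 where "s2 = s'(''x'' := (s' ''x'')(0 := \<mu> j))"
    have "wp (For ''k'' (V ''x'') ?inner) (\<lambda>t s''. t \<le> \<mu> j * (2 + 2) + 2 \<and> ?J (\<mu> j) s'' \<and>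
      (\<forall>y. y \<noteq> ''k'' \<and> y \<notin> assigned ?inner \<longrightarrow> s'' y = s2 y)) s2"
    proof (rule wp_For[where I = ?J])
      show "?J 0 (s2(''k'' := (s2 ''k'')(0 := 0)))" using I by (simp add: s2_def)
    next
      fix k r
      assume J: "?J k r" and k: "r ''k'' 0 = k"
        and fr: "\<forall>y. y \<noteq> ''k'' \<and> y \<notin> assigned ?inner \<longrightarrow> r y = s2 y"
      have rj: "r ''j'' 0 = j" using fr j by (simp add: s2_def)
      have "cnt (Suc (r ''L'' 0)) (\<lambda>l. ((r ''job'')(r ''L'' 0 := j)) l = j') =
        (if j' < j then \<mu> j' else if j' = j then Suc k else 0)" for j'
      proof -
        have "cnt (r ''L'' 0) (\<lambda>l. ((r ''job'')(r ''L'' 0 := j)) l = j') = cnt (r ''L'' 0) (\<lambda>l. r ''job'' l = j')"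
          by (rule cnt_cong) simp
        then show ?thesis using J by (simp add: cnt_Suc)
      qed
      then show "wp ?inner (\<lambda>t s''. t \<le> 2 \<and> ?J (Suc k) (s''(''k'' := (s'' ''k'')(0 := Suc k)))) r"
        using J rj j(1) by (simp add: less_Suc_eq)
    qed (simp_all add: s2_def)
    moreover have "\<mu> j \<le> u + v" using mu by simp
    ultimately have F: "wp (For ''k'' (V ''x'') ?inner) (\<lambda>t s''. 2 + t \<le> (u + v) * 4 + 4 \<and>
        ?I (Suc j) (s''(''j'' := (s'' ''j'')(0 := Suc j)))) s2"
      by (elim wp_mono) (auto simp: less_Suc_eq)
    have "wp (Cond (Elem ''in'' (Plus (Const 2) (V ''j''))) (Put ''x'' (Const u)) (Put ''x'' (Const v)))
        (\<lambda>t s''. t = 2 \<and> s'' = s2) s'"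
      using mu[of j] j(2) inn by (simp add: s2_def)
    then show "wp ?c (\<lambda>t s''. t \<le> (u + v) * 4 + 4 \<and> ?I (Suc j) (s''(''j'' := (s'' ''j'')(0 := Suc j)))) s'"
      by (subst wp_Seq, elim wp_mono) (elim conjE, simp only: F)
  qed simp_all
  then show ?thesis
    unfolding copies_def by (simp add: s1_def del: One_nat_def) (elim wp_mono, simp add: ac_simps)
qed

text \<open>Slot \<open>k\<close> of machine \<open>i\<close> exists if \<open>a * k < X i\<close>, and it takes big jobs if \<open>b * k < Y i\<close>.\<close>

definition slots :: "nat \<Rightarrow> nat \<Rightarrow> prog" where
  "slots a b = Put ''R'' (Const 0) ;;
     For ''i'' (Elem ''in'' (Const 0))
       (Put ''x'' (Elem ''X'' (V ''i'')) ;; Put ''y'' (Elem ''Y'' (V ''i'')) ;;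
        While (V ''x'')
          (Assign ''mach'' (V ''R'') (V ''i'') ;; Assign ''any'' (V ''R'') (V ''y'') ;;
           Put ''x'' (Minus (V ''x'') (Const a)) ;; Put ''y'' (Minus (V ''y'') (Const b)) ;;
           Put ''R'' (Plus (V ''R'') (Const 1))))"

lemma assigned_slots [simp]: "assigned (slots a b) = {''R'', ''i'', ''x'', ''y'', ''mach'', ''any''}"
  by (auto simp: slots_def)

lemma wp_slots:
  assumes m: "s ''in'' 0 = m" and a: "0 < a" and D: "\<And>i. i < m \<Longrightarrow> s ''X'' i \<le> D"
  shows "wp (slots a b) (\<lambda>t s'. t \<le> m * (D * 6 + 5) + 3 \<and>
    s' ''R'' 0 \<le> m * D \<and> (\<forall>r<s' ''R'' 0. s' ''mach'' r < m) \<and>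
    (\<forall>i<m. cnt (s' ''R'' 0) (\<lambda>r. s' ''mach'' r = i) = steps a (s ''X'' i)) \<and>
    (\<forall>i<m. cnt (s' ''R'' 0) (\<lambda>r. s' ''mach'' r = i \<and> s' ''any'' r \<noteq> 0) = steps2 a b (s ''X'' i) (s ''Y'' i))) s"
proof -
  let ?inner = "Assign ''mach'' (V ''R'') (V ''i'') ;; Assign ''any'' (V ''R'') (V ''y'') ;;
           Put ''x'' (Minus (V ''x'') (Const a)) ;; Put ''y'' (Minus (V ''y'') (Const b)) ;;
           Put ''R'' (Plus (V ''R'') (Const 1))"
  let ?c = "Put ''x'' (Elem ''X'' (V ''i'')) ;; Put ''y'' (Elem ''Y'' (V ''i'')) ;; While (V ''x'') ?inner"
  let ?n1 = "\<lambda>s' i. cnt (s' ''R'' 0) (\<lambda>r. s' ''mach'' r = i)"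
  let ?n2 = "\<lambda>s' i. cnt (s' ''R'' 0) (\<lambda>r. s' ''mach'' r = i \<and> s' ''any'' r \<noteq> 0)"
  let ?I = "\<lambda>i s'. s' ''R'' 0 \<le> i * D \<and> (\<forall>r<s' ''R'' 0. s' ''mach'' r < m) \<and>
    (\<forall>i'. ?n1 s' i' = (if i' < i then steps a (s ''X'' i') else 0)) \<and>
    (\<forall>i'. ?n2 s' i' = (if i' < i then steps2 a b (s ''X'' i') (s ''Y'' i') else 0))"
  define s1 where "s1 = s(''R'' := (s ''R'')(0 := 0))"
  have "wp (For ''i'' (Elem ''in'' (Const 0)) ?c)
    (\<lambda>t s'. t \<le> m * ((D * (5 + 1) + 3) + 2) + 2 \<and> ?I m s' \<and>
      (\<forall>y. y \<noteq> ''i'' \<and> y \<notin> assigned ?c \<longrightarrow> s' y = s1 y)) s1"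
  proof (rule wp_For[where I = ?I])
    show "?I 0 (s1(''i'' := (s1 ''i'')(0 := 0)))" by (simp add: s1_def)
    show "val (Elem ''in'' (Const 0)) s' = m" if "\<forall>y. y \<noteq> ''i'' \<and> y \<notin> assigned ?c \<longrightarrow> s' y = s1 y" for s'
      using that m by (simp add: s1_def)
  next
    fix i s'
    assume i: "i < m" "s' ''i'' 0 = i" and I: "?I i s'"
      and fr: "\<forall>y. y \<noteq> ''i'' \<and> y \<notin> assigned ?c \<longrightarrow> s' y = s1 y"
    \<comment> \<open>The slots that machine \<open>i\<close> has yet to receive, as determined by
      the current \<open>x\<close> and \<open>y\<close>, are added to those present; this total is
      constant throughout the inner loop.\<close>
    let ?J = "\<lambda>r. r ''R'' 0 + r ''x'' 0 \<le> i * D + s ''X'' i \<and> (\<forall>k<r ''R'' 0. r ''mach'' k < m) \<and>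
      (\<forall>i'. ?n1 r i' + (if i' = i then steps a (r ''x'' 0) else 0) =
        (if i' < Suc i then steps a (s ''X'' i') else 0)) \<and>
      (\<forall>i'. ?n2 r i' + (if i' = i then steps2 a b (r ''x'' 0) (r ''y'' 0) else 0) =
        (if i' < Suc i then steps2 a b (s ''X'' i') (s ''Y'' i') else 0))"
    have XY: "s' ''X'' = s ''X''" "s' ''Y'' = s ''Y''" using fr by (simp_all add: s1_def)
    define s2 where "s2 = s'(''x'' := (s' ''x'')(0 := s ''X'' i), ''y'' := (s' ''y'')(0 := s ''Y'' i))"
    have "wp (While (V ''x'') ?inner) (\<lambda>t s''. t \<le> D * (5 + 1) + 1 \<and> ?J s'' \<and> val (V ''x'') s'' = 0 \<and>
      (\<forall>y. y \<notin> assigned ?inner \<longrightarrow> s'' y = s2 y)) s2"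
    proof (rule wp_While[where I = ?J and f = "\<lambda>r. r ''x'' 0"])
      show "?J s2" using I by (simp add: s2_def less_Suc_eq)
      show "s2 ''x'' 0 \<le> D" using D i(1) by (simp add: s2_def)
    next
      fix r
      assume J: "?J r" and cond: "val (V ''x'') r \<noteq> 0"
        and fr: "\<forall>y. y \<notin> assigned ?inner \<longrightarrow> r y = s2 y"
      have ri: "r ''i'' 0 = i" using fr i by (simp add: s2_def)
      let ?N = "r ''R'' 0"
      have x: "0 < r ''x'' 0" using cond by simp
      have *: "cnt (Suc ?N) (\<lambda>k. ((r ''mach'')(?N := i)) k = i') = ?n1 r i' + of_bool (i' = i)" for i'
        using cnt_cong[of ?N "\<lambda>k. ((r ''mach'')(?N := i)) k = i'" "\<lambda>k. r ''mach'' k = i'"]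
        by (auto simp: cnt_Suc)
      have **: "cnt (Suc ?N) (\<lambda>k. ((r ''mach'')(?N := i)) k = i' \<and> 0 < ((r ''any'')(?N := r ''y'' 0)) k) =
          ?n2 r i' + of_bool (i' = i \<and> r ''y'' 0 \<noteq> 0)" for i'
        using cnt_cong[of ?N "\<lambda>k. ((r ''mach'')(?N := i)) k = i' \<and> 0 < ((r ''any'')(?N := r ''y'' 0)) k"
          "\<lambda>k. r ''mach'' k = i' \<and> r ''any'' k \<noteq> 0"]
        by (auto simp: cnt_Suc)
      define r' where "r' = r(''mach'' := (r ''mach'')(?N := i), ''any'' := (r ''any'')(?N := r ''y'' 0),
        ''x'' := (r ''x'')(0 := r ''x'' 0 - a), ''y'' := (r ''y'')(0 := r ''y'' 0 - b),
        ''R'' := (r ''R'')(0 := Suc ?N))"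
      have "?J r'"
      proof (intro conjI allI)
        show "r' ''R'' 0 + r' ''x'' 0 \<le> i * D + s ''X'' i"
        proof -
          have "r ''R'' 0 + r ''x'' 0 \<le> i * D + s ''X'' i" using J by blast
          moreover have "Suc (r ''x'' 0 - a) \<le> r ''x'' 0" using x a by simp
          ultimately show ?thesis by (simp add: r'_def)
        qed
      next
        fix i'
        show "?n1 r' i' + (if i' = i then steps a (r' ''x'' 0) else 0) =
          (if i' < Suc i then steps a (s ''X'' i') else 0)"
        proof -
          have "?n1 r' i' = ?n1 r i' + of_bool (i' = i)" using *[of i'] by (simp add: r'_def)
          moreover have "?n1 r i' + (if i' = i then steps a (r ''x'' 0) else 0) =
            (if i' < Suc i then steps a (s ''X'' i') else 0)" using J by blast
          ultimately show ?thesis using steps_step[OF a x] by (simp add: r'_def split: if_splits)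
        qed
      next
        fix i'
        have "?n2 r' i' = ?n2 r i' + of_bool (i' = i \<and> r ''y'' 0 \<noteq> 0)"
          using ** by (simp add: r'_def)
        moreover have "?n2 r i' + (if i' = i then steps2 a b (r ''x'' 0) (r ''y'' 0) else 0) =
          (if i' < Suc i then steps2 a b (s ''X'' i') (s ''Y'' i') else 0)" using J by blast
        ultimately show "?n2 r' i' + (if i' = i then steps2 a b (r' ''x'' 0) (r' ''y'' 0) else 0) =
          (if i' < Suc i then steps2 a b (s ''X'' i') (s ''Y'' i') else 0)"
          using steps2_step[OF a x, of b "r ''y'' 0"]
          by (cases "r ''y'' 0 = 0") (simp_all add: r'_def split: if_splits)
      next
        fix k
        show "k < r' ''R'' 0 \<longrightarrow> r' ''mach'' k < m" using J i(1) by (auto simp: r'_def less_Suc_eq)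
      qed
      moreover have "r' ''x'' 0 < r ''x'' 0" using x a by (simp add: r'_def)
      ultimately have F: "5 \<le> (5::nat) \<and> ?J r' \<and> r' ''x'' 0 < r ''x'' 0" by blast
      have "wp ?inner (\<lambda>t s''. t = 5 \<and> s'' = r') r" by (simp add: ri r'_def)
      then show "wp ?inner (\<lambda>t s''. t \<le> 5 \<and> ?J s'' \<and> s'' ''x'' 0 < r ''x'' 0) r"
      proof (rule wp_mono)
        fix t :: nat and s'' assume "t = 5 \<and> s'' = r'"
        then have eq: "t = 5" "s'' = r'" by simp_all
        show "t \<le> 5 \<and> ?J s'' \<and> s'' ''x'' 0 < r ''x'' 0" unfolding eq by (rule F)
      qed
    qed
    then have "wp (While (V ''x'') ?inner) (\<lambda>t s''. 2 + t \<le> D * (5 + 1) + 3 \<and>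
        ?I (Suc i) (s''(''i'' := (s'' ''i'')(0 := Suc i)))) s2"
    proof (rule wp_mono)
      fix t s''
      assume *: "t \<le> D * (5 + 1) + 1 \<and> ?J s'' \<and> val (V ''x'') s'' = 0 \<and>
        (\<forall>y. y \<notin> assigned ?inner \<longrightarrow> s'' y = s2 y)"
      then have x: "s'' ''x'' 0 = 0" by simp
      from * have "?J s''" by blast
      from this[unfolded x steps_0 steps2_0 if_cancel add_0_right]
      have "?I (Suc i) s''" using D[OF i(1)] by simp
      then show "2 + t \<le> D * (5 + 1) + 3 \<and> ?I (Suc i) (s''(''i'' := (s'' ''i'')(0 := Suc i)))"
        using * by simp
    qed
    then show "wp ?c (\<lambda>t s''. t \<le> D * (5 + 1) + 3 \<and> ?I (Suc i) (s''(''i'' := (s'' ''i'')(0 := Suc i)))) s'"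
      using i(2) XY by (simp add: s2_def)
  qed simp_all
  then show ?thesis
    unfolding slots_def by (simp add: s1_def) (elim wp_mono, simp add: ac_simps)
qed

text \<open>The number of copies of job \<open>j\<close> that have been given to machine \<open>i\<close>.\<close>

definition share :: "store \<Rightarrow> nat \<Rightarrow> nat \<Rightarrow> nat" where
  "share s i j = cnt (s ''R'' 0) (\<lambda>r. (s ''mach'' r = i \<and> s ''a'' r \<noteq> 0) \<and> s ''job'' (s ''a'' r - 1) = j)"

definition solve :: "nat \<Rightarrow> nat \<Rightarrow> nat \<Rightarrow> nat \<Rightarrow> prog" where
  "solve u v a b = copies u v ;; slots a b ;; auction"

lemma assigned_solve [simp]: "assigned (solve u v a b) =
    {''L'', ''j'', ''x'', ''k'', ''job'', ''R'', ''i'', ''y'', ''mach'', ''any'',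
     ''nxt'', ''c'', ''best'', ''low'', ''r'', ''old'', ''a'', ''d'', ''fail''}"
  by (auto simp: solve_def)

text \<open>\<open>w\<close> is the total \<open>u + v\<close>, \<open>D\<close> a bound for the
  array \<open>X\<close>, and \<open>z\<close> a bound for the numbers of machines and jobs. The
  semiring is left open so that the same expression can be read as a number of steps and, at
  \<open>[:0, 1:]\<close>, as a polynomial.\<close>

definition solve_time :: "nat \<Rightarrow> 'a \<Rightarrow> 'a \<Rightarrow> 'a :: comm_semiring_1" where
  "solve_time w D z = z * (of_nat w * 4 + 6) + z * (D * 6 + 5) +
     ((z * D) * (z * D) + 1) * ((z * D) * 6 + 13) + (z * D) * 4 + 12"

section \<open>Fractional assignments, matchings and Hall's condition\<close>

locale assignment =
  fixes m n :: nat and big :: "nat \<Rightarrow> bool" and \<Gamma> :: "nat \<Rightarrow> nat set"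
begin

definition ready :: "store \<Rightarrow> bool" where
  "ready s \<longleftrightarrow> s ''in'' 0 = m \<and> s ''in'' 1 = n \<and> (\<forall>j<n. s ''in'' (2 + j) = of_bool (big j)) \<and>
     (\<forall>j<n. \<forall>i<m. s ''in'' (s ''row'' j + i) = of_bool (i \<in> \<Gamma> j))"

lemma ready_cong: "ready s \<Longrightarrow> s' ''in'' = s ''in'' \<Longrightarrow> s' ''row'' = s ''row'' \<Longrightarrow> ready s'"
  by (simp add: ready_def)

text \<open>Admitting real \<open>y\<close> lets one predicate cover both the fractional assignments
  that are to be rounded and the integral ones read off from matchings.\<close>

definition feasible :: "(nat \<Rightarrow> nat) \<Rightarrow> (nat \<Rightarrow> nat) \<Rightarrow> (nat \<Rightarrow> nat) \<Rightarrow> (nat \<Rightarrow> nat \<Rightarrow> real) \<Rightarrow> bool" where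
  "feasible \<mu> c b y \<longleftrightarrow>
     (\<forall>i<m. \<forall>j<n. 0 \<le> y i j \<and> (y i j \<noteq> 0 \<longrightarrow> i \<in> \<Gamma> j)) \<and>
     (\<forall>j<n. (\<Sum>i<m. y i j) = real (\<mu> j)) \<and>
     (\<forall>i<m. (\<Sum>j<n. y i j) \<le> real (c i)) \<and>
     (\<forall>i<m. (\<Sum>j | j < n \<and> big j. y i j) \<le> real (b i))"

text \<open>On machine \<open>i\<close>, the load from the jobs of \<open>X\<close> is bounded by
  the number of neighbours of \<open>X\<close> among its slots: if some small job of
  \<open>X\<close> is allowed on \<open>i\<close>, all its slots are neighbours and the bound
  \<open>c i\<close> applies; if only big ones are, the slots open to big jobs are, and
  \<open>b i\<close> applies; otherwise the load is 0. Summation over \<open>i\<close> gives Hall's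
  condition without any appeal to integrality of \<open>y\<close>.\<close>

lemma feasible_imp_no_hall_violation:
  assumes y: "feasible \<mu> c b y"
    and job: "\<And>l. l < L \<Longrightarrow> job l < n" "\<And>j. j < n \<Longrightarrow> cnt L (\<lambda>l. job l = j) = \<mu> j"
    and mach: "\<And>r. r < R \<Longrightarrow> mach r < m" "\<And>i. i < m \<Longrightarrow> cnt R (\<lambda>r. mach r = i) = c i"
      "\<And>i. i < m \<Longrightarrow> cnt R (\<lambda>r. mach r = i \<and> any r \<noteq> 0) = b i"
    and E: "\<And>l r. l < L \<Longrightarrow> r < R \<Longrightarrow> E l r \<longleftrightarrow> mach r \<in> \<Gamma> (job l) \<and> (big (job l) \<longrightarrow> any r \<noteq> (0::nat))"
  shows "\<not> hall_violation E L R"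
proof
  assume "hall_violation E L R"
  then obtain X where X: "X \<subseteq> {..<L}" and viol: "cnt R (\<lambda>r. \<exists>l\<in>X. E l r) < card X"
    by (auto simp: hall_violation_def cnt_def)
  define J where "J = job ` X"
  have J: "J \<subseteq> {..<n}" using X job(1) by (auto simp: J_def)
  then have finJ: "finite J" by (rule finite_subset) simp
  have y0: "0 \<le> y i j" "y i j \<noteq> 0 \<Longrightarrow> i \<in> \<Gamma> j" if "i < m" "j < n" for i j
    using y that by (auto simp: feasible_def)
  \<comment> \<open>Copies of one job have the same neighbours, so \<open>X\<close> may be enlarged
    to all copies of its jobs. The conjunct \<open>True\<close> brings the count into the form of
    \<open>cnt_sum\<close>.\<close>
  have "card X \<le> cnt L (\<lambda>l. True \<and> job l \<in> J)"
    unfolding cnt_def using X by (intro card_mono) (auto simp: J_def)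
  also have "\<dots> = (\<Sum>j\<in>J. cnt L (\<lambda>l. True \<and> job l = j))" by (rule cnt_sum[OF finJ, symmetric])
  also have "\<dots> = (\<Sum>j\<in>J. \<mu> j)" using J job(2) by (intro sum.cong) auto
  finally have "real (card X) \<le> real (\<Sum>j\<in>J. \<mu> j)" by (rule of_nat_mono)
  also have "\<dots> = (\<Sum>j\<in>J. \<Sum>i<m. y i j)"
    using y J by (simp add: feasible_def) (intro sum.cong, auto)
  also have "\<dots> = (\<Sum>i<m. \<Sum>j\<in>J. y i j)" by (rule sum.swap)
  also have "\<dots> \<le> (\<Sum>i<m. real (cnt R (\<lambda>r. (\<exists>l\<in>X. E l r) \<and> mach r = i)))"
  proof (rule sum_mono)
    fix i assume "i \<in> {..<m}"
    then have i: "i < m" by simp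
    show "(\<Sum>j\<in>J. y i j) \<le> real (cnt R (\<lambda>r. (\<exists>l\<in>X. E l r) \<and> mach r = i))"
    proof (cases "\<exists>l\<in>X. i \<in> \<Gamma> (job l) \<and> \<not> big (job l)")
      case True
      then obtain l where l: "l \<in> X" "i \<in> \<Gamma> (job l)" "\<not> big (job l)" by blast
      have "(\<Sum>j\<in>J. y i j) \<le> (\<Sum>j<n. y i j)" using J y0(1)[OF i] by (intro sum_mono2) auto
      also have "\<dots> \<le> real (cnt R (\<lambda>r. mach r = i))" using y i mach(2) by (simp add: feasible_def)
      also have "\<dots> \<le> real (cnt R (\<lambda>r. (\<exists>l\<in>X. E l r) \<and> mach r = i))"
        using l X E by (intro of_nat_mono cnt_mono) blast
      finally show ?thesis .
    next
      case notA: False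
      show ?thesis
      proof (cases "\<exists>l\<in>X. i \<in> \<Gamma> (job l)")
        case True
        then obtain l where l: "l \<in> X" "i \<in> \<Gamma> (job l)" by blast
        have "(\<Sum>j\<in>J. y i j) = (\<Sum>j\<in>J \<inter> {j. big j}. y i j)"
          using notA J y0(2)[OF i] finJ by (intro sum.mono_neutral_right) (auto simp: J_def)
        also have "\<dots> \<le> (\<Sum>j | j < n \<and> big j. y i j)"
          using J y0(1)[OF i] by (intro sum_mono2) auto
        also have "\<dots> \<le> real (cnt R (\<lambda>r. mach r = i \<and> any r \<noteq> 0))"
          using y i mach(3) by (simp add: feasible_def)
        also have "\<dots> \<le> real (cnt R (\<lambda>r. (\<exists>l\<in>X. E l r) \<and> mach r = i))"
          using l X E by (intro of_nat_mono cnt_mono) blast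
        finally show ?thesis .
      next
        case False
        then have "(\<Sum>j\<in>J. y i j) = 0"
          using J y0(2)[OF i] by (intro sum.neutral) (auto simp: J_def)
        then show ?thesis by simp
      qed
    qed
  qed
  also have "\<dots> = real (cnt R (\<lambda>r. (\<exists>l\<in>X. E l r) \<and> mach r \<in> {..<m}))"
    by (simp flip: of_nat_sum add: cnt_sum del: lessThan_iff)
  also have "\<dots> = real (cnt R (\<lambda>r. \<exists>l\<in>X. E l r))"
    using mach(1) by (intro arg_cong[where f = real] cnt_cong) auto
  finally show False using viol by simp
qed

lemma matching_imp_feasible:
  assumes mat: "matching E L R a"
    and job: "\<And>l. l < L \<Longrightarrow> job l < n" "\<And>j. j < n \<Longrightarrow> cnt L (\<lambda>l. job l = j) = \<mu> j"
    and mach: "\<And>r. r < R \<Longrightarrow> mach r < m" "\<And>i. i < m \<Longrightarrow> cnt R (\<lambda>r. mach r = i) = c i"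
      "\<And>i. i < m \<Longrightarrow> cnt R (\<lambda>r. mach r = i \<and> any r \<noteq> 0) = b i"
    and E: "\<And>l r. l < L \<Longrightarrow> r < R \<Longrightarrow> E l r \<longleftrightarrow> mach r \<in> \<Gamma> (job l) \<and> (big (job l) \<longrightarrow> any r \<noteq> (0::nat))"
  shows "feasible \<mu> c b (\<lambda>i j. real (cnt R (\<lambda>r. (mach r = i \<and> a r \<noteq> 0) \<and> job (a r - 1) = j)))"
proof -
  have a: "a r - 1 < L" "E (a r - 1) r" if "r < R" "a r \<noteq> 0" for r
    using mat that by (auto simp: matching_def)
  have inj: "r' = r" if "r < R" "r' < R" "a r \<noteq> 0" "a r' = a r" for r r'
    using mat that unfolding matching_def by blast
  show ?thesis
    unfolding feasible_def
  proof (intro conjI allI impI)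
    fix i j assume "real (cnt R (\<lambda>r. (mach r = i \<and> a r \<noteq> 0) \<and> job (a r - 1) = j)) \<noteq> 0"
    then obtain r where "r < R" "mach r = i" "a r \<noteq> 0" "job (a r - 1) = j" by (auto simp: cnt_eq_0)
    then show "i \<in> \<Gamma> j" using E a by blast
  next
    fix j assume j: "j < n"
    have "(\<Sum>i<m. cnt R (\<lambda>r. (mach r = i \<and> a r \<noteq> 0) \<and> job (a r - 1) = j)) =
        (\<Sum>i<m. cnt R (\<lambda>r. (a r \<noteq> 0 \<and> job (a r - 1) = j) \<and> mach r = i))"
      by (intro sum.cong cnt_cong) auto
    also have "\<dots> = cnt R (\<lambda>r. (a r \<noteq> 0 \<and> job (a r - 1) = j) \<and> mach r \<in> {..<m})"
      by (rule cnt_sum) simp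
    also have "\<dots> = cnt R (\<lambda>r. a r \<noteq> 0 \<and> job (a r - 1) = j)" using mach(1) by (intro cnt_cong) auto
    \<comment> \<open>The slots holding a copy of \<open>j\<close> correspond bijectively to these
      copies, as a matching covers every left vertex exactly once.\<close>
    also have "\<dots> = cnt L (\<lambda>l. job l = j)"
      unfolding cnt_def
    proof (rule bij_betw_same_card[of "\<lambda>r. a r - 1"], rule bij_betwI')
      fix r r'
      assume "r \<in> {r. r < R \<and> a r \<noteq> 0 \<and> job (a r - 1) = j}" "r' \<in> {r. r < R \<and> a r \<noteq> 0 \<and> job (a r - 1) = j}"
      then have r: "r < R" "a r \<noteq> 0" "r' < R" "a r' \<noteq> 0" by simp_all
      show "(a r - 1 = a r' - 1) = (r = r')"
      proof
        assume "a r - 1 = a r' - 1"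
        with r have "a r' = a r" by simp
        then show "r = r'" using inj[OF r(1,3,2)] by simp
      qed simp
    next
      fix r assume "r \<in> {r. r < R \<and> a r \<noteq> 0 \<and> job (a r - 1) = j}"
      then show "a r - 1 \<in> {l. l < L \<and> job l = j}" using a by blast
    next
      fix l assume "l \<in> {l. l < L \<and> job l = j}"
      then obtain r where "r < R" "a r = Suc l" "job l = j" using mat by (auto simp: matching_def)
      then show "\<exists>r\<in>{r. r < R \<and> a r \<noteq> 0 \<and> job (a r - 1) = j}. l = a r - 1"
        by (intro bexI[of _ r]) simp_all
    qed
    finally show "(\<Sum>i<m. real (cnt R (\<lambda>r. (mach r = i \<and> a r \<noteq> 0) \<and> job (a r - 1) = j))) = real (\<mu> j)"
      using job(2)[OF j] by (simp flip: of_nat_sum)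
  next
    fix i assume i: "i < m"
    have "(\<Sum>j\<in>{..<n}. cnt R (\<lambda>r. (mach r = i \<and> a r \<noteq> 0) \<and> job (a r - 1) = j)) =
        cnt R (\<lambda>r. (mach r = i \<and> a r \<noteq> 0) \<and> job (a r - 1) \<in> {..<n})"
      by (rule cnt_sum) simp
    also have "\<dots> \<le> cnt R (\<lambda>r. mach r = i)" by (intro cnt_mono) auto
    finally show "(\<Sum>j<n. real (cnt R (\<lambda>r. (mach r = i \<and> a r \<noteq> 0) \<and> job (a r - 1) = j))) \<le> real (c i)"
      using mach(2)[OF i] by (simp flip: of_nat_sum)
    have "(\<Sum>j\<in>{j. j < n \<and> big j}. cnt R (\<lambda>r. (mach r = i \<and> a r \<noteq> 0) \<and> job (a r - 1) = j)) =
        cnt R (\<lambda>r. (mach r = i \<and> a r \<noteq> 0) \<and> job (a r - 1) \<in> {j. j < n \<and> big j})"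
      by (rule cnt_sum) simp
    also have "\<dots> \<le> cnt R (\<lambda>r. mach r = i \<and> any r \<noteq> 0)"
      using E a by (intro cnt_mono) blast
    finally show "(\<Sum>j | j < n \<and> big j. real (cnt R (\<lambda>r. (mach r = i \<and> a r \<noteq> 0) \<and> job (a r - 1) = j))) \<le> real (b i)"
      using mach(3)[OF i] by (simp flip: of_nat_sum)
  qed simp
qed

text \<open>This contains an integrality theorem: a real \<open>y\<close> excludes a violation of
  Hall's condition, so the auction succeeds, and its shares are natural numbers within the same
  capacities.\<close>

lemma wp_solve:
  assumes rdy: "ready s" and a: "0 < a" and D: "\<And>i. i < m \<Longrightarrow> s ''X'' i \<le> D"
    and z: "m \<le> z" "n \<le> z"
  shows "wp (solve u v a b) (\<lambda>t s'. t \<le> solve_time (u + v) D z \<and> s' ''R'' 0 \<le> z * D \<and>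
    (if s' ''fail'' 0 = 0
     then feasible (\<lambda>j. if big j then u else v) (\<lambda>i. steps a (s ''X'' i)) (\<lambda>i. steps2 a b (s ''X'' i) (s ''Y'' i))
         (\<lambda>i j. real (share s' i j)) \<and>
       (\<forall>r<s' ''R'' 0. s' ''mach'' r < m \<and> (s' ''a'' r \<noteq> 0 \<longrightarrow> s' ''job'' (s' ''a'' r - 1) < n))
     else \<not> (\<exists>y. feasible (\<lambda>j. if big j then u else v)
         (\<lambda>i. steps a (s ''X'' i)) (\<lambda>i. steps2 a b (s ''X'' i) (s ''Y'' i)) y)) \<and>
    (\<forall>x. x \<notin> assigned (solve u v a b) \<longrightarrow> s' x = s x)) s" (is "wp _ ?Q s")
proof -
  let ?\<mu> = "\<lambda>j. if s ''in'' (2 + j) \<noteq> 0 then u else v"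
  let ?c = "\<lambda>i. steps a (s ''X'' i)" and ?b = "\<lambda>i. steps2 a b (s ''X'' i) (s ''Y'' i)"
  have inn: "s ''in'' 0 = m" "s ''in'' 1 = n" "\<And>j. j < n \<Longrightarrow> s ''in'' (2 + j) = of_bool (big j)"
    "\<And>i j. i < m \<Longrightarrow> j < n \<Longrightarrow> s ''in'' (s ''row'' j + i) = of_bool (i \<in> \<Gamma> j)"
    using rdy by (auto simp: ready_def)
  have "wp (solve u v a b) (\<lambda>t s'. t \<le> solve_time (u + v) D z \<and> s' ''R'' 0 \<le> z * D \<and>
    (if s' ''fail'' 0 = 0
     then feasible (\<lambda>j. if big j then u else v) ?c ?b (\<lambda>i j. real (share s' i j)) \<and>
       (\<forall>r<s' ''R'' 0. s' ''mach'' r < m \<and> (s' ''a'' r \<noteq> 0 \<longrightarrow> s' ''job'' (s' ''a'' r - 1) < n))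
     else \<not> (\<exists>y. feasible (\<lambda>j. if big j then u else v) ?c ?b y))) s"
    unfolding solve_def wp_Seq
  proof (rule wp_mono[OF wp_frame[OF wp_copies[where s = s, OF inn(2) refl]]])
    fix t1 s1
    assume 1: "(t1 \<le> n * ((u + v) * 4 + 6) + 3 \<and> s1 ''L'' 0 \<le> n * (u + v) \<and>
      (\<forall>l<s1 ''L'' 0. s1 ''job'' l < n) \<and> (\<forall>j<n. cnt (s1 ''L'' 0) (\<lambda>l. s1 ''job'' l = j) = ?\<mu> j)) \<and>
      (\<forall>x. x \<notin> assigned (copies u v) \<longrightarrow> s1 x = s x)"
    then have f1: "s1 ''in'' = s ''in''" "s1 ''row'' = s ''row''" "s1 ''X'' = s ''X''" "s1 ''Y'' = s ''Y''"
      by simp_all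
    have m1: "s1 ''in'' 0 = m" and D1: "\<And>i. i < m \<Longrightarrow> s1 ''X'' i \<le> D" using f1 inn D by simp_all
    show "wp (slots a b) (\<lambda>t2. wp auction (\<lambda>t3 s'. t1 + (t2 + t3) \<le> solve_time (u + v) D z \<and> s' ''R'' 0 \<le> z * D \<and>
    (if s' ''fail'' 0 = 0
     then feasible (\<lambda>j. if big j then u else v) ?c ?b (\<lambda>i j. real (share s' i j)) \<and>
       (\<forall>r<s' ''R'' 0. s' ''mach'' r < m \<and> (s' ''a'' r \<noteq> 0 \<longrightarrow> s' ''job'' (s' ''a'' r - 1) < n))
     else \<not> (\<exists>y. feasible (\<lambda>j. if big j then u else v) ?c ?b y)))) s1"
    proof (rule wp_mono[OF wp_frame[OF wp_slots[where s = s1, OF m1 a D1]]])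
      fix t2 s2
      assume 2: "(t2 \<le> m * (D * 6 + 5) + 3 \<and> s2 ''R'' 0 \<le> m * D \<and>
        (\<forall>r<s2 ''R'' 0. s2 ''mach'' r < m) \<and>
        (\<forall>i<m. cnt (s2 ''R'' 0) (\<lambda>r. s2 ''mach'' r = i) = steps a (s1 ''X'' i)) \<and>
        (\<forall>i<m. cnt (s2 ''R'' 0) (\<lambda>r. s2 ''mach'' r = i \<and> s2 ''any'' r \<noteq> 0) = steps2 a b (s1 ''X'' i) (s1 ''Y'' i))) \<and>
        (\<forall>x. x \<notin> assigned (slots a b) \<longrightarrow> s2 x = s1 x)"
      then have f2: "s2 ''in'' = s ''in''" "s2 ''row'' = s ''row''" "s2 ''job'' = s1 ''job''" "s2 ''L'' = s1 ''L''"
        using f1 by simp_all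
      define R where "R = s2 ''R'' 0"
      define L where "L = s2 ''L'' 0"
      define E where "E = edge s2"
      have job: "\<And>l. l < L \<Longrightarrow> s2 ''job'' l < n"
          "\<And>j. j < n \<Longrightarrow> cnt L (\<lambda>l. s2 ''job'' l = j) = (if big j then u else v)"
        using 1 inn(3) by (simp_all add: f2 L_def)
      have mach: "\<And>r. r < R \<Longrightarrow> s2 ''mach'' r < m" "\<And>i. i < m \<Longrightarrow> cnt R (\<lambda>r. s2 ''mach'' r = i) = ?c i"
          "\<And>i. i < m \<Longrightarrow> cnt R (\<lambda>r. s2 ''mach'' r = i \<and> s2 ''any'' r \<noteq> 0) = ?b i"
        using 2 unfolding R_def f1 by blast+
      have E: "E l r \<longleftrightarrow> s2 ''mach'' r \<in> \<Gamma> (s2 ''job'' l) \<and> (big (s2 ''job'' l) \<longrightarrow> s2 ''any'' r \<noteq> 0)"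
        if "l < L" "r < R" for l r
        using inn(3,4) job(1)[OF that(1)] mach(1)[OF that(2)] unfolding E_def edge_def f2
        by (auto simp: f2)
      note facts = job mach E
      have "R \<le> m * D" using 2 by (simp add: R_def)
      then have Rz: "R \<le> z * D" using z(1) by (meson mult_le_mono1 order_trans)
      have time: "t1 + (t2 + t3) \<le> solve_time (u + v) D z"
        if "t3 \<le> (R * R + 1) * (R * 6 + 13) + R * 4 + 6" for t3
      proof -
        have "t1 \<le> z * ((u + v) * 4 + 6) + 3" using 1 z(2) by (meson add_mono mult_le_mono1 order_refl order_trans)
        moreover have "t2 \<le> z * (D * 6 + 5) + 3" using 2 z(1) by (meson add_mono mult_le_mono1 order_refl order_trans)
        moreover have "(R * R + 1) * (R * 6 + 13) + R * 4 + 6 \<le>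
            ((z * D) * (z * D) + 1) * ((z * D) * 6 + 13) + (z * D) * 4 + 6"
          using Rz by (intro add_mono mult_le_mono order_refl)
        ultimately show ?thesis
          using that unfolding solve_time_def by simp
      qed
      show "wp auction (\<lambda>t3 s'. t1 + (t2 + t3) \<le> solve_time (u + v) D z \<and> s' ''R'' 0 \<le> z * D \<and>
    (if s' ''fail'' 0 = 0
     then feasible (\<lambda>j. if big j then u else v) ?c ?b (\<lambda>i j. real (share s' i j)) \<and>
       (\<forall>r<s' ''R'' 0. s' ''mach'' r < m \<and> (s' ''a'' r \<noteq> 0 \<longrightarrow> s' ''job'' (s' ''a'' r - 1) < n))
     else \<not> (\<exists>y. feasible (\<lambda>j. if big j then u else v) ?c ?b y))) s2"
      proof (rule wp_mono[OF wp_frame[OF wp_auction[where s = s2, OF R_def[symmetric] L_def[symmetric]]]],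
          fold E_def, elim conjE, intro conjI)
        fix t3 s3
        assume t3: "t3 \<le> (R * R + 1) * (R * 6 + 13) + R * 4 + 6"
          and res: "if s3 ''fail'' 0 = 0 then matching E L R (s3 ''a'') else hall_violation E L R"
          and "\<forall>x. x \<notin> assigned auction \<longrightarrow> s3 x = s2 x"
        then have f3: "s3 ''mach'' = s2 ''mach''" "s3 ''job'' = s2 ''job''" "s3 ''R'' 0 = R"
          by (simp_all add: R_def)
        show "t1 + (t2 + t3) \<le> solve_time (u + v) D z" using t3 by (rule time)
        show "s3 ''R'' 0 \<le> z * D" using Rz f3 by simp
        show "if s3 ''fail'' 0 = 0
           then feasible (\<lambda>j. if big j then u else v) ?c ?b (\<lambda>i j. real (share s3 i j)) \<and>
             (\<forall>r<s3 ''R'' 0. s3 ''mach'' r < m \<and> (s3 ''a'' r \<noteq> 0 \<longrightarrow> s3 ''job'' (s3 ''a'' r - 1) < n))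
           else \<not> (\<exists>y. feasible (\<lambda>j. if big j then u else v) ?c ?b y)"
        proof (cases "s3 ''fail'' 0 = 0")
          case True
          then have mat: "matching E L R (s3 ''a'')" using res by simp
          have "s3 ''a'' r - 1 < L" if "r < R" "s3 ''a'' r \<noteq> 0" for r
            using mat that by (auto simp: matching_def)
          then have "\<forall>r<s3 ''R'' 0. s3 ''mach'' r < m \<and> (s3 ''a'' r \<noteq> 0 \<longrightarrow> s3 ''job'' (s3 ''a'' r - 1) < n)"
            using job(1) mach(1) unfolding f3 by blast
          moreover have "feasible (\<lambda>j. if big j then u else v) ?c ?b (\<lambda>i j. real (share s3 i j))"
            unfolding share_def f3 by (rule matching_imp_feasible[OF mat facts])
          ultimately show ?thesis using True by simp
        next
          case False
          then have "hall_violation E L R" using res by simp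
          then have "\<not> (\<exists>y. feasible (\<lambda>j. if big j then u else v) ?c ?b y)"
            using feasible_imp_no_hall_violation[OF _ facts] by blast
          then show ?thesis using False by simp
        qed
      qed
    qed
  qed
  from wp_frame[OF this] show ?thesis by (rule wp_mono) blast
qed

end

section \<open>Floors and ceilings of quotients\<close>

lemma steps_eq: "0 < a \<Longrightarrow> steps a x = (x + a - 1) div a"
proof -
  assume "0 < a"
  then have "a * k < x \<longleftrightarrow> k < (x + a - 1) div a" for k
    using less_eq_div_iff_mult_less_eq[of a "Suc k" "x + a - 1"] by (auto simp: Suc_le_eq ac_simps)
  then have "{k. a * k < x} = {..<(x + a - 1) div a}" by auto
  then show ?thesis by (simp add: steps_def)
qed

lemma steps_bounds:
  assumes "0 < a"
  shows "x \<le> a * steps a x" and "a * steps a x < x + a"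
proof -
  have "a * steps a x + (x + a - 1) mod a = x + a - 1"
    unfolding steps_eq[OF assms] by (rule mult_div_mod_eq)
  moreover have "(x + a - 1) mod a < a" using assms by simp
  ultimately show "x \<le> a * steps a x" "a * steps a x < x + a" using assms by linarith+
qed

text \<open>Subtracting \<open>a - 1\<close> beforehand turns rounding up into rounding down; for
  \<open>x < a - 1\<close> truncation at 0 still gives the right quotient 0.\<close>

lemma steps_div: "0 < a \<Longrightarrow> steps a (x - (a - 1)) = x div a"
  by (cases "a - 1 \<le> x") (simp_all add: steps_eq)

text \<open>The premise says that \<open>y\<close> runs out no later than \<open>x\<close>, so that
  the end of the loop cuts off none of the slots open to big jobs.\<close>

lemma steps2_eq_steps:
  assumes "\<And>k. b * k < y \<Longrightarrow> a * k < x"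
  shows "steps2 a b x y = steps b y"
proof -
  have "{k. a * k < x \<and> b * k < y} = {k. b * k < y}" using assms by auto
  then show ?thesis by (simp add: steps_def steps2_def)
qed

lemma steps2_div:
  assumes "0 < a" "a \<le> b"
  shows "steps2 a b (x - (a - 1)) (x - (b - 1)) = x div b"
proof -
  have "a * k < x - (a - 1)" if "b * k < x - (b - 1)" for k
  proof -
    have "a * k \<le> b * k" using assms(2) by simp
    then show ?thesis using that assms by linarith
  qed
  then show ?thesis using steps2_eq_steps steps_div assms by simp
qed

section \<open>The algorithm\<close>

text \<open>In the absence of multiplication, the offsets of the rows of the characteristic matrix
  are tabulated by repeated addition.\<close>

definition rows :: prog where
  "rows = Put ''x'' (Plus (Const 2) (Elem ''in'' (Const 1))) ;;
     For ''j'' (Elem ''in'' (Const 1))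
       (Assign ''row'' (V ''j'') (V ''x'') ;; Put ''x'' (Plus (V ''x'') (Elem ''in'' (Const 0))))"

definition fill :: "expr \<Rightarrow> expr \<Rightarrow> prog" where
  "fill d e = For ''i'' (Elem ''in'' (Const 0)) (Assign ''X'' (V ''i'') d ;; Assign ''Y'' (V ''i'') e)"

lemma assigned_rows [simp]: "assigned rows = {''x'', ''j'', ''row''}"
  by (auto simp: rows_def)

lemma assigned_fill [simp]: "assigned (fill d e) = {''i'', ''X'', ''Y''}"
  by (auto simp: fill_def)

lemma wp_fill:
  assumes m: "s ''in'' 0 = m"
    and d: "\<And>s'. (\<forall>x. x \<notin> {''i'', ''X'', ''Y''} \<longrightarrow> s' x = s x) \<Longrightarrow> val d s' = x"
    and e: "\<And>s'. (\<forall>x. x \<notin> {''i'', ''X'', ''Y''} \<longrightarrow> s' x = s x) \<Longrightarrow> val e s' = y"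
  shows "wp (fill d e) (\<lambda>t s'. t \<le> m * 4 + 2 \<and> (\<forall>i<m. s' ''X'' i = x \<and> s' ''Y'' i = y) \<and>
    (\<forall>z. z \<notin> assigned (fill d e) \<longrightarrow> s' z = s z)) s"
proof -
  let ?c = "Assign ''X'' (V ''i'') d ;; Assign ''Y'' (V ''i'') e"
  let ?I = "\<lambda>k s'. \<forall>i<k. s' ''X'' i = x \<and> s' ''Y'' i = y"
  have "wp (fill d e) (\<lambda>t s'. t \<le> m * (2 + 2) + 2 \<and> ?I m s' \<and>
      (\<forall>z. z \<noteq> ''i'' \<and> z \<notin> assigned ?c \<longrightarrow> s' z = s z)) s"
    unfolding fill_def
  proof (rule wp_For[where I = ?I])
    fix k :: nat and s'
    assume I: "?I k s'" and k: "s' ''i'' 0 = k"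
      and fr: "\<forall>z. z \<noteq> ''i'' \<and> z \<notin> assigned ?c \<longrightarrow> s' z = s z"
    define s2 where "s2 = s'(''X'' := (s' ''X'')(k := x))"
    have "val d s' = x" using fr by (intro d) simp
    moreover have "val e s2 = y" using fr by (intro e) (simp add: s2_def)
    ultimately show "wp ?c (\<lambda>t s''. t \<le> 2 \<and> ?I (Suc k) (s''(''i'' := (s'' ''i'')(0 := Suc k)))) s'"
      using I k by (simp add: s2_def less_Suc_eq)
  qed (use m in simp_all)
  then show ?thesis by (elim wp_mono) simp
qed

definition tidy :: "nat \<Rightarrow> nat \<Rightarrow> store \<Rightarrow> bool" where
  "tidy m n s \<longleftrightarrow> (\<forall>r<s ''R'' 0. s ''mach'' r < m \<and> (s ''a'' r \<noteq> 0 \<longrightarrow> s ''job'' (s ''a'' r - 1) < n))"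

text \<open>For large \<open>T\<close> both capacities are \<open>T\<close>, so no slot is reserved
  and only the total length counts. For small \<open>T\<close> the subtractions make
  \<open>slots\<close>, which rounds up, produce \<open>T div p\<close> slots,
  \<open>T div q\<close> of them open to big jobs.\<close>

definition attempt :: "nat \<Rightarrow> nat \<Rightarrow> nat \<Rightarrow> prog" where
  "attempt p q K = Cond (Minus (V ''T'') (Const (K * q)))
     (fill (V ''T'') (V ''T'') ;; solve q p 1 1)
     (fill (Minus (V ''T'') (Const (p - 1))) (Minus (V ''T'') (Const (q - 1))) ;; solve 1 1 p q)"

text \<open>\<open>N\<close> becomes \<open>n * q + 1\<close>, computed by additions: no machine can
  receive more than \<open>n\<close> jobs of at most \<open>q\<close> units each, so
  \<open>n * q\<close> is the last value worth trying. Resetting \<open>N\<close> to 0 leaves the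
  loop after a success.\<close>

definition search :: "nat \<Rightarrow> nat \<Rightarrow> nat \<Rightarrow> prog" where
  "search p q K = Put ''T'' (Const 0) ;; Put ''fail'' (Const 1) ;; Put ''N'' (Const 1) ;;
     For ''j'' (Elem ''in'' (Const 1)) (Put ''N'' (Plus (V ''N'') (Const q))) ;;
     While (Minus (V ''N'') (V ''T''))
       (attempt p q K ;; Cond (V ''fail'') (Put ''T'' (Plus (V ''T'') (Const 1))) (Put ''N'' (Const 0)))"

text \<open>The denominators of \<open>U / q + W / p\<close> are cleared: this number is
  \<open>(p * U + q * W) / (p * q)\<close>, whose numerator is collected in \<open>X\<close>, while
  \<open>Y\<close> collects \<open>U\<close>.\<close>

definition weigh :: "nat \<Rightarrow> nat \<Rightarrow> prog" where
  "weigh p q = For ''r'' (V ''R'') (Cond (Elem ''a'' (V ''r''))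
     (Cond (Elem ''in'' (Plus (Const 2) (Elem ''job'' (Minus (Elem ''a'' (V ''r'')) (Const 1)))))
       (Assign ''X'' (Elem ''mach'' (V ''r'')) (Plus (Elem ''X'' (Elem ''mach'' (V ''r''))) (Const p)) ;;
        Assign ''Y'' (Elem ''mach'' (V ''r'')) (Plus (Elem ''Y'' (Elem ''mach'' (V ''r''))) (Const 1)))
       (Assign ''X'' (Elem ''mach'' (V ''r'')) (Plus (Elem ''X'' (Elem ''mach'' (V ''r''))) (Const q))))
     Skip)"

definition rounding :: "nat \<Rightarrow> nat \<Rightarrow> prog" where
  "rounding p q = fill (Const 0) (Const 0) ;; weigh p q ;; solve 1 1 (p * q) q"

definition write_out :: prog where
  "write_out = For ''r'' (V ''R'') (Cond (Elem ''a'' (V ''r''))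
     (Assign ''out'' (Elem ''job'' (Minus (Elem ''a'' (V ''r'')) (Const 1))) (Elem ''mach'' (V ''r''))) Skip)"

definition algorithm :: "nat \<Rightarrow> nat \<Rightarrow> nat \<Rightarrow> prog" where
  "algorithm p q K = rows ;; search p q K ;; Cond (V ''fail'') Skip
     (Cond (Minus (V ''T'') (Const (K * q))) (rounding p q) Skip ;; write_out)"

section \<open>Polynomial time bounds\<close>

definition attempt_time :: "nat \<Rightarrow> nat \<Rightarrow> 'a \<Rightarrow> 'a :: comm_semiring_1" where
  "attempt_time p q z = z * 4 + 3 + solve_time (p + q) (z * of_nat q + 1) z"

definition search_time :: "nat \<Rightarrow> nat \<Rightarrow> 'a \<Rightarrow> 'a :: comm_semiring_1" where
  "search_time p q z = z * 3 + 6 + (z * of_nat q + 1) * (attempt_time p q z + 3)"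

definition round_slots :: "nat \<Rightarrow> nat \<Rightarrow> 'a \<Rightarrow> 'a :: comm_semiring_1" where
  "round_slots p q z = of_nat (p + q) * (z * of_nat q + 1)"

definition round_time :: "nat \<Rightarrow> nat \<Rightarrow> 'a \<Rightarrow> 'a :: comm_semiring_1" where
  "round_time p q z = z * 4 + 2 + ((z * (z * of_nat q + 1)) * 6 + 2) + solve_time 2 (round_slots p q z) z"

definition algorithm_time :: "nat \<Rightarrow> nat \<Rightarrow> 'a \<Rightarrow> 'a :: comm_semiring_1" where
  "algorithm_time p q z = z * 4 + 3 + search_time p q z + 2 + round_time p q z +
     (z * (z * of_nat q + 1) + z * round_slots p q z) * 4 + 2"

lemma assigned_attempt [simp]: "assigned (attempt p q K) = insert ''X'' (insert ''Y'' (assigned (solve 1 1 1 1)))"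
  by (auto simp: attempt_def)

lemma assigned_search [simp]:
  "assigned (search p q K) = insert ''T'' (insert ''N'' (insert ''X'' (insert ''Y'' (assigned (solve 1 1 1 1)))))"
  by (auto simp: search_def)

lemma solve_time_mono: "w \<le> w' \<Longrightarrow> solve_time w D z \<le> (solve_time w' D z :: nat)"
  by (simp add: solve_time_def)

context assignment
begin

lemma wp_rows:
  assumes inn: "s ''in'' 0 = m" "s ''in'' 1 = n" "\<And>j. j < n \<Longrightarrow> s ''in'' (2 + j) = of_bool (big j)"
      "\<And>i j. i < m \<Longrightarrow> j < n \<Longrightarrow> s ''in'' (2 + n + m * j + i) = of_bool (i \<in> \<Gamma> j)"
    and z: "n \<le> z"
  shows "wp rows (\<lambda>t s'. t \<le> z * 4 + 3 \<and> ready s') s"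
proof -
  let ?c = "Assign ''row'' (V ''j'') (V ''x'') ;; Put ''x'' (Plus (V ''x'') (Elem ''in'' (Const 0)))"
  let ?I = "\<lambda>k s'. s' ''x'' 0 = 2 + n + m * k \<and> (\<forall>j<k. s' ''row'' j = 2 + n + m * j)"
  define s1 where "s1 = s(''x'' := (s ''x'')(0 := 2 + n))"
  have "wp (For ''j'' (Elem ''in'' (Const 1)) ?c) (\<lambda>t s'. t \<le> n * (2 + 2) + 2 \<and> ?I n s' \<and>
      (\<forall>y. y \<noteq> ''j'' \<and> y \<notin> assigned ?c \<longrightarrow> s' y = s1 y)) s1"
  proof (rule wp_For[where I = ?I])
    fix k :: nat and s'
    assume I: "?I k s'" and k: "s' ''j'' 0 = k"
      and fr: "\<forall>y. y \<noteq> ''j'' \<and> y \<notin> assigned ?c \<longrightarrow> s' y = s1 y"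
    have "s' ''in'' 0 = m" using fr inn(1) by (simp add: s1_def)
    then show "wp ?c (\<lambda>t s''. t \<le> 2 \<and> ?I (Suc k) (s''(''j'' := (s'' ''j'')(0 := Suc k)))) s'"
      using I k by (simp add: less_Suc_eq)
  qed (use inn(2) in \<open>simp_all add: s1_def\<close>)
  then have "wp (For ''j'' (Elem ''in'' (Const 1)) ?c) (\<lambda>t s'. 1 + t \<le> z * 4 + 3 \<and> ready s') s1"
  proof (rule wp_mono)
    fix t s'
    assume *: "t \<le> n * (2 + 2) + 2 \<and> ?I n s' \<and> (\<forall>y. y \<noteq> ''j'' \<and> y \<notin> assigned ?c \<longrightarrow> s' y = s1 y)"
    then have "s' ''in'' = s ''in''" "\<forall>j<n. s' ''row'' j = 2 + n + m * j" by (simp_all add: s1_def)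
    then have "ready s'" using inn by (simp add: ready_def)
    then show "1 + t \<le> z * 4 + 3 \<and> ready s'" using * z by simp
  qed
  then show ?thesis unfolding rows_def using inn(2) by (simp add: s1_def)
qed

text \<open>The two relaxations of the existence of a schedule of makespan at most \<open>T\<close>, in units of \<open>1 / q\<close>: for
  small \<open>T\<close> only numbers of jobs are bounded, for large \<open>T\<close> jobs are cut into units.\<close>

definition trial :: "nat \<Rightarrow> nat \<Rightarrow> nat \<Rightarrow> nat \<Rightarrow> (nat \<Rightarrow> nat \<Rightarrow> real) \<Rightarrow> bool" where
  "trial p q K T = (if T \<le> K * q then feasible (\<lambda>j. 1) (\<lambda>i. T div p) (\<lambda>i. T div q)
     else feasible (\<lambda>j. if big j then q else p) (\<lambda>i. T) (\<lambda>i. T))"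

lemma feasible_cong:
  "(\<And>i. i < m \<Longrightarrow> c i = c' i) \<Longrightarrow> (\<And>i. i < m \<Longrightarrow> b i = b' i) \<Longrightarrow> feasible \<mu> c b = feasible \<mu> c' b'"
  by (intro ext) (simp add: feasible_def)

lemma wp_attempt:
  assumes rdy: "ready s" and pq: "0 < p" "p \<le> q" and T: "s ''T'' 0 = T" "T \<le> z * q + 1"
    and z: "m \<le> z" "n \<le> z"
  shows "wp (attempt p q K) (\<lambda>t s'. t \<le> attempt_time p q z \<and> s' ''R'' 0 \<le> z * (z * q + 1) \<and>
    (if s' ''fail'' 0 = 0 then trial p q K T (\<lambda>i j. real (share s' i j)) \<and> tidy m n s'
     else \<not> (\<exists>y. trial p q K T y)) \<and>
    (\<forall>x. x \<notin> assigned (attempt p q K) \<longrightarrow> s' x = s x)) s"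
proof -
  let ?Q = "\<lambda>t s'. t \<le> z * 4 + 2 + solve_time (p + q) (z * q + 1) z \<and> s' ''R'' 0 \<le> z * (z * q + 1) \<and>
    (if s' ''fail'' 0 = 0 then trial p q K T (\<lambda>i j. real (share s' i j)) \<and> tidy m n s'
     else \<not> (\<exists>y. trial p q K T y))"
  have main: "wp (fill d e ;; solve u v a b) ?Q s"
    if d: "\<And>s'. (\<forall>x. x \<notin> {''i'', ''X'', ''Y''} \<longrightarrow> s' x = s x) \<Longrightarrow> val d s' = x"
      and e: "\<And>s'. (\<forall>x. x \<notin> {''i'', ''X'', ''Y''} \<longrightarrow> s' x = s x) \<Longrightarrow> val e s' = y"
      and a: "0 < a" and x: "x \<le> z * q + 1" and uv: "u + v \<le> p + q"
      and tr: "trial p q K T = feasible (\<lambda>j. if big j then u else v) (\<lambda>i. steps a x) (\<lambda>i. steps2 a b x y)"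
    for d e u v a b x y
    unfolding wp_Seq
  proof (rule wp_mono[OF wp_fill[where s = s and d = d and e = e, OF _ d e]])
    show "s ''in'' 0 = m" using rdy by (simp add: ready_def)
    fix t1 s1
    assume 1: "t1 \<le> m * 4 + 2 \<and> (\<forall>i<m. s1 ''X'' i = x \<and> s1 ''Y'' i = y) \<and>
      (\<forall>z. z \<notin> assigned (fill d e) \<longrightarrow> s1 z = s z)"
    have rdy1: "ready s1" using 1 by (intro ready_cong[OF rdy]) simp_all
    have D: "\<And>i. i < m \<Longrightarrow> s1 ''X'' i \<le> z * q + 1" using 1 x by simp
    have tr1: "feasible (\<lambda>j. if big j then u else v) (\<lambda>i. steps a (s1 ''X'' i))
        (\<lambda>i. steps2 a b (s1 ''X'' i) (s1 ''Y'' i)) = trial p q K T"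
      unfolding tr using 1 by (intro feasible_cong) simp_all
    note slv = wp_solve[where s = s1 and u = u and v = v and a = a and b = b and D = "z * q + 1" and z = z,
      OF rdy1 a D z, unfolded tr1, folded tidy_def]
    show "wp (solve u v a b) (\<lambda>t. ?Q (t1 + t)) s1"
    proof (rule wp_mono[OF slv], assumption, elim conjE, intro conjI)
      fix t s'
      assume "t \<le> solve_time (u + v) (z * q + 1) z"
      with solve_time_mono[OF uv, of "z * q + 1" z]
      have "t \<le> solve_time (p + q) (z * q + 1) z" by linarith
      moreover have "t1 \<le> z * 4 + 2" using 1 z(1) by linarith
      ultimately show "t1 + t \<le> z * 4 + 2 + solve_time (p + q) (z * q + 1) z" by linarith
    qed assumption+
  qed
  have "wp (attempt p q K) (\<lambda>t s'. t \<le> attempt_time p q z \<and> s' ''R'' 0 \<le> z * (z * q + 1) \<and>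
    (if s' ''fail'' 0 = 0 then trial p q K T (\<lambda>i j. real (share s' i j)) \<and> tidy m n s'
     else \<not> (\<exists>y. trial p q K T y))) s" (is "wp _ ?P s")
  proof (cases "T \<le> K * q")
    case True
    have "wp (fill (Minus (V ''T'') (Const (p - 1))) (Minus (V ''T'') (Const (q - 1))) ;; solve 1 1 p q) ?Q s"
    proof (rule main)
      show "trial p q K T = feasible (\<lambda>j. if big j then 1 else 1) (\<lambda>i. steps p (T - (p - 1)))
          (\<lambda>i. steps2 p q (T - (p - 1)) (T - (q - 1)))"
        unfolding trial_def using True pq steps_div[of p T] steps2_div[of p q T] by simp
      show "T - (p - 1) \<le> z * q + 1" using T(2) by linarith
    qed (use T pq in simp_all)
    then have "wp (fill (Minus (V ''T'') (Const (p - 1))) (Minus (V ''T'') (Const (q - 1))) ;; solve 1 1 p q)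
        (\<lambda>t. ?P (t + 1)) s"
      by (rule wp_mono) (simp add: attempt_time_def)
    then show ?thesis unfolding attempt_def wp_Cond using True T(1) by simp
  next
    case False
    have "wp (fill (V ''T'') (V ''T'') ;; solve q p 1 1) ?Q s"
    proof (rule main)
      have "steps 1 T = T" by (simp add: steps_eq)
      moreover have "steps2 1 1 T T = T" by (subst steps2_eq_steps) (simp_all add: steps_eq)
      ultimately show "trial p q K T = feasible (\<lambda>j. if big j then q else p) (\<lambda>i. steps 1 T)
          (\<lambda>i. steps2 1 1 T T)"
        unfolding trial_def using False by simp
    qed (use T in simp_all)
    then have "wp (fill (V ''T'') (V ''T'') ;; solve q p 1 1) (\<lambda>t. ?P (t + 1)) s"
      by (rule wp_mono) (simp add: attempt_time_def)
    then show ?thesis unfolding attempt_def wp_Cond using False T(1) by simp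
  qed
  from wp_frame[OF this] show ?thesis by (rule wp_mono) blast
qed

end

lemma assigned_weigh [simp]: "assigned (weigh p q) = {''r'', ''X'', ''Y''}"
  by (auto simp: weigh_def)

lemma assigned_write_out [simp]: "assigned write_out = {''r'', ''out''}"
  by (auto simp: write_out_def)

context assignment
begin

lemma wp_search:
  assumes rdy: "ready s" and pq: "0 < p" "p \<le> q" and z: "m \<le> z" "n \<le> z"
  shows "wp (search p q K) (\<lambda>t s'. t \<le> search_time p q z \<and> ready s' \<and>
    (if s' ''fail'' 0 = 0
     then s' ''T'' 0 \<le> n * q \<and> s' ''R'' 0 \<le> z * (z * q + 1) \<and> tidy m n s' \<and>
       trial p q K (s' ''T'' 0) (\<lambda>i j. real (share s' i j)) \<and> (\<forall>T<s' ''T'' 0. \<not> (\<exists>y. trial p q K T y))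
     else (\<forall>T\<le>n * q. \<not> (\<exists>y. trial p q K T y)))) s"
proof -
  let ?res = "\<lambda>s'. s' ''T'' 0 \<le> n * q \<and> s' ''R'' 0 \<le> z * (z * q + 1) \<and> tidy m n s' \<and>
       trial p q K (s' ''T'' 0) (\<lambda>i j. real (share s' i j)) \<and> (\<forall>T<s' ''T'' 0. \<not> (\<exists>y. trial p q K T y))"
  \<comment> \<open>After a success \<open>N = 0\<close> stops the loop whatever \<open>T\<close>
    is; before, \<open>N\<close> stays at \<open>n * q + 1\<close>, and \<open>T\<close> reaches it
    only if every attempt has failed.\<close>
  let ?I = "\<lambda>s'. if s' ''fail'' 0 = 0 then s' ''N'' 0 = 0 \<and> ?res s'
    else s' ''N'' 0 = n * q + 1 \<and> s' ''T'' 0 \<le> n * q + 1 \<and> (\<forall>T<s' ''T'' 0. \<not> (\<exists>y. trial p q K T y))"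
  let ?upd = "Cond (V ''fail'') (Put ''T'' (Plus (V ''T'') (Const 1))) (Put ''N'' (Const 0))"
  let ?body = "attempt p q K ;; ?upd"
  let ?B = "attempt_time p q z + 2"
  have n: "s ''in'' 1 = n" using rdy by (simp add: ready_def)
  have body: "wp ?body (\<lambda>t s''. t \<le> ?B \<and> ?I s'' \<and> s'' ''N'' 0 - s'' ''T'' 0 < s' ''N'' 0 - s' ''T'' 0) s'"
    if rdy': "ready s'" and fail: "s' ''fail'' 0 \<noteq> 0" and N: "s' ''N'' 0 = n * q + 1" and T: "s' ''T'' 0 \<le> n * q"
      and none: "\<forall>T<s' ''T'' 0. \<not> (\<exists>y. trial p q K T y)" for s'
  proof -
    have "n * q \<le> z * q" using z by simp
    then have Tz: "s' ''T'' 0 \<le> z * q + 1" using T by linarith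
    show ?thesis
      unfolding wp_Seq[of "attempt p q K"]
    proof (rule wp_mono[OF wp_attempt[where s = s', OF rdy' pq refl Tz z]])
      fix t s1
      assume 1: "t \<le> attempt_time p q z \<and> s1 ''R'' 0 \<le> z * (z * q + 1) \<and>
        (if s1 ''fail'' 0 = 0 then trial p q K (s' ''T'' 0) (\<lambda>i j. real (share s1 i j)) \<and> tidy m n s1
         else \<not> (\<exists>y. trial p q K (s' ''T'' 0) y)) \<and>
        (\<forall>x. x \<notin> assigned (attempt p q K) \<longrightarrow> s1 x = s' x)"
      then have eq: "s1 ''T'' = s' ''T''" "s1 ''N'' = s' ''N''" by simp_all
      show "wp ?upd (\<lambda>t'. (\<lambda>t s''. t \<le> ?B \<and> ?I s'' \<and>
          s'' ''N'' 0 - s'' ''T'' 0 < s' ''N'' 0 - s' ''T'' 0) (t + t')) s1"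
      proof (cases "s1 ''fail'' 0 = 0")
        case True
        define s2 where "s2 = s1(''N'' := (s1 ''N'')(0 := 0))"
        have "share s2 = share s1" "tidy m n s2 = tidy m n s1"
          by (simp_all add: share_def tidy_def s2_def fun_eq_iff)
        then have "?I s2" using 1 True T none by (simp add: s2_def eq)
        moreover have "s2 ''N'' 0 - s2 ''T'' 0 < s' ''N'' 0 - s' ''T'' 0"
          using N T by (simp add: s2_def eq)
        ultimately have "t + 2 \<le> ?B \<and> ?I s2 \<and> s2 ''N'' 0 - s2 ''T'' 0 < s' ''N'' 0 - s' ''T'' 0"
          using 1 by (intro conjI) simp_all
        moreover have "wp ?upd (\<lambda>t s''. t = 2 \<and> s'' = s2) s1" using True by (simp add: s2_def)
        ultimately show ?thesis by (elim wp_mono) (elim conjE, hypsubst, intro conjI, assumption+)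
      next
        case False
        define s2 where "s2 = s1(''T'' := (s1 ''T'')(0 := s' ''T'' 0 + 1))"
        have "\<forall>T<s' ''T'' 0 + 1. \<not> (\<exists>y. trial p q K T y)"
          using 1 False none by (auto simp: less_Suc_eq)
        then have "?I s2" using False T N by (simp add: s2_def eq)
        moreover have "s2 ''N'' 0 - s2 ''T'' 0 < s' ''N'' 0 - s' ''T'' 0"
          using N T by (simp add: s2_def eq)
        ultimately have "t + 2 \<le> ?B \<and> ?I s2 \<and> s2 ''N'' 0 - s2 ''T'' 0 < s' ''N'' 0 - s' ''T'' 0"
          using 1 by (intro conjI) simp_all
        moreover have "wp ?upd (\<lambda>t s''. t = 2 \<and> s'' = s2) s1" using False by (simp add: s2_def eq)
        ultimately show ?thesis by (elim wp_mono) (elim conjE, hypsubst, intro conjI, assumption+)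
      qed
    qed
  qed
  have loop: "wp (While (Minus (V ''N'') (V ''T'')) ?body)
      (\<lambda>t s'. t \<le> (z * q + 1) * (?B + 1) + 1 \<and> ?I s' \<and> val (Minus (V ''N'') (V ''T'')) s' = 0 \<and>
        (\<forall>x. x \<notin> assigned ?body \<longrightarrow> s' x = s1 x)) s1"
    if rdy1: "ready s1" and I: "?I s1" for s1
  proof (rule wp_While[where I = ?I and f = "\<lambda>s. s ''N'' 0 - s ''T'' 0"])
    show "?I s1" by (rule I)
    have "n * q \<le> z * q" using z by simp
    moreover have "s1 ''N'' 0 \<le> n * q + 1" using I by (simp split: if_splits)
    ultimately show "s1 ''N'' 0 - s1 ''T'' 0 \<le> z * q + 1" by linarith
  next
    fix s'
    assume I: "?I s'" and fr: "\<forall>x. x \<notin> assigned ?body \<longrightarrow> s' x = s1 x"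
      and cond: "val (Minus (V ''N'') (V ''T'')) s' \<noteq> 0"
    have "s' ''fail'' 0 \<noteq> 0" using I cond by (simp split: if_splits)
    moreover from this I have "s' ''N'' 0 = n * q + 1" "\<forall>T<s' ''T'' 0. \<not> (\<exists>y. trial p q K T y)" by simp_all
    moreover from this cond have "s' ''T'' 0 \<le> n * q" by simp
    moreover have "ready s'" using fr by (intro ready_cong[OF rdy1]) simp_all
    ultimately show "wp ?body (\<lambda>t s''. t \<le> ?B \<and> ?I s'' \<and> s'' ''N'' 0 - s'' ''T'' 0 < s' ''N'' 0 - s' ''T'' 0) s'"
      by (intro body)
  qed
  define sT where "sT = s(''T'' := (s ''T'')(0 := 0))"
  define sf where "sf = sT(''fail'' := (sT ''fail'')(0 := 1))"
  define s0 where "s0 = sf(''N'' := (sf ''N'')(0 := 1))"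
  note s0_defs = s0_def sf_def sT_def
  let ?c = "Put ''N'' (Plus (V ''N'') (Const q))"
  have init: "wp (For ''j'' (Elem ''in'' (Const 1)) ?c) (\<lambda>t s'. t \<le> n * (1 + 2) + 2 \<and> s' ''N'' 0 = n * q + 1 \<and>
      (\<forall>y. y \<noteq> ''j'' \<and> y \<notin> assigned ?c \<longrightarrow> s' y = s0 y)) s0"
    by (rule wp_For[where I = "\<lambda>k s'. s' ''N'' 0 = k * q + 1"]) (use n in \<open>simp_all add: s0_defs\<close>)
  have "wp (For ''j'' (Elem ''in'' (Const 1)) ?c ;; While (Minus (V ''N'') (V ''T'')) ?body)
      (\<lambda>t s'. 3 + t \<le> search_time p q z \<and> ready s' \<and>
        (if s' ''fail'' 0 = 0 then ?res s' else (\<forall>T\<le>n * q. \<not> (\<exists>y. trial p q K T y)))) s0"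
    unfolding wp_Seq[of "For _ _ _"]
  proof (rule wp_mono[OF init], elim conjE)
    fix t s1
    assume t: "t \<le> n * (1 + 2) + 2" and N: "s1 ''N'' 0 = n * q + 1"
      and fr: "\<forall>y. y \<noteq> ''j'' \<and> y \<notin> assigned ?c \<longrightarrow> s1 y = s0 y"
    have rdy1: "ready s1" using fr by (intro ready_cong[OF rdy]) (simp_all add: s0_defs)
    have I: "?I s1" using fr N by (simp add: s0_defs)
    show "wp (While (Minus (V ''N'') (V ''T'')) ?body) (\<lambda>t' s'. 3 + (t + t') \<le> search_time p q z \<and> ready s' \<and>
        (if s' ''fail'' 0 = 0 then ?res s' else (\<forall>T\<le>n * q. \<not> (\<exists>y. trial p q K T y)))) s1"
    proof (rule wp_mono[OF loop[OF rdy1 I]])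
      fix t' s'
      assume 2: "t' \<le> (z * q + 1) * (?B + 1) + 1 \<and> ?I s' \<and> val (Minus (V ''N'') (V ''T'')) s' = 0 \<and>
        (\<forall>x. x \<notin> assigned ?body \<longrightarrow> s' x = s1 x)"
      have "ready s'" using 2 by (intro ready_cong[OF rdy1]) simp_all
      moreover have "3 + (t + t') \<le> search_time p q z"
      proof -
        have "?B + 1 = attempt_time p q z + 3" by simp
        then have "t' \<le> (z * q + 1) * (attempt_time p q z + 3) + 1" using 2 by metis
        moreover have "t \<le> z * 3 + 2" using t z by simp
        ultimately show ?thesis unfolding search_time_def of_nat_id by linarith
      qed
      moreover have "if s' ''fail'' 0 = 0 then ?res s' else (\<forall>T\<le>n * q. \<not> (\<exists>y. trial p q K T y))"
      proof (cases "s' ''fail'' 0 = 0")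
        case True
        then have "?res s'" using 2 by presburger
        with True show ?thesis by presburger
      next
        case False
        then have "s' ''N'' 0 = n * q + 1" "\<forall>T<s' ''T'' 0. \<not> (\<exists>y. trial p q K T y)"
          using 2 by presburger+
        moreover from this 2 have "n * q < s' ''T'' 0" by simp
        ultimately show ?thesis using False by auto
      qed
      ultimately show "3 + (t + t') \<le> search_time p q z \<and> ready s' \<and>
        (if s' ''fail'' 0 = 0 then ?res s' else (\<forall>T\<le>n * q. \<not> (\<exists>y. trial p q K T y)))" by blast
    qed
  qed
  then have "wp (For ''j'' (Elem ''in'' (Const 1)) ?c ;; While (Minus (V ''N'') (V ''T'')) ?body)
      (\<lambda>t s'. 1 + (1 + (1 + t)) \<le> search_time p q z \<and> ready s' \<and>
        (if s' ''fail'' 0 = 0 then ?res s' else (\<forall>T\<le>n * q. \<not> (\<exists>y. trial p q K T y)))) s0"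
    by (rule wp_mono) linarith
  then show ?thesis
    unfolding search_def wp_Seq[of "Put _ _"] wp_Assign val.simps s0_defs .
qed

lemma wp_weigh:
  assumes rdy: "ready s" and R: "s ''R'' 0 = R" and tidy: "tidy m n s"
    and 0: "\<And>i. i < m \<Longrightarrow> s ''X'' i = 0 \<and> s ''Y'' i = 0"
  shows "wp (weigh p q) (\<lambda>t s'. t \<le> R * 6 + 2 \<and>
    (\<forall>i<m. s' ''Y'' i = (\<Sum>j | j < n \<and> big j. share s i j) \<and>
      s' ''X'' i = p * (\<Sum>j | j < n \<and> big j. share s i j) + q * (\<Sum>j | j < n \<and> \<not> big j. share s i j)) \<and>
    (\<forall>x. x \<notin> assigned (weigh p q) \<longrightarrow> s' x = s x)) s"
proof -
  let ?inc = "Assign ''X'' (Elem ''mach'' (V ''r'')) (Plus (Elem ''X'' (Elem ''mach'' (V ''r''))) (Const q))"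
  let ?c = "Cond (Elem ''a'' (V ''r''))
     (Cond (Elem ''in'' (Plus (Const 2) (Elem ''job'' (Minus (Elem ''a'' (V ''r'')) (Const 1)))))
       (Assign ''X'' (Elem ''mach'' (V ''r'')) (Plus (Elem ''X'' (Elem ''mach'' (V ''r''))) (Const p)) ;;
        Assign ''Y'' (Elem ''mach'' (V ''r'')) (Plus (Elem ''Y'' (Elem ''mach'' (V ''r''))) (Const 1))) ?inc)
     Skip"
  define P where "P i r \<longleftrightarrow> s ''mach'' r = i \<and> s ''a'' r \<noteq> 0" for i r
  define f where "f r = s ''job'' (s ''a'' r - 1)" for r
  let ?U = "\<lambda>k i. cnt k (\<lambda>r. P i r \<and> f r \<in> {j. j < n \<and> big j})"
  let ?W = "\<lambda>k i. cnt k (\<lambda>r. P i r \<and> f r \<in> {j. j < n \<and> \<not> big j})"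
  let ?I = "\<lambda>k s'. \<forall>i<m. s' ''Y'' i = ?U k i \<and> s' ''X'' i = p * ?U k i + q * ?W k i"
  have "wp (weigh p q) (\<lambda>t s'. t \<le> R * (4 + 2) + 2 \<and> ?I R s' \<and>
      (\<forall>y. y \<noteq> ''r'' \<and> y \<notin> assigned ?c \<longrightarrow> s' y = s y)) s"
    unfolding weigh_def
  proof (rule wp_For[where I = ?I])
    fix k s'
    assume k: "k < R" "s' ''r'' 0 = k" and I: "?I k s'"
      and fr: "\<forall>y. y \<noteq> ''r'' \<and> y \<notin> assigned ?c \<longrightarrow> s' y = s y"
    have eq: "s' ''in'' = s ''in''" "s' ''mach'' = s ''mach''" "s' ''a'' = s ''a''" "s' ''job'' = s ''job''"
      using fr by simp_all
    have fk: "f k < n" if "s ''a'' k \<noteq> 0" using tidy k R that by (simp add: tidy_def f_def)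
    have fk': "s ''job'' (s ''a'' k - Suc 0) = f k" by (simp add: f_def)
    have bigk: "s ''in'' (Suc (Suc (f k))) = of_bool (big (f k))" if "s ''a'' k \<noteq> 0"
      using rdy fk[OF that] by (simp add: ready_def)
    show "wp ?c (\<lambda>t s''. t \<le> 4 \<and> ?I (Suc k) (s''(''r'' := (s'' ''r'')(0 := Suc k)))) s'"
    proof (cases "s ''a'' k = 0")
      case True
      then show ?thesis using I k by (simp add: eq cnt_Suc P_def)
    next
      case False
      then show ?thesis
        using I k fk bigk
        by (cases "big (f k)") (simp_all add: eq cnt_Suc P_def fk' algebra_simps)
    qed
  qed (use 0 R in simp_all)
  moreover have "?U R i = (\<Sum>j | j < n \<and> big j. share s i j)" "?W R i = (\<Sum>j | j < n \<and> \<not> big j. share s i j)" for i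
    unfolding share_def R P_def f_def by (rule cnt_sum[symmetric], simp)+
  ultimately show ?thesis by (elim wp_mono) simp
qed

lemma assigned_rounding [simp]:
  "assigned (rounding p q) = insert ''X'' (insert ''Y'' (assigned (solve 1 1 1 1)))"
  by (auto simp: rounding_def)

lemma sum_split_big:
  fixes g :: "nat \<Rightarrow> 'a :: comm_monoid_add"
  shows "(\<Sum>j<n. g j) = (\<Sum>j | j < n \<and> big j. g j) + (\<Sum>j | j < n \<and> \<not> big j. g j)"
  by (subst sum.union_disjoint[symmetric]) (auto intro: sum.cong)

lemma wp_rounding:
  assumes rdy: "ready s" and pq: "0 < p" "p \<le> q" and R: "s ''R'' 0 \<le> z * (z * q + 1)" and tidy: "tidy m n s"
    and T: "T \<le> n * q"
    and feas: "feasible (\<lambda>j. if big j then q else p) (\<lambda>i. T) (\<lambda>i. T) (\<lambda>i j. real (share s i j))"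
    and z: "m \<le> z" "n \<le> z"
  shows "wp (rounding p q) (\<lambda>t s'. t \<le> round_time p q z \<and> s' ''R'' 0 \<le> z * round_slots p q z \<and> tidy m n s' \<and>
    (\<exists>U W. (\<forall>i<m. U i + W i \<le> T) \<and>
      feasible (\<lambda>j. 1) (\<lambda>i. steps (p * q) (p * U i + q * W i)) (\<lambda>i. steps q (U i)) (\<lambda>i j. real (share s' i j)))) s"
proof -
  define U where "U i = (\<Sum>j | j < n \<and> big j. share s i j)" for i
  define W where "W i = (\<Sum>j | j < n \<and> \<not> big j. share s i j)" for i
  have UW: "U i + W i \<le> T" if "i < m" for i
  proof -
    have "real (U i + W i) = (\<Sum>j<n. real (share s i j))"
      by (simp add: sum_split_big U_def W_def)
    also have "\<dots> \<le> real T" using feas that by (simp add: feasible_def)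
    finally show ?thesis by simp
  qed
  have steps2: "steps2 (p * q) q (p * U i + q * W i) (U i) = steps q (U i)" for i
  proof (rule steps2_eq_steps)
    fix k assume "q * k < U i"
    then have "p * (q * k) < p * U i" using pq(1) by (rule mult_strict_left_mono)
    then show "p * q * k < p * U i + q * W i" unfolding mult.assoc by linarith
  qed
  let ?c = "\<lambda>i. steps (p * q) (p * U i + q * W i)" and ?b = "\<lambda>i. steps q (U i)"
  \<comment> \<open>Dividing by the number of units per job turns numbers of units into fractions of
    jobs. On machine \<open>i\<close> these add up to \<open>U i / q\<close> for big jobs and
    \<open>W i / p\<close> for small ones, which the ceilings cover.\<close>
  have fractional: "feasible (\<lambda>j. 1) ?c ?b (\<lambda>i j. real (share s i j) / real (if big j then q else p))"
    unfolding feasible_def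
  proof (intro conjI allI impI)
    fix j assume j: "j < n"
    have "(\<Sum>i<m. real (share s i j)) = real (if big j then q else p)" using feas j by (simp add: feasible_def)
    then show "(\<Sum>i<m. real (share s i j) / real (if big j then q else p)) = real 1"
      using pq by (simp flip: sum_divide_distrib)
  next
    fix i assume i: "i < m"
    have big: "(\<Sum>j | j < n \<and> big j. real (share s i j) / real (if big j then q else p)) = real (U i) / real q"
      by (simp add: U_def sum_divide_distrib)
    have small: "(\<Sum>j | j < n \<and> \<not> big j. real (share s i j) / real (if big j then q else p)) = real (W i) / real p"
      by (simp add: W_def sum_divide_distrib)
    have "real (p * U i + q * W i) \<le> real (p * q * ?c i)"
      using pq by (intro of_nat_mono steps_bounds) simp
    then show "(\<Sum>j<n. real (share s i j) / real (if big j then q else p)) \<le> real (?c i)"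
      unfolding sum_split_big big small using pq by (simp add: field_simps)
    have "real (U i) \<le> real (q * ?b i)" using pq by (intro of_nat_mono steps_bounds) simp
    then show "(\<Sum>j | j < n \<and> big j. real (share s i j) / real (if big j then q else p)) \<le> real (?b i)"
      unfolding big using pq by (simp add: field_simps)
  next
    fix i j assume "i < m" "j < n"
    then show "i \<in> \<Gamma> j" if "real (share s i j) / real (if big j then q else p) \<noteq> 0"
      using feas that by (auto simp: feasible_def)
  qed simp
  have D: "p * U i + q * W i \<le> round_slots p q z" if "i < m" for i
  proof -
    have "p * U i + q * W i \<le> (p + q) * (U i + W i)" by (simp add: algebra_simps)
    also have "U i + W i \<le> z * q + 1"
    proof -
      have "n * q \<le> z * q" using z by simp
      then show ?thesis using UW[OF that] T by linarith
    qed
    finally show ?thesis by (simp add: round_slots_def)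
  qed
  show ?thesis
    unfolding rounding_def wp_Seq
  proof (rule wp_mono[OF wp_fill[where s = s and d = "Const 0" and e = "Const 0" and x = 0 and y = 0]])
    show "s ''in'' 0 = m" using rdy by (simp add: ready_def)
    fix t1 s1
    assume 1: "t1 \<le> m * 4 + 2 \<and> (\<forall>i<m. s1 ''X'' i = 0 \<and> s1 ''Y'' i = 0) \<and>
      (\<forall>z. z \<notin> assigned (fill (Const 0) (Const 0)) \<longrightarrow> s1 z = s z)"
    have rdy1: "ready s1" using 1 by (intro ready_cong[OF rdy]) simp_all
    have tidy1: "tidy m n s1" using 1 tidy by (simp add: tidy_def)
    have share1: "share s1 = share s" using 1 by (simp add: share_def fun_eq_iff)
    have X1: "s1 ''X'' i = 0 \<and> s1 ''Y'' i = 0" if "i < m" for i using 1 that by blast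
    show "wp (weigh p q) (\<lambda>t2. wp (solve 1 1 (p * q) q) (\<lambda>t3 s'. t1 + (t2 + t3) \<le> round_time p q z \<and>
      s' ''R'' 0 \<le> z * round_slots p q z \<and> tidy m n s' \<and>
      (\<exists>U W. (\<forall>i<m. U i + W i \<le> T) \<and>
        feasible (\<lambda>j. 1) (\<lambda>i. steps (p * q) (p * U i + q * W i)) (\<lambda>i. steps q (U i)) (\<lambda>i j. real (share s' i j))))) s1"
    proof (rule wp_mono[OF wp_weigh[where s = s1, OF rdy1 refl tidy1 X1]], assumption, unfold share1, fold U_def W_def)
      fix t2 s2
      assume 2: "t2 \<le> s1 ''R'' 0 * 6 + 2 \<and>
        (\<forall>i<m. s2 ''Y'' i = U i \<and> s2 ''X'' i = p * U i + q * W i) \<and>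
        (\<forall>x. x \<notin> assigned (weigh p q) \<longrightarrow> s2 x = s1 x)"
      have rdy2: "ready s2" using 2 by (intro ready_cong[OF rdy1]) simp_all
      have D2: "\<And>i. i < m \<Longrightarrow> s2 ''X'' i \<le> round_slots p q z" using 2 D by simp
      have feas2: "feasible (\<lambda>j. if big j then 1 else 1) (\<lambda>i. steps (p * q) (s2 ''X'' i))
          (\<lambda>i. steps2 (p * q) q (s2 ''X'' i) (s2 ''Y'' i)) = feasible (\<lambda>j. 1) ?c ?b"
        unfolding if_cancel using 2 steps2 by (intro feasible_cong) simp_all
      have pq0: "0 < p * q" using pq by simp
      have t12: "t1 \<le> z * 4 + 2" "t2 \<le> z * (z * q + 1) * 6 + 2"
        using 1 2 R z(1) by simp_all
      show "wp (solve 1 1 (p * q) q) (\<lambda>t3 s'. t1 + (t2 + t3) \<le> round_time p q z \<and>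
        s' ''R'' 0 \<le> z * round_slots p q z \<and> tidy m n s' \<and>
        (\<exists>U W. (\<forall>i<m. U i + W i \<le> T) \<and>
          feasible (\<lambda>j. 1) (\<lambda>i. steps (p * q) (p * U i + q * W i)) (\<lambda>i. steps q (U i)) (\<lambda>i j. real (share s' i j)))) s2"
      proof (rule wp_mono[OF wp_solve[where s = s2 and u = 1 and v = 1 and a = "p * q" and b = q and z = z
              and D = "round_slots p q z", OF rdy2 pq0 D2 z, unfolded feas2, folded tidy_def]], assumption)
        fix t3 s3
        assume 3: "t3 \<le> solve_time (1 + 1) (round_slots p q z) z \<and> s3 ''R'' 0 \<le> z * round_slots p q z \<and>
          (if s3 ''fail'' 0 = 0
           then feasible (\<lambda>j. 1) ?c ?b (\<lambda>i j. real (share s3 i j)) \<and> tidy m n s3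
           else \<not> (\<exists>y. feasible (\<lambda>j. 1) ?c ?b y)) \<and>
          (\<forall>x. x \<notin> assigned (solve 1 1 (p * q) q) \<longrightarrow> s3 x = s2 x)"
        \<comment> \<open>The fractional assignment guarantees that this second matching
          exists.\<close>
        have "s3 ''fail'' 0 = 0" using 3 fractional by presburger
        then have "feasible (\<lambda>j. 1) ?c ?b (\<lambda>i j. real (share s3 i j))" "tidy m n s3" using 3 by presburger+
        moreover have "t1 + (t2 + t3) \<le> round_time p q z"
          using 3 t12 unfolding round_time_def of_nat_id one_add_one by linarith
        ultimately show "t1 + (t2 + t3) \<le> round_time p q z \<and> s3 ''R'' 0 \<le> z * round_slots p q z \<and> tidy m n s3 \<and>
          (\<exists>U W. (\<forall>i<m. U i + W i \<le> T) \<and>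
            feasible (\<lambda>j. 1) (\<lambda>i. steps (p * q) (p * U i + q * W i)) (\<lambda>i. steps q (U i)) (\<lambda>i j. real (share s3 i j)))"
          using 3 UW by blast
      qed
    qed
  qed simp_all
qed

lemma wp_write_out:
  assumes R: "s ''R'' 0 = R" and tidy: "tidy m n s"
    and feas: "feasible (\<lambda>j. 1) c b (\<lambda>i j. real (share s i j))"
  shows "wp write_out (\<lambda>t s'. t \<le> R * 4 + 2 \<and>
    (\<forall>j<n. s' ''out'' j < m \<and> s' ''out'' j \<in> \<Gamma> j) \<and>
    (\<forall>i<m. card {j. j < n \<and> s' ''out'' j = i} \<le> c i \<and> card {j. (j < n \<and> big j) \<and> s' ''out'' j = i} \<le> b i)) s"
proof -
  let ?c = "Cond (Elem ''a'' (V ''r''))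
     (Assign ''out'' (Elem ''job'' (Minus (Elem ''a'' (V ''r'')) (Const 1))) (Elem ''mach'' (V ''r''))) Skip"
  let ?P = "\<lambda>r j. s ''a'' r \<noteq> 0 \<and> s ''job'' (s ''a'' r - 1) = j"
  \<comment> \<open>Recording that the machine of a job comes from some slot holding that job is
    enough: the indicator of \<open>out j = i\<close> is then at most \<open>share s i j\<close>,
    and the capacities bound the sums of the shares.\<close>
  let ?I = "\<lambda>k s'. \<forall>j. (\<exists>r<k. ?P r j) \<longrightarrow> (\<exists>r<k. ?P r j \<and> s' ''out'' j = s ''mach'' r)"
  have "wp write_out (\<lambda>t s'. t \<le> R * (2 + 2) + 2 \<and> ?I R s' \<and>
      (\<forall>y. y \<noteq> ''r'' \<and> y \<notin> assigned ?c \<longrightarrow> s' y = s y)) s"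
    unfolding write_out_def
  proof (rule wp_For[where I = ?I])
    fix k :: nat and s'
    assume I: "?I k s'" and k: "s' ''r'' 0 = k"
      and fr: "\<forall>y. y \<noteq> ''r'' \<and> y \<notin> assigned ?c \<longrightarrow> s' y = s y"
    have eq: "s' ''mach'' = s ''mach''" "s' ''a'' = s ''a''" "s' ''job'' = s ''job''" using fr by simp_all
    show "wp ?c (\<lambda>t s''. t \<le> 2 \<and> ?I (Suc k) (s''(''r'' := (s'' ''r'')(0 := Suc k)))) s'"
    proof (cases "s ''a'' k = 0")
      case True
      have "?I (Suc k) s'"
        using I True by (metis less_Suc_eq)
      then show ?thesis using k True by (simp add: eq)
    next
      case False
      define out where "out = (s' ''out'')(s ''job'' (s ''a'' k - 1) := s ''mach'' k)"
      have "\<exists>r<Suc k. ?P r j \<and> out j = s ''mach'' r" if "r < Suc k" "?P r j" for r j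
      proof (cases "j = s ''job'' (s ''a'' k - 1)")
        case True
        then show ?thesis using False by (intro exI[of _ k]) (simp add: out_def)
      next
        case ne: False
        with that have "r < k" by (cases "r = k") auto
        with I that obtain r' where "r' < k" "?P r' j" "s' ''out'' j = s ''mach'' r'" by blast
        then show ?thesis using ne by (intro exI[of _ r']) (simp add: out_def)
      qed
      then have "?I (Suc k) (s'(''out'' := out))" by auto
      then show ?thesis using k False by (simp add: eq out_def)
    qed
  qed (use R in simp_all)
  then show ?thesis
  proof (rule wp_mono)
    fix t s'
    assume *: "t \<le> R * (2 + 2) + 2 \<and> ?I R s' \<and> (\<forall>y. y \<noteq> ''r'' \<and> y \<notin> assigned ?c \<longrightarrow> s' y = s y)"
    let ?out = "s' ''out''"
    have out: "?out j < m \<and> share s (?out j) j \<noteq> 0" if j: "j < n" for j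
    proof -
      have "(\<Sum>i<m. real (share s i j)) = 1" using feas j by (simp add: feasible_def)
      moreover have "(\<Sum>i<m. real (share s i j)) = 0" if "\<not> (\<exists>i<m. share s i j \<noteq> 0)"
        using that by (intro sum.neutral) auto
      ultimately obtain i where "i < m" "share s i j \<noteq> 0" by (metis zero_neq_one)
      then have "\<exists>r<R. ?P r j" unfolding share_def R cnt_eq_0 by blast
      then obtain r where r: "r < R" "?P r j" "?out j = s ''mach'' r" using * by blast
      moreover from this have "s ''mach'' r < m" using tidy R by (simp add: tidy_def)
      ultimately show ?thesis unfolding share_def R cnt_eq_0 by metis
    qed
    have count: "real (card {j. P j \<and> ?out j = i}) \<le> (\<Sum>j | P j. real (share s i j))"
      if "\<And>j. P j \<Longrightarrow> j < n" for P i
    proof -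
      have "{j. P j} \<subseteq> {..<n}" using that by blast
      then have fin: "finite {j. P j}" by (rule finite_subset) simp
      have "real (card {j. P j \<and> ?out j = i}) = (\<Sum>j | P j. of_bool (?out j = i))"
        using fin by (simp add: sum.If_cases of_bool_def Int_def)
      also have "\<dots> \<le> (\<Sum>j | P j. real (share s i j))"
        using out that by (intro sum_mono) (fastforce simp: Suc_le_eq)
      finally show ?thesis .
    qed
    have "card {j. j < n \<and> ?out j = i} \<le> c i \<and> card {j. (j < n \<and> big j) \<and> ?out j = i} \<le> b i" if "i < m" for i
    proof -
      have "(\<Sum>j | j < n. real (share s i j)) \<le> real (c i)" "(\<Sum>j | j < n \<and> big j. real (share s i j)) \<le> real (b i)"
        using feas that by (simp_all add: feasible_def lessThan_def)
      with count[of "\<lambda>j. j < n" i] count[of "\<lambda>j. j < n \<and> big j" i]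
      have "real (card {j. j < n \<and> ?out j = i}) \<le> real (c i)"
        "real (card {j. (j < n \<and> big j) \<and> ?out j = i}) \<le> real (b i)" by simp_all
      then show ?thesis by simp
    qed
    moreover have "?out j < m \<and> ?out j \<in> \<Gamma> j" if "j < n" for j
      using out[OF that] feas that by (auto simp: feasible_def)
    ultimately show "t \<le> R * 4 + 2 \<and> (\<forall>j<n. ?out j < m \<and> ?out j \<in> \<Gamma> j) \<and>
      (\<forall>i<m. card {j. j < n \<and> ?out j = i} \<le> c i \<and> card {j. (j < n \<and> big j) \<and> ?out j = i} \<le> b i)"
      using * by simp
  qed
qed

section \<open>Loads of a schedule and the cost of rounding\<close>

definition load :: "(nat \<Rightarrow> nat) \<Rightarrow> nat \<Rightarrow> nat" where
  "load \<sigma> i = card {j. j < n \<and> \<sigma> j = i}"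

definition big_load :: "(nat \<Rightarrow> nat) \<Rightarrow> nat \<Rightarrow> nat" where
  "big_load \<sigma> i = card {j. (j < n \<and> big j) \<and> \<sigma> j = i}"

definition valid :: "(nat \<Rightarrow> nat) \<Rightarrow> bool" where
  "valid \<sigma> \<longleftrightarrow> (\<forall>j<n. \<sigma> j < m \<and> \<sigma> j \<in> \<Gamma> j)"

text \<open>\<open>p * N + (q - p) * B\<close> is the length, in units of \<open>1 / q\<close>, of
  \<open>N\<close> jobs of which \<open>B\<close> are big. The additional \<open>q\<close> is the
  length of one big job.\<close>

definition good :: "nat \<Rightarrow> nat \<Rightarrow> nat \<Rightarrow> nat \<Rightarrow> (nat \<Rightarrow> nat) \<Rightarrow> bool" where
  "good p q K T \<sigma> \<longleftrightarrow> valid \<sigma> \<and>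
     (\<forall>i<m. if T \<le> K * q then load \<sigma> i \<le> T div p \<and> big_load \<sigma> i \<le> T div q
       else p * load \<sigma> i + (q - p) * big_load \<sigma> i < T + q)"

text \<open>Without rounding, the left-hand side would be
  \<open>p * (U / q + W / p) + (q - p) * (U / q) = U + W\<close>. Either ceiling adds less than 1,
  and the weights \<open>p\<close> and \<open>q - p\<close> add up to \<open>q\<close>. As both
  weights are nonnegative, upper bounds for \<open>N\<close> and \<open>B\<close> are all that is
  needed.\<close>

lemma rounding_load:
  assumes pq: "0 < p" "p \<le> q" and "U + W \<le> T"
    and N: "N \<le> steps (p * q) (p * U + q * W)" and B: "B \<le> steps q U"
  shows "p * N + (q - p) * B < T + q"
proof -
  have "(p * q) * N \<le> (p * q) * steps (p * q) (p * U + q * W)" using N by simp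
  also have "\<dots> < p * U + q * W + p * q" using pq by (intro steps_bounds) simp
  finally have 1: "(p * q) * N < p * U + q * W + p * q" .
  have "q * B \<le> q * steps q U" using B by simp
  also have "\<dots> < U + q" using pq by (intro steps_bounds) simp
  finally have "(q - p) * (q * B) \<le> (q - p) * (U + q)" by simp
  with 1 have "(p * q) * N + (q - p) * (q * B) < p * U + q * W + p * q + (q - p) * (U + q)" by linarith
  also have "\<dots> = q * (U + W + q)"
  proof -
    obtain d where "q = p + d" using pq(2) le_Suc_ex by blast
    then show ?thesis by (simp add: algebra_simps)
  qed
  also have "\<dots> \<le> q * (T + q)" using assms(3) by simp
  finally have "q * (p * N + (q - p) * B) < q * (T + q)" by (simp add: algebra_simps)
  then show ?thesis by simp
qed

lemma wp_algorithm:
  assumes inn: "s ''in'' 0 = m" "s ''in'' 1 = n" "\<And>j. j < n \<Longrightarrow> s ''in'' (2 + j) = of_bool (big j)"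
      "\<And>i j. i < m \<Longrightarrow> j < n \<Longrightarrow> s ''in'' (2 + n + m * j + i) = of_bool (i \<in> \<Gamma> j)"
    and pq: "0 < p" "p \<le> q" and z: "m \<le> z" "n \<le> z"
  shows "wp (algorithm p q K) (\<lambda>t s'. t \<le> algorithm_time p q z \<and>
    ((\<exists>T\<le>n * q. \<exists>y. trial p q K T y) \<longrightarrow>
     (\<exists>T. (\<forall>T'<T. \<not> (\<exists>y. trial p q K T' y)) \<and> good p q K T (s' ''out'')))) s"
proof -
  let ?Q = "\<lambda>t s'. t \<le> algorithm_time p q z \<and>
    ((\<exists>T\<le>n * q. \<exists>y. trial p q K T y) \<longrightarrow>
     (\<exists>T. (\<forall>T'<T. \<not> (\<exists>y. trial p q K T' y)) \<and> good p q K T (s' ''out'')))"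
  let ?round = "Cond (Minus (V ''T'') (Const (K * q))) (rounding p q) Skip"
  have final: "wp write_out (\<lambda>t s'. ?Q (t0 + t) s') s2"
    if "t0 \<le> z * 4 + 3 + search_time p q z + 2 + round_time p q z"
      and R: "s2 ''R'' 0 \<le> z * (z * q + 1) + z * round_slots p q z" and "tidy m n s2"
      and feas: "feasible (\<lambda>j. 1) c b (\<lambda>i j. real (share s2 i j))"
      and none: "\<forall>T'<T. \<not> (\<exists>y. trial p q K T' y)"
      and cb: "\<And>\<sigma>. valid \<sigma> \<Longrightarrow> (\<And>i. i < m \<Longrightarrow> load \<sigma> i \<le> c i \<and> big_load \<sigma> i \<le> b i) \<Longrightarrow> good p q K T \<sigma>"
    for t0 s2 c b T
  proof (rule wp_mono[OF wp_write_out[where s = s2, OF refl \<open>tidy m n s2\<close> feas]])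
    fix t s'
    assume *: "t \<le> s2 ''R'' 0 * 4 + 2 \<and> (\<forall>j<n. s' ''out'' j < m \<and> s' ''out'' j \<in> \<Gamma> j) \<and>
      (\<forall>i<m. card {j. j < n \<and> s' ''out'' j = i} \<le> c i \<and> card {j. (j < n \<and> big j) \<and> s' ''out'' j = i} \<le> b i)"
    then have "good p q K T (s' ''out'')"
      by (intro cb) (simp_all add: valid_def load_def big_load_def)
    moreover have "t0 + t \<le> algorithm_time p q z"
    proof -
      have "t \<le> s2 ''R'' 0 * 4 + 2" using * by blast
      also have "\<dots> \<le> (z * (z * q + 1) + z * round_slots p q z) * 4 + 2"
        using R by (intro add_mono mult_le_mono1 order_refl)
      finally have "t0 + t \<le> (z * 4 + 3 + search_time p q z + 2 + round_time p q z) +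
          ((z * (z * q + 1) + z * round_slots p q z) * 4 + 2)"
        using that(1) by (intro add_mono)
      then show ?thesis by (simp add: algorithm_time_def)
    qed
    ultimately show "?Q (t0 + t) s'" using none by blast
  qed
  have "wp rows (\<lambda>t1. wp (search p q K) (\<lambda>t2. wp (Cond (V ''fail'') Skip (?round ;; write_out))
      (\<lambda>t3. ?Q (t1 + (t2 + t3))))) s"
  proof (rule wp_mono[OF wp_rows[where s = s, OF inn z(2)]], assumption, assumption, assumption, elim conjE)
    fix t1 s1
    assume t1: "t1 \<le> z * 4 + 3" and rdy1: "ready s1"
    show "wp (search p q K) (\<lambda>t2. wp (Cond (V ''fail'') Skip (?round ;; write_out))
      (\<lambda>t3. ?Q (t1 + (t2 + t3)))) s1"
    proof (rule wp_mono[OF wp_search[where s = s1 and K = K, OF rdy1 pq z]], elim conjE)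
      fix t2 s2
      assume t2: "t2 \<le> search_time p q z" and rdy2: "ready s2"
        and res: "if s2 ''fail'' 0 = 0
         then s2 ''T'' 0 \<le> n * q \<and> s2 ''R'' 0 \<le> z * (z * q + 1) \<and> tidy m n s2 \<and>
           trial p q K (s2 ''T'' 0) (\<lambda>i j. real (share s2 i j)) \<and> (\<forall>T<s2 ''T'' 0. \<not> (\<exists>y. trial p q K T y))
         else (\<forall>T\<le>n * q. \<not> (\<exists>y. trial p q K T y))"
      define T where "T = s2 ''T'' 0"
      show "wp (Cond (V ''fail'') Skip (?round ;; write_out)) (\<lambda>t3. ?Q (t1 + (t2 + t3))) s2"
      proof (cases "s2 ''fail'' 0 = 0")
        case False
        then have "\<not> (\<exists>T\<le>n * q. \<exists>y. trial p q K T y)" using res by auto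
        moreover have "t1 + (t2 + 2) \<le> algorithm_time p q z"
          using t1 t2 unfolding algorithm_time_def by linarith
        ultimately have "?Q (t1 + (t2 + 2)) s2" by blast
        then show ?thesis unfolding wp_Cond wp_Skip using False by (simp del: One_nat_def)
      next
        case True
        then have T: "T \<le> n * q" "s2 ''R'' 0 \<le> z * (z * q + 1)" "tidy m n s2"
            "trial p q K T (\<lambda>i j. real (share s2 i j))" "\<forall>T'<T. \<not> (\<exists>y. trial p q K T' y)"
          using res unfolding T_def by presburger+
        have "wp ?round (\<lambda>t3. wp write_out (\<lambda>t4. ?Q (t1 + (t2 + (t3 + t4 + 1))))) s2"
        proof (cases "T \<le> K * q")
          case True
          have "wp write_out (\<lambda>t. ?Q (t1 + t2 + 3 + t)) s2"
          proof (rule final[where T = T])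
            show "t1 + t2 + 3 \<le> z * 4 + 3 + search_time p q z + 2 + round_time p q z"
              using t1 t2 unfolding round_time_def by linarith
            show "s2 ''R'' 0 \<le> z * (z * q + 1) + z * round_slots p q z" using T(2) by linarith
            show "feasible (\<lambda>j. 1) (\<lambda>i. T div p) (\<lambda>i. T div q) (\<lambda>i j. real (share s2 i j))"
              using T(4) True unfolding trial_def by presburger
          qed (use T True in \<open>simp_all add: good_def\<close>)
          then have "wp write_out (\<lambda>t. ?Q (t1 + (t2 + (2 + t + 1)))) s2"
            by (rule wp_mono) (simp add: ac_simps numeral_3_eq_3)
          then show ?thesis unfolding wp_Cond wp_Skip using True by (simp add: T_def)
        next
          case False
          then have feas: "feasible (\<lambda>j. if big j then q else p) (\<lambda>i. T) (\<lambda>i. T) (\<lambda>i j. real (share s2 i j))"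
            using T(4) unfolding trial_def by presburger
          have "wp (rounding p q) (\<lambda>t3. wp write_out (\<lambda>t4. ?Q (t1 + (t2 + (t3 + 1 + t4 + 1))))) s2"
          proof (rule wp_mono[OF wp_rounding[where s = s2, OF rdy2 pq T(2,3,1) feas z]], elim conjE exE)
            fix t3 s3 U W
            assume t3: "t3 \<le> round_time p q z" and R: "s3 ''R'' 0 \<le> z * round_slots p q z" and "tidy m n s3"
              and UW: "\<forall>i<m. U i + W i \<le> T"
              and feas: "feasible (\<lambda>j. 1) (\<lambda>i. steps (p * q) (p * U i + q * W i)) (\<lambda>i. steps q (U i))
                (\<lambda>i j. real (share s3 i j))"
            have "wp write_out (\<lambda>t. ?Q (t1 + t2 + t3 + 2 + t)) s3"
            proof (rule final[OF _ _ \<open>tidy m n s3\<close> feas T(5)])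
              show "t1 + t2 + t3 + 2 \<le> z * 4 + 3 + search_time p q z + 2 + round_time p q z"
                using t1 t2 t3 by linarith
              show "s3 ''R'' 0 \<le> z * (z * q + 1) + z * round_slots p q z" using R by linarith
              show "good p q K T \<sigma>" if "valid \<sigma>"
                "\<And>i. i < m \<Longrightarrow> load \<sigma> i \<le> steps (p * q) (p * U i + q * W i) \<and> big_load \<sigma> i \<le> steps q (U i)" for \<sigma>
                unfolding good_def if_not_P[OF False] using that UW by (auto intro!: rounding_load[OF pq])
            qed
            then show "wp write_out (\<lambda>t4. ?Q (t1 + (t2 + (t3 + 1 + t4 + 1)))) s3"
              by (rule wp_mono) (simp add: ac_simps)
          qed
          then show ?thesis unfolding wp_Cond using False by (simp add: T_def)
        qed
        then show ?thesis unfolding wp_Cond wp_Seq using True by simp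
      qed
    qed
  qed
  then show ?thesis unfolding algorithm_def wp_Seq .
qed

section \<open>The approximation guarantee\<close>

lemma valid_imp_feasible:
  assumes \<sigma>: "valid \<sigma>"
    and cb: "\<And>i. i < m \<Longrightarrow> (\<Sum>j | j < n \<and> \<sigma> j = i. \<mu> j) \<le> c i"
      "\<And>i. i < m \<Longrightarrow> (\<Sum>j | (j < n \<and> big j) \<and> \<sigma> j = i. \<mu> j) \<le> b i"
  shows "feasible \<mu> c b (\<lambda>i j. if \<sigma> j = i then real (\<mu> j) else 0)"
  unfolding feasible_def
proof (intro conjI allI impI)
  have restr: "(\<Sum>j | P j. if \<sigma> j = i then real (\<mu> j) else 0) = real (\<Sum>j | P j \<and> \<sigma> j = i. \<mu> j)"
    if "\<And>j. P j \<Longrightarrow> j < n" for P i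
  proof -
    have "{j. P j} \<subseteq> {..<n}" using that by blast
    then have fin: "finite {j. P j}" by (rule finite_subset) simp
    show ?thesis using sum.inter_filter[OF fin, of "\<lambda>j. real (\<mu> j)" "\<lambda>j. \<sigma> j = i"] by simp
  qed
  fix i assume i: "i < m"
  show "(\<Sum>j<n. if \<sigma> j = i then real (\<mu> j) else 0) \<le> real (c i)"
    using restr[of "\<lambda>j. j < n" i] cb(1)[OF i] by (simp add: lessThan_def del: of_nat_sum)
  show "(\<Sum>j | j < n \<and> big j. if \<sigma> j = i then real (\<mu> j) else 0) \<le> real (b i)"
    using restr[of "\<lambda>j. j < n \<and> big j" i] cb(2)[OF i] by (simp del: of_nat_sum)
next
  fix j assume "j < n"
  then show "(\<Sum>i<m. if \<sigma> j = i then real (\<mu> j) else 0) = real (\<mu> j)"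
    using \<sigma> by (simp add: valid_def)
qed (use \<sigma> in \<open>auto simp: valid_def split: if_splits\<close>)

lemma big_load_le: "big_load \<sigma> i \<le> load \<sigma> i"
  unfolding big_load_def load_def by (intro card_mono) auto

lemma load_le: "load \<sigma> i \<le> n"
proof -
  have "load \<sigma> i \<le> card {..<n}" unfolding load_def by (intro card_mono) auto
  then show ?thesis by simp
qed

lemma trial_of_valid:
  assumes \<sigma>: "valid \<sigma>" and pq: "0 < p" "p \<le> q"
    and small: "T \<le> K * q \<Longrightarrow> \<forall>i<m. q * big_load \<sigma> i \<le> T \<and> p * load \<sigma> i \<le> T"
    and large: "K * q < T \<Longrightarrow> \<forall>i<m. p * load \<sigma> i + (q - p) * big_load \<sigma> i \<le> T"
  shows "\<exists>y. trial p q K T y"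
proof (cases "T \<le> K * q")
  case True
  have "feasible (\<lambda>j. 1) (\<lambda>i. T div p) (\<lambda>i. T div q) (\<lambda>i j. if \<sigma> j = i then real 1 else 0)"
    using small[OF True] pq
    by (intro valid_imp_feasible \<sigma>)
      (simp_all add: load_def big_load_def less_eq_div_iff_mult_less_eq mult.commute)
  then show ?thesis using True unfolding trial_def by auto
next
  case False
  let ?\<mu> = "\<lambda>j. if big j then q else p"
  have "(\<Sum>j | j < n \<and> \<sigma> j = i. ?\<mu> j) \<le> T" if "i < m" for i
  proof -
    let ?S = "{j. j < n \<and> \<sigma> j = i}"
    have "?\<mu> j = p + (if big j then q - p else 0)" for j using pq by simp
    then have "(\<Sum>j\<in>?S. ?\<mu> j) = p * card ?S + (\<Sum>j\<in>?S. if big j then q - p else 0)"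
      by (simp add: sum.distrib)
    also have "(\<Sum>j\<in>?S. if big j then q - p else 0) = (q - p) * card {j. (j < n \<and> big j) \<and> \<sigma> j = i}"
    proof -
      have "{j \<in> ?S. big j} = {j. (j < n \<and> big j) \<and> \<sigma> j = i}" by auto
      then show ?thesis by (simp flip: sum.inter_filter)
    qed
    finally show ?thesis using large False that by (simp add: load_def big_load_def)
  qed
  moreover have "(\<Sum>j | (j < n \<and> big j) \<and> \<sigma> j = i. ?\<mu> j) \<le> (\<Sum>j | j < n \<and> \<sigma> j = i. ?\<mu> j)" for i
    by (intro sum_mono2) auto
  ultimately have "feasible ?\<mu> (\<lambda>i. T) (\<lambda>i. T) (\<lambda>i j. if \<sigma> j = i then real (?\<mu> j) else 0)"
    by (intro valid_imp_feasible \<sigma>) (auto intro: order_trans)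
  then show ?thesis using False unfolding trial_def by auto
qed

text \<open>Below the threshold \<open>K\<close> for the makespan, \<open>p / q\<close> is as good as \<open>\<epsilon>\<close> for comparing a number of big
  jobs with one of small jobs; above, the rounding error of one big job is a small fraction of
  the makespan, which leaves room for the error made by replacing \<open>\<epsilon>\<close> by \<open>p / q\<close>.\<close>

lemma good_approximates:
  fixes \<epsilon> Opt :: real
  assumes \<epsilon>: "0 < \<epsilon>" "\<epsilon> < 1" and pq: "0 < p" "p \<le> q" "\<epsilon> \<le> p / q" and K: "0 < K"
    and exact: "\<And>b t :: nat. b \<le> K \<Longrightarrow> q * b \<le> p * t \<Longrightarrow> b \<le> \<epsilon> * t"
    and slack: "(1 + 1 / K) * (p / q) \<le> (2 - \<epsilon>) * \<epsilon>"
    and "0 < m" and \<tau>: "valid \<tau>" and opt: "\<And>i. i < m \<Longrightarrow> (1 - \<epsilon>) * big_load \<tau> i + \<epsilon> * load \<tau> i \<le> Opt"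
  shows "\<exists>T\<le>n * q. \<exists>y. trial p q K T y"
    and "\<forall>T'<T. \<not> (\<exists>y. trial p q K T' y) \<Longrightarrow> good p q K T \<sigma> \<Longrightarrow> i < m \<Longrightarrow>
      (1 - \<epsilon>) * big_load \<sigma> i + \<epsilon> * load \<sigma> i \<le> (2 - \<epsilon>) * Opt"
proof -
  let ?A = "\<lambda>i. max (q * big_load \<tau> i) (p * load \<tau> i)"
  let ?B = "\<lambda>i. p * load \<tau> i + (q - p) * big_load \<tau> i"
  \<comment> \<open>\<open>T0\<close> and \<open>W0\<close> are the least \<open>T\<close> for which
    the optimal schedule \<open>\<tau>\<close> itself obeys the bounds of the relaxation for small
    and for large \<open>T\<close>, respectively.\<close>
  define T0 where "T0 = Max (?A ` {..<m})"
  define W0 where "W0 = Max (?B ` {..<m})"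
  have ne: "?A ` {..<m} \<noteq> {}" "?B ` {..<m} \<noteq> {}" using \<open>0 < m\<close> by auto
  have "T0 \<in> ?A ` {..<m}" "W0 \<in> ?B ` {..<m}"
    unfolding T0_def W0_def by (rule Max_in[OF _ ne(1)], simp, rule Max_in[OF _ ne(2)], simp)
  then obtain i0 i1 where i0: "i0 < m" "T0 = ?A i0" and i1: "i1 < m" "W0 = ?B i1" by auto
  have A: "?A i \<le> T0" and B: "?B i \<le> W0" if "i < m" for i
    using that unfolding T0_def W0_def by (intro Max_ge; simp)+
  have AB: "?A i \<le> ?B i" for i
  proof -
    have "q * big_load \<tau> i = p * big_load \<tau> i + (q - p) * big_load \<tau> i"
      using pq(2) by (simp flip: add_mult_distrib)
    moreover have "p * big_load \<tau> i \<le> p * load \<tau> i" using big_load_le by simp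
    ultimately show ?thesis by simp
  qed
  \<comment> \<open>This prevents a gap at the threshold: if \<open>T0\<close> is too large for the
    first relaxation to be used at \<open>T0\<close>, then \<open>W0\<close> is large enough for the
    second one.\<close>
  have "T0 \<le> W0" using i0 AB[of i0] B[of i0] by linarith
  have "W0 \<le> n * q"
  proof -
    have "W0 \<le> p * n + (q - p) * n"
      unfolding i1 using load_le order_trans[OF big_load_le load_le] by (intro add_mono mult_le_mono2)
    also have "\<dots> = n * q" using pq(2) by (simp flip: add_mult_distrib)
    finally show ?thesis .
  qed
  have trial0: "\<exists>y. trial p q K T0 y" if "T0 \<le> K * q"
    using A that by (intro trial_of_valid[OF \<tau> pq(1,2)]) auto
  have trial1: "\<exists>y. trial p q K W0 y" if "K * q < W0"
    using B that by (intro trial_of_valid[OF \<tau> pq(1,2)]) auto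
  show "\<exists>T\<le>n * q. \<exists>y. trial p q K T y"
    using trial0 trial1 \<open>T0 \<le> W0\<close> \<open>W0 \<le> n * q\<close> by (meson le_trans not_le)
  assume none: "\<forall>T'<T. \<not> (\<exists>y. trial p q K T' y)" and good: "good p q K T \<sigma>" and i: "i < m"
  define e where "e = real p / real q"
  have q: "real q > 0" using pq by simp
  have e: "\<epsilon> \<le> e" "e \<le> 1" using pq q by (simp_all add: e_def)
  have opt_big: "real (big_load \<tau> k) \<le> Opt" and opt_load: "\<epsilon> * real (load \<tau> k) \<le> Opt" if "k < m" for k
  proof -
    have "\<epsilon> * real (big_load \<tau> k) \<le> \<epsilon> * real (load \<tau> k)" using \<epsilon> big_load_le by simp
    then show "real (big_load \<tau> k) \<le> Opt" using opt[OF that] by (simp add: algebra_simps)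
    have "0 \<le> (1 - \<epsilon>) * real (big_load \<tau> k)" using \<epsilon> by simp
    then show "\<epsilon> * real (load \<tau> k) \<le> Opt" using opt[OF that] by linarith
  qed
  let ?b = "real (big_load \<sigma> i)" and ?l = "real (load \<sigma> i)"
  show "(1 - \<epsilon>) * ?b + \<epsilon> * ?l \<le> (2 - \<epsilon>) * Opt"
  proof (cases "T \<le> K * q")
    case True
    have "T \<le> T0"
    proof (rule ccontr)
      assume "\<not> T \<le> T0"
      then show False using none trial0 True by auto
    qed
    define b l where "b = T div q" and "l = T div p"
    have bl: "q * b \<le> T" "p * l \<le> T" by (simp_all add: b_def l_def)
    have "b \<le> K" using div_le_mono[OF True, of q] pq by (simp add: b_def)
    \<comment> \<open>One of the two terms of the maximum \<open>T0\<close> is at least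
      \<open>T\<close>. If it counts big jobs, \<open>\<epsilon> \<le> p / q\<close> translates it
      into a bound for \<open>\<epsilon> * l\<close>. If it counts all jobs, the translation into a
      bound for \<open>b\<close> goes the other way, and \<open>exact\<close> makes up for
      \<open>p / q\<close> being too large.\<close>
    have "real b \<le> Opt \<and> \<epsilon> * real l \<le> Opt"
    proof (cases "T \<le> q * big_load \<tau> i0")
      case T: True
      then have "q * b \<le> q * big_load \<tau> i0" using bl by linarith
      then have "b \<le> big_load \<tau> i0" using pq by simp
      then have "real b \<le> Opt" using opt_big[OF i0(1)] by linarith
      moreover have "real (p * l) \<le> real (q * big_load \<tau> i0)" using T bl by (intro of_nat_mono) linarith
      then have "e * real l \<le> real (big_load \<tau> i0)" using q by (simp add: e_def field_simps)
      moreover have "\<epsilon> * real l \<le> e * real l" using e by (intro mult_right_mono) auto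
      ultimately show ?thesis using opt_big[OF i0(1)] by linarith
    next
      case False
      then have T: "T \<le> p * load \<tau> i0" using \<open>T \<le> T0\<close> i0 by (simp add: max_def split: if_splits)
      then have "p * l \<le> p * load \<tau> i0" using bl by linarith
      then have "\<epsilon> * real l \<le> \<epsilon> * real (load \<tau> i0)" using pq \<epsilon> by simp
      moreover have "real b \<le> \<epsilon> * real (load \<tau> i0)"
        using bl T by (intro exact \<open>b \<le> K\<close>) linarith
      ultimately show ?thesis using opt_load[OF i0(1)] by linarith
    qed
    moreover have "?b \<le> real b" "?l \<le> real l"
      using good True i by (simp_all add: good_def b_def l_def)
    then have "(1 - \<epsilon>) * ?b \<le> (1 - \<epsilon>) * real b" "\<epsilon> * ?l \<le> \<epsilon> * real l"
      using \<epsilon> by (intro mult_left_mono; simp)+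
    moreover have "(1 - \<epsilon>) * real b \<le> (1 - \<epsilon>) * Opt"
      using calculation(1) \<epsilon> by (intro mult_left_mono) simp_all
    ultimately have "(1 - \<epsilon>) * ?b + \<epsilon> * ?l \<le> (1 - \<epsilon>) * Opt + Opt" by linarith
    then show ?thesis by (simp add: algebra_simps)
  next
    case False
    have "T \<le> W0"
    proof (rule ccontr)
      assume "\<not> T \<le> W0"
      moreover have "K * q < T0" using False \<open>T0 \<le> W0\<close> none trial0 calculation by (meson leD leI le_less_trans)
      ultimately show False using none trial1 \<open>T0 \<le> W0\<close> by auto
    qed
    let ?b1 = "real (big_load \<tau> i1)" and ?l1 = "real (load \<tau> i1)"
    define w where "w = (1 - e) * ?b1 + e * ?l1"
    have qe: "real q * e = real p" using q by (simp add: e_def)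
    have scale: "real (p * l + (q - p) * b) = real q * ((1 - e) * b + e * l)" for b l :: nat
    proof -
      have "real (p * l + (q - p) * b) = (real q * e) * l + (real q - real q * e) * b"
        unfolding qe using pq(2) by (simp add: of_nat_diff)
      then show ?thesis by (simp add: algebra_simps)
    qed
    have qw: "real q * w = real W0" unfolding w_def i1(2) scale ..
    have "K * q < W0" using False \<open>T \<le> W0\<close> by linarith
    then have "real (K * q) < real W0" by (rule of_nat_less_iff[THEN iffD2])
    then have "real q * real K < real q * w" unfolding qw by (simp add: mult.commute)
    then have Kw: "real K < w" using q by simp
    have "real (p * load \<sigma> i + (q - p) * big_load \<sigma> i) < real (T + q)"
      using good False i by (intro of_nat_less_iff[THEN iffD2]) (simp add: good_def)
    also have "\<dots> \<le> real q * (w + 1)" using \<open>T \<le> W0\<close> by (simp add: distrib_left qw)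
    also have "real (p * load \<sigma> i + (q - p) * big_load \<sigma> i) = real q * ((1 - e) * ?b + e * ?l)"
      by (rule scale)
    finally have "(1 - e) * ?b + e * ?l < w + 1" using q by simp
    \<comment> \<open>Shortening the small jobs from \<open>e\<close> to \<open>\<epsilon>\<close>
      cannot increase a load.\<close>
    moreover have "(1 - \<epsilon>) * ?b + \<epsilon> * ?l \<le> (1 - e) * ?b + e * ?l"
    proof -
      have "0 \<le> (e - \<epsilon>) * (?l - ?b)" using e big_load_le[of \<sigma> i] by simp
      then show ?thesis by (simp add: algebra_simps)
    qed
    moreover have "w + 1 \<le> (1 + 1 / K) * w" using Kw K by (simp add: field_simps)
    ultimately have "(1 - \<epsilon>) * ?b + \<epsilon> * ?l \<le> (1 + 1 / K) * w" by linarith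
    then have "\<epsilon> * ((1 - \<epsilon>) * ?b + \<epsilon> * ?l) \<le> (1 + 1 / K) * (\<epsilon> * w)"
      using \<epsilon> by (simp add: mult.left_commute)
    also have "\<dots> \<le> (1 + 1 / K) * (e * Opt)"
    proof (rule mult_left_mono)
      \<comment> \<open>The left-hand side exceeds \<open>\<epsilon> * w\<close> by
        \<open>(e - \<epsilon>) * ?b1\<close>: lengthening the small jobs from
        \<open>\<epsilon>\<close> to \<open>e\<close> multiplies a load by at most
        \<open>e / \<epsilon>\<close>.\<close>
      have "e * ((1 - \<epsilon>) * ?b1 + \<epsilon> * ?l1) \<le> e * Opt" using opt[OF i1(1)] e \<epsilon> by (intro mult_left_mono) auto
      moreover have "\<epsilon> * ?b1 \<le> e * ?b1" using e by (intro mult_right_mono) auto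
      ultimately show "\<epsilon> * w \<le> e * Opt" by (simp add: w_def algebra_simps)
    qed simp
    also have "\<dots> = ((1 + 1 / K) * (p / q)) * Opt" by (simp add: e_def)
    also have "\<dots> \<le> ((2 - \<epsilon>) * \<epsilon>) * Opt"
      using slack opt_big[OF i] by (intro mult_right_mono) auto
    finally have "\<epsilon> * ((1 - \<epsilon>) * ?b + \<epsilon> * ?l) \<le> \<epsilon> * ((2 - \<epsilon>) * Opt)" by (simp add: ac_simps)
    then show ?thesis using \<epsilon>(1) by simp
  qed
qed

end

text \<open>There are only finitely many fractions \<open>b / t > \<epsilon>\<close> with \<open>b \<le> K\<close>, so \<open>p / q\<close> can be chosen between
  \<open>\<epsilon>\<close> and all of them.\<close>

lemma exists_rational_approximation:
  fixes \<epsilon> :: real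
  assumes \<epsilon>: "0 < \<epsilon>" "\<epsilon> < 1"
  obtains p q K :: nat where "0 < p" "p \<le> q" "\<epsilon> \<le> p / q" "0 < K"
    "\<And>b t :: nat. b \<le> K \<Longrightarrow> q * b \<le> p * t \<Longrightarrow> b \<le> \<epsilon> * t"
    "(1 + 1 / K) * (p / q) \<le> (2 - \<epsilon>) * \<epsilon>"
proof -
  \<comment> \<open>This makes \<open>1 + 1 / K\<close> at most \<open>(3 - \<epsilon>) / 2\<close>,
    the midpoint of 1 and \<open>2 - \<epsilon>\<close>; the remaining factor is left for the error
    of \<open>p / q\<close>.\<close>
  define K where "K = nat \<lceil>2 / (1 - \<epsilon>)\<rceil>"
  have "2 / (1 - \<epsilon>) \<le> real K" unfolding K_def by linarith
  moreover have "0 < 2 / (1 - \<epsilon>)" using \<epsilon> by simp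
  ultimately have K0: "0 < real K" and "2 / (1 - \<epsilon>) \<le> real K" by linarith+
  then have K: "0 < real K" "1 / K \<le> (1 - \<epsilon>) / 2"
    using \<epsilon> by (simp_all add: divide_le_eq le_divide_eq mult.commute)
  \<comment> \<open>For \<open>b \<le> K\<close> and \<open>t > M\<close> the quotient
    \<open>b / t\<close> is below \<open>\<epsilon>\<close>, so only finitely many denominators
    matter.\<close>
  define M where "M = nat \<lceil>real K / \<epsilon>\<rceil>"
  have M: "real K / \<epsilon> \<le> real M" unfolding M_def by linarith
  \<comment> \<open>Division by zero gives 0, hence \<open>t = 0\<close> contributes nothing to
    \<open>F\<close>.\<close>
  define F where "F = {real b / real t |b t. b \<le> K \<and> t \<le> M \<and> \<epsilon> < real b / real t}"
  have "F \<subseteq> (\<lambda>(b, t). real b / real t) ` ({..K} \<times> {..M})" by (auto simp: F_def)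
  then have "finite F" by (rule finite_subset) simp
  \<comment> \<open>\<open>2 * (2 - \<epsilon>) / (3 - \<epsilon>)\<close> is
    \<open>2 - \<epsilon>\<close> divided by the bound \<open>(3 - \<epsilon>) / 2\<close> for
    \<open>1 + 1 / K\<close>, and it exceeds 1 because of \<open>\<epsilon> < 1\<close>. The minimum
    with 1 ensures \<open>p \<le> q\<close>.\<close>
  define c where "c = Min (insert (min 1 (\<epsilon> * (2 * (2 - \<epsilon>) / (3 - \<epsilon>)))) F)"
  have "1 < 2 * (2 - \<epsilon>) / (3 - \<epsilon>)" using \<epsilon> by (simp add: field_simps)
  then have "\<epsilon> < \<epsilon> * (2 * (2 - \<epsilon>) / (3 - \<epsilon>))" using \<epsilon> by (metis mult.right_neutral mult_less_cancel_left_pos)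
  then have "\<epsilon> < c" using \<open>finite F\<close> \<epsilon> by (auto simp: c_def F_def)
  then obtain r where r: "r \<in> \<rat>" "\<epsilon> < r" "r < c" using Rats_dense_in_real by blast
  have c_le: "c \<le> x" if "x \<in> insert (min 1 (\<epsilon> * (2 * (2 - \<epsilon>) / (3 - \<epsilon>)))) F" for x
    unfolding c_def using \<open>finite F\<close> that by (intro Min_le) auto
  then have c: "c \<le> 1" "c \<le> \<epsilon> * (2 * (2 - \<epsilon>) / (3 - \<epsilon>))" and cF: "\<And>x. x \<in> F \<Longrightarrow> c \<le> x"
    by (simp_all add: min_le_iff_disj) (metis insertI1 min.bounded_iff)+
  obtain p q :: nat where pq: "q \<noteq> 0" "\<bar>r\<bar> = real p / real q" using Rats_abs_nat_div_natE[OF r(1)] by metis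
  have rpq: "r = real p / real q" using pq r(2) \<epsilon> by simp
  have "0 < r" "r < 1" using r c \<epsilon> by simp_all
  show thesis
  proof (rule that)
    show "0 < p" using \<open>0 < r\<close> rpq by (cases p) auto
    show "p \<le> q" using \<open>r < 1\<close> rpq pq(1) by (simp add: field_simps)
    show "\<epsilon> \<le> p / q" using r rpq by simp
    show "0 < K" using K by simp
    show "real b \<le> \<epsilon> * real t" if "b \<le> K" "q * b \<le> p * t" for b t :: nat
    proof (rule ccontr)
      assume "\<not> real b \<le> \<epsilon> * real t"
      then have less: "\<epsilon> * real t < real b" by simp
      then have "b \<noteq> 0" using \<epsilon> by (cases b) (auto simp: mult_less_0_iff)
      then have "t \<noteq> 0" using that pq by (cases t) auto
      have "\<epsilon> * real t < real K" using less that by linarith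
      then have "real t < real K / \<epsilon>" using \<epsilon> by (simp add: field_simps)
      then have "t \<le> M" using M by linarith
      moreover have "\<epsilon> < real b / real t" using less \<open>t \<noteq> 0\<close> by (simp add: field_simps)
      ultimately have "c \<le> real b / real t" using that by (intro cF) (auto simp: F_def)
      moreover have "real (q * b) \<le> real (p * t)" using that by (intro of_nat_mono)
      then have "real b / real t \<le> r" using pq \<open>t \<noteq> 0\<close> by (simp add: rpq field_simps)
      ultimately show False using r by linarith
    qed
    have "1 + 1 / K \<le> (3 - \<epsilon>) / 2" using K by argo
    moreover have "r \<le> \<epsilon> * (2 * (2 - \<epsilon>) / (3 - \<epsilon>))"
      by (rule order_trans[OF less_imp_le[OF r(3)] c(2)])
    ultimately have "(1 + 1 / K) * r \<le> ((3 - \<epsilon>) / 2) * (\<epsilon> * (2 * (2 - \<epsilon>) / (3 - \<epsilon>)))"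
      using \<open>0 < r\<close> \<epsilon> by (intro mult_mono) simp_all
    also have "\<dots> = (2 - \<epsilon>) * \<epsilon>" using \<epsilon> by (simp add: field_simps)
    finally show "(1 + 1 / K) * (p / q) \<le> (2 - \<epsilon>) * \<epsilon>" by (simp add: rpq)
  qed
qed

section \<open>Access to the encoded instance\<close>

lemma length_concat_rows: "length (concat (map (\<lambda>j. map (f j) [0..<m]) [0..<n])) = m * n"
  by (induction n) simp_all

lemma nth_concat_rows:
  "i < m \<Longrightarrow> j < n \<Longrightarrow> concat (map (\<lambda>j. map (f j) [0..<m]) [0..<n]) ! (m * j + i) = f j i"
proof (induction n)
  case (Suc n)
  show ?case
  proof (cases "j = n")
    case True
    then show ?thesis using Suc.prems by (simp add: nth_append length_concat_rows)
  next
    case False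
    then have "j < n" using Suc.prems by simp
    then have "m * Suc j \<le> m * n" by (intro mult_le_mono2) simp
    then have "m * j + i < m * n" using Suc.prems by simp
    then show ?thesis using Suc.IH Suc.prems \<open>j < n\<close> by (simp add: nth_append length_concat_rows)
  qed
qed simp

lemma input_encode:
  fixes I :: "(nat, nat) assignment_instance"
  defines "m \<equiv> card (machines I)" and "n \<equiv> card (jobs I)"
  shows "input_store (encode I) ''in'' 0 = m" and "input_store (encode I) ''in'' 1 = n"
    and "j < n \<Longrightarrow> input_store (encode I) ''in'' (2 + j) = of_bool (ptime I j = 1)"
    and "i < m \<Longrightarrow> j < n \<Longrightarrow> input_store (encode I) ''in'' (2 + n + m * j + i) = of_bool (i \<in> allowed I j)"
proof -
  let ?rows = "concat (map (\<lambda>j. map (\<lambda>i. of_bool (i \<in> allowed I j)) [0..<m]) [0..<n]) :: nat list"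
  have enc: "encode I = m # n # map (\<lambda>j. of_bool (ptime I j = 1)) [0..<n] @ ?rows"
    by (simp add: encode_def m_def n_def Let_def)
  show "input_store (encode I) ''in'' 0 = m" "input_store (encode I) ''in'' 1 = n"
    by (simp_all add: input_store_def enc)
  show "input_store (encode I) ''in'' (2 + j) = of_bool (ptime I j = 1)" if "j < n"
    using that by (simp add: input_store_def enc nth_append)
  assume ij: "i < m" "j < n"
  then have "m * Suc j \<le> m * n" by (intro mult_le_mono2) simp
  then have "m * j + i < m * n" using ij by simp
  then show "input_store (encode I) ''in'' (2 + n + m * j + i) = of_bool (i \<in> allowed I j)"
    using nth_concat_rows[OF ij, of "\<lambda>j i. of_bool (i \<in> allowed I j)"]
    by (simp add: input_store_def enc nth_append length_concat_rows add.assoc)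
qed

text \<open>The time bound is built by semiring operations from \<open>z\<close> and constants, and
  evaluation of polynomials commutes with these.\<close>

lemma poly_algorithm_time: "poly (algorithm_time p q [:0, 1:]) z = algorithm_time p q (z :: nat)"
  by (simp add: algorithm_time_def search_time_def round_time_def round_slots_def attempt_time_def
      solve_time_def algebra_simps)

lemma finite_schedules: "restricted_assignment I \<Longrightarrow> finite (schedules I)"
  unfolding schedules_def restricted_assignment_def
  by (intro finite_PiE) (blast intro: finite_subset)+

theorem theorem5:
  fixes \<epsilon> :: real
  assumes "0 < \<epsilon>" and "\<epsilon> < 1"
  shows "\<exists>A :: prog. poly_time_approximation \<epsilon> (2 - \<epsilon>) A"
proof -
  obtain p q K :: nat where pq: "0 < p" "p \<le> q" "\<epsilon> \<le> p / q" and K: "0 < K"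
    and exact: "\<And>b t :: nat. b \<le> K \<Longrightarrow> q * b \<le> p * t \<Longrightarrow> b \<le> \<epsilon> * t"
    and slack: "(1 + 1 / K) * (p / q) \<le> (2 - \<epsilon>) * \<epsilon>"
    by (rule exists_rational_approximation[OF assms]) blast
  have "\<exists>t s. exec (algorithm p q K) (input_store (encode I)) t s \<and>
      t \<le> poly (algorithm_time p q [:0, 1:]) (instance_size I) \<and>
      (schedules I \<noteq> {} \<longrightarrow> output_schedule I s \<in> schedules I \<and>
        makespan I (output_schedule I s) \<le> (2 - \<epsilon>) * OPT I)"
    if I: "one_eps_case \<epsilon> I" and num: "numbered I" for I :: "(nat, nat) assignment_instance"
  proof -
    define m where "m = card (machines I)"
    define n where "n = card (jobs I)"
    define big where "big j \<longleftrightarrow> ptime I j = 1" for j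
    interpret assignment m n big "allowed I" .
    have mn: "machines I = {..<m}" "jobs I = {..<n}" using num by (simp_all add: numbered_def m_def n_def)
    have R: "restricted_assignment I" using I by (simp add: one_eps_case_def)
    then have "0 < m" and allowed: "\<And>j. j < n \<Longrightarrow> allowed I j \<subseteq> {..<m}"
      using mn by (auto simp: restricted_assignment_def)
    \<comment> \<open>Being affine in the flag, processing times add up to an expression in
      \<open>big_load\<close> and \<open>load\<close> only.\<close>
    have ptime: "ptime I j = (1 - \<epsilon>) * of_bool (big j) + \<epsilon>" if "j < n" for j
      using I that mn by (auto simp: one_eps_case_def big_def)
    have span: "makespan I \<sigma> \<le> c \<longleftrightarrow> (\<forall>i<m. (1 - \<epsilon>) * big_load \<sigma> i + \<epsilon> * load \<sigma> i \<le> c)" for \<sigma> c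
    proof -
      have "(\<Sum>j\<in>{j \<in> jobs I. \<sigma> j = i}. ptime I j) = (1 - \<epsilon>) * big_load \<sigma> i + \<epsilon> * load \<sigma> i" for i
      proof -
        let ?S = "{j. j < n \<and> \<sigma> j = i}"
        have "{j \<in> jobs I. \<sigma> j = i} = ?S" using mn by auto
        then have "(\<Sum>j\<in>{j \<in> jobs I. \<sigma> j = i}. ptime I j) = (\<Sum>j\<in>?S. (1 - \<epsilon>) * of_bool (big j) + \<epsilon>)"
          using ptime by (intro sum.cong) auto
        also have "\<dots> = (1 - \<epsilon>) * (\<Sum>j\<in>?S. of_bool (big j)) + \<epsilon> * load \<sigma> i"
          by (simp add: sum.distrib sum_distrib_left load_def)
        also have "(\<Sum>j\<in>?S. of_bool (big j)) = real (big_load \<sigma> i)"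
        proof -
          have "?S \<inter> {j. big j} = {j. (j < n \<and> big j) \<and> \<sigma> j = i}" by auto
          then show ?thesis by (simp add: big_load_def)
        qed
        finally show ?thesis .
      qed
      then show ?thesis
        unfolding makespan_def mn(1) using \<open>0 < m\<close> by (subst Max_le_iff) auto
    qed
    \<comment> \<open>The output is restricted to the jobs, so it agrees with the array
      \<open>out\<close> only there.\<close>
    have load_cong: "load \<sigma> i = load \<sigma>' i" "big_load \<sigma> i = big_load \<sigma>' i"
      if "\<And>j. j < n \<Longrightarrow> \<sigma> j = \<sigma>' j" for \<sigma> \<sigma>' i
      using that by (auto simp: load_def big_load_def intro!: arg_cong[where f = card])
    have z: "m \<le> instance_size I" "n \<le> instance_size I" by (simp_all add: instance_size_def m_def n_def)
    have "wp (algorithm p q K) (\<lambda>t s'. t \<le> algorithm_time p q (instance_size I) \<and>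
      ((\<exists>T\<le>n * q. \<exists>y. trial p q K T y) \<longrightarrow>
       (\<exists>T. (\<forall>T'<T. \<not> (\<exists>y. trial p q K T' y)) \<and> good p q K T (s' ''out'')))) (input_store (encode I))"
      by (rule wp_algorithm[OF _ _ _ _ pq(1,2) z])
        (simp_all add: input_encode m_def n_def big_def del: One_nat_def add_2_eq_Suc)
    then obtain t s where exec: "exec (algorithm p q K) (input_store (encode I)) t s"
      and t: "t \<le> algorithm_time p q (instance_size I)"
      and out: "(\<exists>T\<le>n * q. \<exists>y. trial p q K T y) \<longrightarrow>
        (\<exists>T. (\<forall>T'<T. \<not> (\<exists>y. trial p q K T' y)) \<and> good p q K T (s ''out''))"
      unfolding wp_def by blast
    have "output_schedule I s \<in> schedules I \<and> makespan I (output_schedule I s) \<le> (2 - \<epsilon>) * OPT I"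
      if ne: "schedules I \<noteq> {}"
    proof -
      have "OPT I \<in> makespan I ` schedules I"
        unfolding OPT_def using finite_schedules[OF R] ne by (intro Min_in) auto
      then obtain \<tau> where \<tau>: "\<tau> \<in> schedules I" "OPT I = makespan I \<tau>" by auto
      have "valid \<tau>" using \<tau>(1) allowed mn by (fastforce simp: valid_def schedules_def PiE_iff)
      moreover have "(1 - \<epsilon>) * big_load \<tau> i + \<epsilon> * load \<tau> i \<le> OPT I" if "i < m" for i
        using span[of \<tau> "OPT I"] \<tau>(2) that by simp
      ultimately have approx: "\<exists>T\<le>n * q. \<exists>y. trial p q K T y"
        "\<And>T \<sigma> i. \<forall>T'<T. \<not> (\<exists>y. trial p q K T' y) \<Longrightarrow> good p q K T \<sigma> \<Longrightarrow> i < m \<Longrightarrow>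
          (1 - \<epsilon>) * big_load \<sigma> i + \<epsilon> * load \<sigma> i \<le> (2 - \<epsilon>) * OPT I"
        using good_approximates[OF assms pq K exact slack \<open>0 < m\<close>] by blast+
      then obtain T where T: "\<forall>T'<T. \<not> (\<exists>y. trial p q K T' y)" "good p q K T (s ''out'')"
        using out by blast
      have "output_schedule I s \<in> schedules I"
        using T(2) mn by (auto simp: good_def valid_def output_schedule_def schedules_def PiE_iff)
      moreover have "output_schedule I s j = s ''out'' j" if "j < n" for j
        using that mn by (simp add: output_schedule_def)
      then have "makespan I (output_schedule I s) \<le> (2 - \<epsilon>) * OPT I"
        unfolding span using approx(2)[OF T] load_cong[of "output_schedule I s" "s ''out''"] by simp
      ultimately show ?thesis by blast
    qed
    then show ?thesis unfolding poly_algorithm_time using exec t by blast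
  qed
  then show ?thesis
    unfolding poly_time_approximation_def by blast
qed

end
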